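(* (1) Every $(X,\sigma)\in\mathsf{LHomeo}$ admits a $\sigma$-refined sequence of partitions, and the separated graph $(F,D)$ built from any such sequence by Construction I is an $l$-diagram. Its class under $\sim_l$ depends only on the topological conjugacy class of $(X,\sigma)$. Hence there is a well-defined map $\Phi:\mathsf{LHomeo}/\!\sim_{t.c.}\;\to\;\mathsf{LDiag}/\!\sim_l$, $[(X,\sigma)]\mapsto[(F,D)]$. (2) For every $l$-diagram $(F,D)$, the pair $(X,\sigma)$ built from $(F,D)$ by Construction II belongs to $\mathsf{LHomeo}$, and its topological conjugacy class depends only on the class of $(F,D)$ under $\sim_l$. Hence there is a well-defined map $\Psi:\mathsf{LDiag}/\!\sim_l\;\to\;\mathsf{LHomeo}/\!\sim_{t.c.}$, $[(F,D)]\mapsto[(X,\sigma)]$. (3) The maps $\Phi$ and $\Psi$ are inverse to each other. In particular there is a bijective correspondence between equivalence classes of $l$-diagrams under $\sim_l$ and topological conjugacy classes of surjective local homeomorphisms on totally disconnected compact metrizable spaces.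
   Context: **Dynamical systems.** $\mathsf{LHomeo}$ is the class of pairs $(X,\sigma)$, with $X$ a nonempty totally disconnected compact metrizable space and $\sigma:X\to X$ a surjective local homeomorphism (continuous, and each point has an open neighbourhood $U$ with $\sigma(U)$ open and $\sigma|_U:U\to\sigma(U)$ a homeomorphism). $(X_1,\sigma_1)\sim_{t.c.}(X_2,\sigma_2)$ (topologically conjugate) means that there is a homeomorphism $h:X_1\to X_2$ with $h\circ\sigma_1=\sigma_2\circ h$. **Separated Bratteli diagrams.** A directed graph $E=(E^0,E^1,r,s)$ has vertices $E^0$, edges $E^1$, range and source maps $r,s:E^1\to E^0$. A separated graph $(E,C)$ is a directed graph with $C=\bigsqcup_{v\in E^0}C_v$, where $C_v$ is a partition of $r^{-1}(v)$ into pairwise disjoint nonempty subsets ($C_v=\emptyset$ if $r^{-1}(v)=\emptyset$). A separated Bratteli diagram is a separated graph $(F,D)$ such that $F^0$ is the disjoint union of finite nonempty sets $F^{0,j}$ ($j\ge0$), $F^1$ is the disjoint union of finite nonempty sets $F^{1,j}$ ($j\ge0$), and $r(F^{1,j})=F^{0,j}$, $s(F^{1,j})=F^{0,j+1}$. **$l$-diagrams.** A separated Bratteli diagram $(F,D)$ (with the colour data below) is an $l$-diagram if: (a) For $j\ge0$, $v\in F^{0,2j}$: $D_v=\{B_v,R_v\}$ for nonempty $B_v,R_v\subseteq r^{-1}(v)$; elements of $B_v$ are blue edges, elements of $R_v$ are red edges. (b) For $j\ge1$, $v\in F^{0,2j-1}$: $D_v=\{B_v\}\cup\{R(f)\mid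 f\in R_{r(f)},\ s(f)=v\}$ for nonempty $B_v,R(f)\subseteq r^{-1}(v)$. Elements of $B_v$ are blue; $R_v:=\bigcup_{f\in s^{-1}(v)\cap R_{r(f)}}R(f)$ and its elements are red. (c) For $j\ge1$: $F^{0,2j}=\bigsqcup_{v\in F^{0,2j-1}}s(B_v)=\bigsqcup_{v\in F^{0,2j-1}}s(R_v)$; and for $v\in F^{0,2j-1}$ distinct edges of $B_v$ have distinct sources, and distinct edges of $R_v$ have distinct sources. (d) $F^{0,1}=\bigsqcup_{v\in F^{0,0}}s(B_v)$ and $F^{0,1}=\bigcup_{v\in F^{0,0}}s(R_v)$. Moreover $s(e)\ne s(e')$ for all distinct $e\in B_{v_1}$, $e'\in B_{v_2}$, for any $v_1,v_2\in F^{0,2j}$, $j\ge0$. (e) For $j\ge0$, $v\in F^{0,2j}$: $\bigsqcup_{e\in B_v}s(B_{s(e)})=\bigsqcup_{f\in R_v}s(R(f))$. (f) For $j\ge1$, $v\in F^{0,2j-1}$ and each pair $(f_0,f_1)$ of red edges with $r(f_0)=v$, $s(f_0)=r(f_1)$, there is a (unique) pair $(e_0,e_1)$ of blue edges with $r(e_0)=v$, $s(e_0)=r(e_1)$, $s(e_1)=s(f_1)$. (g) For $j\ge1$, $v\in F^{0,2j-1}$, each red edge $g\in R_{r(g)}$ with $s(g)=v$, and each pair $(e_0,e_1)$ of blue edges with $r(e_0)=v$, $s(e_0)=r(e_1)$, there is a unique pair $(f_0,f_1)$ of red edges with $f_0\in R(g)$, $r(f_0)=v$, $s(f_0)=r(f_1)$,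 $s(f_1)=s(e_1)$. $\mathsf{LDiag}$ is the class of $l$-diagrams. **The relation $\sim_l$.** For $j<l$ let $P^B_{j,l}$ be the set of tuples $(e_j,\dots,e_{l-1})$ of blue edges $e_i\in F^{1,i}$ with $s(e_i)=r(e_{i+1})$, and $P^R_{j,l}$ the set of tuples $(f_j,\dots,f_{l-1})$ of red edges $f_i\in F^{1,i}$ with $s(f_i)=r(f_{i+1})$ and $f_{i+1}\in R(f_i)$ whenever $i$ is even. The range of a tuple is the range of its first entry; its source is the source of its last entry. Given integers $0\le m_0<m_1<\cdots$ with $m_0$ even and all $m_{n+1}-m_n$ odd, the contraction $(F',D')$ of $(F,D)$ has $(F')^{0,n}=F^{0,m_n}$, $(F')^{1,n}=P^B_{m_n,m_{n+1}}\sqcup P^R_{m_n,m_{n+1}}$ (blue and red edges respectively); for $v\in(F')^{0,2j}$, $D'_v=\{B'_v,R'_v\}$, the sets of blue, resp. red, edges with range $v$; for $v\in(F')^{0,2j+1}$, $D'_v=\{B'_v\}\cup\{R'(\hat f)\}$, with $B'_v$ the set of blue edges with range $v$, $\hat f$ running over the red edges in $(F')^{1,2j}$ with $s(\hat f)=v$, and $R'(\hat f)$ the set of tuples in $P^R_{m_{2j+1},m_{2j+2}}$ whose first entry lies in $R(\text{last entry of }\hat f)$. An isomorphism of $l$-diagrams is a pair of bijections on vertices and edges respecting levels, $r$, $s$, colours, separations, i.e. $\phi_1((B_1)_v)=(B_2)_{\phi_0(v)}$ for all $v$, $\phi_1((R_1)_v)=(R_2)_{\phi_0(v)}$ for $v$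 at even levels, and $\phi_1(R_1(f))=R_2(\phi_1(f))$ for $v$ at odd levels and red $f$ with $s(f)=v$. $\sim_l$ is the equivalence relation on $\mathsf{LDiag}$ generated by isomorphism and by "$(F',D')$ is a contraction of $(F,D)$". **$\sigma$-refined sequences.** A partition of $X$ is a finite family of nonempty pairwise disjoint clopen sets with union $X$. $\mathcal P_1\precsim\mathcal P_2$ means every element of $\mathcal P_2$ is contained in an element of $\mathcal P_1$; $\mathcal P_1\vee\mathcal P_2$ is the family of nonempty intersections $Z_1\cap Z_2$, $Z_i\in\mathcal P_i$; $\operatorname{diam}(\mathcal P)$ is the maximal diameter of its elements (for a fixed compatible metric). Let $N(\sigma)=\sup_x|\sigma^{-1}(\{x\})|<\infty$ and $\mathcal U_{\ge k}=\{x:|\sigma^{-1}(\{x\})|\ge k\}$. If $\sigma$ is injective on each element of $\mathcal P$, put $\mathcal P^\sigma=\bigcup_{k=1}^{N(\sigma)}\{\sigma(Z_1)\cap\dots\cap\sigma(Z_k)\setminus\mathcal U_{\ge k+1}\ne\emptyset\mid Z_i\in\mathcal P\text{ all different}\}$, and $\sigma^{-1}(\mathcal P)=\{\sigma^{-1}(Z)\mid Z\in\mathcal P\}$; these are partitions of $X$. A sequence $\{\mathcal P_n\}_{n\ge0}$ of partitions is $\sigma$-refined if: $\sigma|_Z$ is a homeomorphism onto its image for each $Z\in\mathcal P_0$; $\mathcal P_n\precsim\mathcal P_{n+1}$; $\bigcup_n\mathcal P_n$ generates the topology; $\operatorname{diam}(\mathcal P_n)\to0$; and $\mathcal P_{2j}\vee\mathcal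 P_{2j}^\sigma\precsim\mathcal P_{2j+1}$, $\mathcal P_{2j+1}\vee\sigma^{-1}(\mathcal P_{2j+1})\precsim\mathcal P_{2j+2}$ for all $j\ge0$. **Construction I.** Given a $\sigma$-refined sequence, let $F^{0,n}=\mathcal P_n$. Blue edges in $F^{1,n}$: one edge $Z'\to Z$ (source $Z'$, range $Z$) for each $Z\in\mathcal P_n$, $Z'\in\mathcal P_{n+1}$ with $Z'\subseteq Z$. Red edges in $F^{1,2j}$: one edge with source $Z'\in\mathcal P_{2j+1}$ and range $Z\in\mathcal P_{2j}$ whenever $Z'\subseteq\sigma(Z)$. Red edges in $F^{1,2j+1}$: one edge with source $Z''\in\mathcal P_{2j+2}$ and range $Z'\in\mathcal P_{2j+1}$ whenever $\sigma(Z'')\subseteq Z'$. $B_Z,R_Z$ denote the sets of blue, red edges with range $Z$. For $Z\in\mathcal P_{2j}$, $D_Z=\{B_Z,R_Z\}$; for $Z'\in\mathcal P_{2j+1}$, $D_{Z'}=\{B_{Z'}\}\cup\{R(f)\mid f\text{ red},\ s(f)=Z'\}$, where $R(f)$ is the set of $g\in R_{Z'}$ with $s(g)\subseteq r(f)$. **Construction II.** Given an $l$-diagram $(F,D)$, let $X$ be the set of infinite sequences $(e_0,e_1,\dots)$ of blue edges $e_i\in F^{1,i}$ with $r(e_{i+1})=s(e_i)$, with topology generated by the cylinder sets $Z(e_0,\dots,e_n)$ (sequences starting with $e_0,\dots,e_n$). For $v\in F^{0,2j}$ and a pair of blue edges $(e_0,e_1)$ with $r(e_0)=v$, $r(e_1)=s(e_0)$,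 there is a unique pair of red edges $(f_0,f_1)$ with $r(f_0)=v$, $r(f_1)=s(f_0)$, $s(f_1)=s(e_1)$ and $f_1\in R(f_0)$. Given $(e_0,e_1,\dots)\in X$, let $(f_{2j},f_{2j+1})$ be the red pair so associated to $(e_{2j},e_{2j+1})$, $j\ge0$; then $s(f_{2j-1})=r(f_{2j})$, and for $j\ge1$ let $(e'_{2j-1},e'_{2j})$ be the blue pair associated to $(f_{2j-1},f_{2j})$ by (f); let $e'_0$ be the unique blue edge with $s(e'_0)=r(e'_1)$. Then $\sigma(e_0,e_1,\dots):=(e'_0,e'_1,\dots)$. *)

theory Defs
  imports "HOL-Analysis.Analysis"
begin

section \<open>Surjective local homeomorphisms\<close>

definition totally_disconnected_space :: "'a topology \<Rightarrow> bool" where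
  "totally_disconnected_space X \<longleftrightarrow> (\<forall>S. connectedin X S \<longrightarrow> (\<exists>a. S \<subseteq> {a}))"

definition local_homeomorphism :: "'a topology \<Rightarrow> ('a \<Rightarrow> 'a) \<Rightarrow> bool" where
  "local_homeomorphism X \<sigma> \<longleftrightarrow>
     continuous_map X X \<sigma> \<and>
     (\<forall>x \<in> topspace X. \<exists>U. openin X U \<and> x \<in> U \<and> openin X (\<sigma> ` U) \<and>
        homeomorphic_map (subtopology X U) (subtopology X (\<sigma> ` U)) \<sigma>)"

definition LHomeo :: "('a topology \<times> ('a \<Rightarrow> 'a)) set" where
  "LHomeo = {(X, \<sigma>). topspace X \<noteq> {} \<and> totally_disconnected_space X \<and> compact_space X \<and>
     metrizable_space X \<and> local_homeomorphism X \<sigma> \<and> \<sigma> ` topspace X = topspace X}"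

definition top_conj :: "('a topology \<times> ('a \<Rightarrow> 'a)) \<Rightarrow> ('b topology \<times> ('b \<Rightarrow> 'b)) \<Rightarrow> bool" where
  "top_conj p q \<longleftrightarrow>
     (\<exists>h. homeomorphic_map (fst p) (fst q) h \<and>
          (\<forall>x \<in> topspace (fst p). h (snd p x) = snd q (h x)))"

definition tc_rel :: "(('a topology \<times> ('a \<Rightarrow> 'a)) \<times> ('a topology \<times> ('a \<Rightarrow> 'a))) set" where
  "tc_rel = {(p, q). p \<in> LHomeo \<and> q \<in> LHomeo \<and> top_conj p q}"

text \<open>The quotients of the two proper classes are formed over fixed types that contain a copy of
  every object: spaces on subsets of \<^typ>\<open>nat \<Rightarrow> nat\<close> (a nonempty totally disconnected compact
  metrizable space embeds in the Cantor set), and, below, diagrams with vertices and edges of type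
  \<^typ>\<open>nat\<close> (diagrams are countable).  An object over any other type determines the class of its
  copies.\<close>

definition tc_class ::
  "('a topology \<times> ('a \<Rightarrow> 'a)) \<Rightarrow> ((nat \<Rightarrow> nat) topology \<times> ((nat \<Rightarrow> nat) \<Rightarrow> (nat \<Rightarrow> nat))) set" where
  "tc_class p = {q \<in> LHomeo. top_conj p q}"


section \<open>Separated Bratteli diagrams and \<open>l\<close>-diagrams\<close>

text \<open>\<open>verts F n\<close> and \<open>edges F n\<close> are the levels \<open>F\<^sup>0\<^sup>,\<^sup>n\<close> and \<open>F\<^sup>1\<^sup>,\<^sup>n\<close>, \<open>sep F v\<close> is \<open>D\<^sub>v\<close>.
  \<open>blue F v\<close>, \<open>red F v\<close> and \<open>redof F f\<close> are \<open>B\<^sub>v\<close>, \<open>R\<^sub>v\<close> and \<open>R(f)\<close>.\<close>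

record ('v, 'e) cdiagram =
  verts :: "nat \<Rightarrow> 'v set"
  edges :: "nat \<Rightarrow> 'e set"
  rng :: "'e \<Rightarrow> 'v"
  src :: "'e \<Rightarrow> 'v"
  sep :: "'v \<Rightarrow> 'e set set"
  blue :: "'v \<Rightarrow> 'e set"
  red :: "'v \<Rightarrow> 'e set"
  redof :: "'e \<Rightarrow> 'e set"

definition in_edges :: "('v, 'e) cdiagram \<Rightarrow> 'v \<Rightarrow> 'e set" where
  "in_edges F v = {e \<in> (\<Union>n. edges F n). rng F e = v}"

definition separated_bratteli :: "('v, 'e) cdiagram \<Rightarrow> bool" where
  "separated_bratteli F \<longleftrightarrow>
     (\<forall>n. finite (verts F n) \<and> verts F n \<noteq> {} \<and> finite (edges F n) \<and> edges F n \<noteq> {}) \<and>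
     disjoint_family (verts F) \<and> disjoint_family (edges F) \<and>
     (\<forall>n. rng F ` edges F n = verts F n \<and> src F ` edges F n = verts F (Suc n)) \<and>
     (\<forall>v \<in> (\<Union>n. verts F n). partition_on (in_edges F v) (sep F v))"

definition blue_edges :: "('v, 'e) cdiagram \<Rightarrow> nat \<Rightarrow> 'e set" where
  "blue_edges F n = {e \<in> edges F n. e \<in> blue F (rng F e)}"

definition red_edges :: "('v, 'e) cdiagram \<Rightarrow> nat \<Rightarrow> 'e set" where
  "red_edges F n = {e \<in> edges F n. e \<in> red F (rng F e)}"

text \<open>That the blue and red sets are nonempty sets of edges with range \<open>v\<close> is
  part of \<open>sep F v\<close> being a partition; that no edge is both blue and red has to be said, since
  \<open>{B\<^sub>v, R\<^sub>v}\<close> does not exclude \<open>B\<^sub>v = R\<^sub>v\<close>.\<close>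

definition l_colours :: "('v, 'e) cdiagram \<Rightarrow> bool" where
  "l_colours F \<longleftrightarrow>
     (\<forall>n. \<forall>v \<in> verts F n. blue F v \<inter> red F v = {}) \<and>
     (\<forall>j. \<forall>v \<in> verts F (2*j). sep F v = {blue F v, red F v}) \<and>
     (\<forall>j. \<forall>v \<in> verts F (2*j + 1).
        sep F v = insert (blue F v) (redof F ` {f \<in> red_edges F (2*j). src F f = v}) \<and>
        red F v = (\<Union>f \<in> {f \<in> red_edges F (2*j). src F f = v}. redof F f))"

definition l_even_level_sources :: "('v, 'e) cdiagram \<Rightarrow> bool" where
  "l_even_level_sources F \<longleftrightarrow> (\<forall>j.
     disjoint_family_on (\<lambda>v. src F ` blue F v) (verts F (2*j + 1)) \<and>
     verts F (2*j + 2) = (\<Union>v \<in> verts F (2*j + 1). src F ` blue F v) \<and>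
     disjoint_family_on (\<lambda>v. src F ` red F v) (verts F (2*j + 1)) \<and>
     verts F (2*j + 2) = (\<Union>v \<in> verts F (2*j + 1). src F ` red F v) \<and>
     (\<forall>v \<in> verts F (2*j + 1). inj_on (src F) (blue F v) \<and> inj_on (src F) (red F v)))"

text \<open>The last clause concerns all even levels, not only level 0.\<close>

definition l_first_level_sources :: "('v, 'e) cdiagram \<Rightarrow> bool" where
  "l_first_level_sources F \<longleftrightarrow>
     disjoint_family_on (\<lambda>v. src F ` blue F v) (verts F 0) \<and>
     verts F 1 = (\<Union>v \<in> verts F 0. src F ` blue F v) \<and>
     verts F 1 = (\<Union>v \<in> verts F 0. src F ` red F v) \<and>
     (\<forall>j. \<forall>v1 \<in> verts F (2*j). \<forall>v2 \<in> verts F (2*j). \<forall>e \<in> blue F v1. \<forall>e' \<in> blue F v2.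
        e \<noteq> e' \<longrightarrow> src F e \<noteq> src F e')"

definition l_two_step_sources :: "('v, 'e) cdiagram \<Rightarrow> bool" where
  "l_two_step_sources F \<longleftrightarrow> (\<forall>j. \<forall>v \<in> verts F (2*j).
     disjoint_family_on (\<lambda>e. src F ` blue F (src F e)) (blue F v) \<and>
     disjoint_family_on (\<lambda>f. src F ` redof F f) (red F v) \<and>
     (\<Union>e \<in> blue F v. src F ` blue F (src F e)) = (\<Union>f \<in> red F v. src F ` redof F f))"

definition l_red_to_blue :: "('v, 'e) cdiagram \<Rightarrow> bool" where
  "l_red_to_blue F \<longleftrightarrow> (\<forall>j. \<forall>v \<in> verts F (2*j + 1). \<forall>f0 \<in> red F v. \<forall>f1 \<in> red F (src F f0).
     \<exists>!p. fst p \<in> blue F v \<and> snd p \<in> blue F (src F (fst p)) \<and> src F (snd p) = src F f1)"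

definition l_blue_to_red :: "('v, 'e) cdiagram \<Rightarrow> bool" where
  "l_blue_to_red F \<longleftrightarrow> (\<forall>j. \<forall>v \<in> verts F (2*j + 1). \<forall>g \<in> red_edges F (2*j). src F g = v \<longrightarrow>
     (\<forall>e0 \<in> blue F v. \<forall>e1 \<in> blue F (src F e0).
        \<exists>!p. fst p \<in> redof F g \<and> rng F (fst p) = v \<and>
             snd p \<in> red F (src F (fst p)) \<and> src F (snd p) = src F e1))"

definition LDiag :: "('v, 'e) cdiagram set" where
  "LDiag = {F. separated_bratteli F \<and> l_colours F \<and> l_even_level_sources F \<and> l_first_level_sources F \<and>
     l_two_step_sources F \<and> l_red_to_blue F \<and> l_blue_to_red F}"


section \<open>The relation generated by isomorphism and contraction\<close>

definition blue_paths :: "('v, 'e) cdiagram \<Rightarrow> nat \<Rightarrow> nat \<Rightarrow> 'e list set" where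
  "blue_paths F j l = {es. length es = l - j \<and>
     (\<forall>i < l - j. es ! i \<in> blue_edges F (j + i)) \<and>
     (\<forall>i. Suc i < l - j \<longrightarrow> src F (es ! i) = rng F (es ! Suc i))}"

definition red_paths :: "('v, 'e) cdiagram \<Rightarrow> nat \<Rightarrow> nat \<Rightarrow> 'e list set" where
  "red_paths F j l = {fs. length fs = l - j \<and>
     (\<forall>i < l - j. fs ! i \<in> red_edges F (j + i)) \<and>
     (\<forall>i. Suc i < l - j \<longrightarrow> src F (fs ! i) = rng F (fs ! Suc i)) \<and>
     (\<forall>i. Suc i < l - j \<longrightarrow> even (j + i) \<longrightarrow> fs ! Suc i \<in> redof F (fs ! i))}"

definition contraction_levels :: "(nat \<Rightarrow> nat) \<Rightarrow> bool" where
  "contraction_levels m \<longleftrightarrow> even (m 0) \<and> (\<forall>n. m n < m (Suc n) \<and> odd (m (Suc n) - m n))"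

definition contr_blue :: "('v, 'e) cdiagram \<Rightarrow> (nat \<Rightarrow> nat) \<Rightarrow> 'v \<Rightarrow> 'e list set" where
  "contr_blue F m v = {p \<in> (\<Union>n. blue_paths F (m n) (m (Suc n))). rng F (hd p) = v}"

definition contr_red :: "('v, 'e) cdiagram \<Rightarrow> (nat \<Rightarrow> nat) \<Rightarrow> 'v \<Rightarrow> 'e list set" where
  "contr_red F m v = {p \<in> (\<Union>n. red_paths F (m n) (m (Suc n))). rng F (hd p) = v}"

definition contr_redof :: "('v, 'e) cdiagram \<Rightarrow> (nat \<Rightarrow> nat) \<Rightarrow> 'e list \<Rightarrow> 'e list set" where
  "contr_redof F m f = {g. \<exists>j. f \<in> red_paths F (m (2*j)) (m (2*j + 1)) \<and>
     g \<in> red_paths F (m (2*j + 1)) (m (2*j + 2)) \<and> hd g \<in> redof F (last f)}"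

definition contraction :: "('v, 'e) cdiagram \<Rightarrow> (nat \<Rightarrow> nat) \<Rightarrow> ('v, 'e list) cdiagram" where
  "contraction F m = \<lparr>
     verts = (\<lambda>n. verts F (m n)),
     edges = (\<lambda>n. blue_paths F (m n) (m (Suc n)) \<union> red_paths F (m n) (m (Suc n))),
     rng = (\<lambda>p. rng F (hd p)),
     src = (\<lambda>p. src F (last p)),
     sep = (\<lambda>v. if \<exists>j. v \<in> verts F (m (2*j)) then {contr_blue F m v, contr_red F m v}
        else insert (contr_blue F m v) (contr_redof F m `
          {f. \<exists>j. f \<in> red_paths F (m (2*j)) (m (2*j + 1)) \<and> src F (last f) = v})),
     blue = contr_blue F m,
     red = contr_red F m,
     redof = contr_redof F m\<rparr>"

definition ldiag_iso :: "('v, 'e) cdiagram \<Rightarrow> ('w, 'f) cdiagram \<Rightarrow> bool" where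
  "ldiag_iso F G \<longleftrightarrow> (\<exists>\<phi>0 \<phi>1.
     bij_betw \<phi>0 (\<Union>n. verts F n) (\<Union>n. verts G n) \<and>
     bij_betw \<phi>1 (\<Union>n. edges F n) (\<Union>n. edges G n) \<and>
     (\<forall>n. \<phi>0 ` verts F n = verts G n \<and> \<phi>1 ` edges F n = edges G n) \<and>
     (\<forall>e \<in> (\<Union>n. edges F n). rng G (\<phi>1 e) = \<phi>0 (rng F e) \<and> src G (\<phi>1 e) = \<phi>0 (src F e)) \<and>
     (\<forall>v \<in> (\<Union>n. verts F n). (`) \<phi>1 ` sep F v = sep G (\<phi>0 v) \<and>
        \<phi>1 ` blue F v = blue G (\<phi>0 v)) \<and>
     (\<forall>j. \<forall>v \<in> verts F (2*j). \<phi>1 ` red F v = red G (\<phi>0 v)) \<and>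
     (\<forall>j. \<forall>f \<in> red_edges F (2*j). \<phi>1 ` redof F f = redof G (\<phi>1 f)))"

text \<open>Contraction changes the edge type, so a contraction is compared with diagrams over
  \<^typ>\<open>nat\<close> up to isomorphism.\<close>

definition l_step :: "(nat, nat) cdiagram \<Rightarrow> (nat, nat) cdiagram \<Rightarrow> bool" where
  "l_step F G \<longleftrightarrow> F \<in> LDiag \<and> G \<in> LDiag \<and>
     (ldiag_iso F G \<or> (\<exists>m. contraction_levels m \<and> ldiag_iso (contraction F m) G))"

definition l_rel :: "((nat, nat) cdiagram \<times> (nat, nat) cdiagram) set" where
  "l_rel = {(F, G). F \<in> LDiag \<and> G \<in> LDiag \<and> equivclp l_step F G}"

definition l_class :: "('v, 'e) cdiagram \<Rightarrow> (nat, nat) cdiagram set" where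
  "l_class F = {G. \<exists>G0. ldiag_iso F G0 \<and> (G0, G) \<in> l_rel}"


section \<open>\<open>\<sigma>\<close>-refined sequences\<close>

definition clopen_partition :: "'a topology \<Rightarrow> 'a set set \<Rightarrow> bool" where
  "clopen_partition X P \<longleftrightarrow> finite P \<and> partition_on (topspace X) P \<and>
     (\<forall>Z \<in> P. openin X Z \<and> closedin X Z)"

definition refined_by :: "'a set set \<Rightarrow> 'a set set \<Rightarrow> bool" (infix \<open>\<precsim>p\<close> 50) where
  "P \<precsim>p Q \<longleftrightarrow> (\<forall>Z' \<in> Q. \<exists>Z \<in> P. Z' \<subseteq> Z)"

definition join :: "'a set set \<Rightarrow> 'a set set \<Rightarrow> 'a set set" (infixl \<open>\<or>p\<close> 65) where
  "P \<or>p Q = {Z1 \<inter> Z2 | Z1 Z2. Z1 \<in> P \<and> Z2 \<in> Q \<and> Z1 \<inter> Z2 \<noteq> {}}"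

definition compatible_metric :: "'a topology \<Rightarrow> ('a \<Rightarrow> 'a \<Rightarrow> real) \<Rightarrow> bool" where
  "compatible_metric X d \<longleftrightarrow>
     Metric_space (topspace X) d \<and> Metric_space.mtopology (topspace X) d = X"

definition set_diam :: "('a \<Rightarrow> 'a \<Rightarrow> real) \<Rightarrow> 'a set \<Rightarrow> real" where
  "set_diam d Z = Sup {d x y | x y. x \<in> Z \<and> y \<in> Z}"

definition partition_diam :: "('a \<Rightarrow> 'a \<Rightarrow> real) \<Rightarrow> 'a set set \<Rightarrow> real" where
  "partition_diam d P = Max (set_diam d ` P)"

definition fibre :: "'a topology \<Rightarrow> ('a \<Rightarrow> 'a) \<Rightarrow> 'a \<Rightarrow> 'a set" where
  "fibre X \<sigma> x = {y \<in> topspace X. \<sigma> y = x}"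

definition max_fibre :: "'a topology \<Rightarrow> ('a \<Rightarrow> 'a) \<Rightarrow> nat" where
  "max_fibre X \<sigma> = (SUP x \<in> topspace X. card (fibre X \<sigma> x))"

definition fibre_ge :: "'a topology \<Rightarrow> ('a \<Rightarrow> 'a) \<Rightarrow> nat \<Rightarrow> 'a set" where
  "fibre_ge X \<sigma> k = {x \<in> topspace X. k \<le> card (fibre X \<sigma> x)}"

text \<open>The \<open>k\<close> pairwise different elements \<open>Z\<^sub>1, \<dots>, Z\<^sub>k\<close> of \<open>P\<close> are given as a subset of \<open>P\<close> of
  cardinality \<open>k\<close>.\<close>

definition image_partition :: "'a topology \<Rightarrow> ('a \<Rightarrow> 'a) \<Rightarrow> 'a set set \<Rightarrow> 'a set set" where
  "image_partition X \<sigma> P = (\<Union>k \<in> {1..max_fibre X \<sigma>}.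
     {(\<Inter>Z \<in> S. \<sigma> ` Z) - fibre_ge X \<sigma> (k + 1) | S. S \<subseteq> P \<and> card S = k \<and>
        (\<Inter>Z \<in> S. \<sigma> ` Z) - fibre_ge X \<sigma> (k + 1) \<noteq> {}})"

definition preimage_partition :: "'a topology \<Rightarrow> ('a \<Rightarrow> 'a) \<Rightarrow> 'a set set \<Rightarrow> 'a set set" where
  "preimage_partition X \<sigma> P = (\<lambda>Z. {x \<in> topspace X. \<sigma> x \<in> Z}) ` P"

definition sigma_refined ::
  "'a topology \<Rightarrow> ('a \<Rightarrow> 'a \<Rightarrow> real) \<Rightarrow> ('a \<Rightarrow> 'a) \<Rightarrow> (nat \<Rightarrow> 'a set set) \<Rightarrow> bool" where
  "sigma_refined X d \<sigma> P \<longleftrightarrow>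
     (\<forall>n. clopen_partition X (P n)) \<and>
     (\<forall>Z \<in> P 0. homeomorphic_map (subtopology X Z) (subtopology X (\<sigma> ` Z)) \<sigma>) \<and>
     (\<forall>n. P n \<precsim>p P (Suc n)) \<and>
     topology_generated_by (\<Union>n. P n) = X \<and>
     (\<lambda>n. partition_diam d (P n)) \<longlonglongrightarrow> 0 \<and>
     (\<forall>j. (P (2*j) \<or>p image_partition X \<sigma> (P (2*j))) \<precsim>p P (2*j + 1)) \<and>
     (\<forall>j. (P (2*j + 1) \<or>p preimage_partition X \<sigma> (P (2*j + 1))) \<precsim>p P (2*j + 2))"


section \<open>From \<open>\<sigma>\<close>-refined sequences to diagrams\<close>

text \<open>Vertices carry their level, because a set may belong to several of the partitions.  An edge
  \<open>(c, n, Z', Z)\<close> is the edge of colour \<open>c\<close> in level \<open>n\<close> from \<open>Z'\<close> (source) to \<open>Z\<close> (range).\<close>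

datatype colour = Blue | Red

type_synonym 'a pvertex = "nat \<times> 'a set"
type_synonym 'a pedge = "colour \<times> nat \<times> 'a set \<times> 'a set"

fun pedge_rng :: "'a pedge \<Rightarrow> 'a pvertex" where
  "pedge_rng (c, n, Z', Z) = (n, Z)"

fun pedge_src :: "'a pedge \<Rightarrow> 'a pvertex" where
  "pedge_src (c, n, Z', Z) = (Suc n, Z')"

definition pblue_edges :: "(nat \<Rightarrow> 'a set set) \<Rightarrow> nat \<Rightarrow> 'a pedge set" where
  "pblue_edges P n = {(Blue, n, Z', Z) | Z' Z. Z' \<in> P (Suc n) \<and> Z \<in> P n \<and> Z' \<subseteq> Z}"

definition pred_edges :: "('a \<Rightarrow> 'a) \<Rightarrow> (nat \<Rightarrow> 'a set set) \<Rightarrow> nat \<Rightarrow> 'a pedge set" where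
  "pred_edges \<sigma> P n = {(Red, n, Z', Z) | Z' Z. Z' \<in> P (Suc n) \<and> Z \<in> P n \<and>
     (if even n then Z' \<subseteq> \<sigma> ` Z else \<sigma> ` Z' \<subseteq> Z)}"

definition pblue :: "(nat \<Rightarrow> 'a set set) \<Rightarrow> 'a pvertex \<Rightarrow> 'a pedge set" where
  "pblue P v = {e \<in> pblue_edges P (fst v). pedge_rng e = v}"

definition pred :: "('a \<Rightarrow> 'a) \<Rightarrow> (nat \<Rightarrow> 'a set set) \<Rightarrow> 'a pvertex \<Rightarrow> 'a pedge set" where
  "pred \<sigma> P v = {e \<in> pred_edges \<sigma> P (fst v). pedge_rng e = v}"

definition predof :: "('a \<Rightarrow> 'a) \<Rightarrow> (nat \<Rightarrow> 'a set set) \<Rightarrow> 'a pedge \<Rightarrow> 'a pedge set" where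
  "predof \<sigma> P f = {g \<in> pred \<sigma> P (pedge_src f). snd (pedge_src g) \<subseteq> snd (pedge_rng f)}"

definition partition_diagram ::
  "('a \<Rightarrow> 'a) \<Rightarrow> (nat \<Rightarrow> 'a set set) \<Rightarrow> ('a pvertex, 'a pedge) cdiagram" where
  "partition_diagram \<sigma> P = \<lparr>
     verts = (\<lambda>n. {n} \<times> P n),
     edges = (\<lambda>n. pblue_edges P n \<union> pred_edges \<sigma> P n),
     rng = pedge_rng,
     src = pedge_src,
     sep = (\<lambda>v. if even (fst v) then {pblue P v, pred \<sigma> P v}
        else insert (pblue P v)
          (predof \<sigma> P ` {f \<in> pred_edges \<sigma> P (fst v - 1). pedge_src f = v})),
     blue = pblue P,
     red = pred \<sigma> P,
     redof = predof \<sigma> P\<rparr>"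


section \<open>From diagrams to local homeomorphisms\<close>

definition blue_rays :: "('v, 'e) cdiagram \<Rightarrow> (nat \<Rightarrow> 'e) set" where
  "blue_rays F = {x. \<forall>i. x i \<in> blue_edges F i \<and> rng F (x (Suc i)) = src F (x i)}"

definition ray_cylinder :: "('v, 'e) cdiagram \<Rightarrow> 'e list \<Rightarrow> (nat \<Rightarrow> 'e) set" where
  "ray_cylinder F es = {x \<in> blue_rays F. \<forall>i < length es. x i = es ! i}"

definition ray_topology :: "('v, 'e) cdiagram \<Rightarrow> (nat \<Rightarrow> 'e) topology" where
  "ray_topology F = topology_generated_by {ray_cylinder F es | es. es \<noteq> []}"

text \<open>The red pair associated to a blue pair starting at an even level, and the blue pair associated
  to a red pair starting at an odd level.\<close>

definition red_pair :: "('v, 'e) cdiagram \<Rightarrow> 'e \<Rightarrow> 'e \<Rightarrow> 'e \<times> 'e" where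
  "red_pair F e0 e1 = (THE p. fst p \<in> red F (rng F e0) \<and> snd p \<in> red F (src F (fst p)) \<and>
     src F (snd p) = src F e1 \<and> snd p \<in> redof F (fst p))"

definition blue_pair :: "('v, 'e) cdiagram \<Rightarrow> 'e \<Rightarrow> 'e \<Rightarrow> 'e \<times> 'e" where
  "blue_pair F f0 f1 = (THE p. fst p \<in> blue F (rng F f0) \<and> snd p \<in> blue F (src F (fst p)) \<and>
     src F (snd p) = src F f1)"

definition red_ray :: "('v, 'e) cdiagram \<Rightarrow> (nat \<Rightarrow> 'e) \<Rightarrow> nat \<Rightarrow> 'e" where
  "red_ray F x i = (if even i then fst (red_pair F (x i) (x (i + 1)))
     else snd (red_pair F (x (i - 1)) (x i)))"

definition ray_shift_pos :: "('v, 'e) cdiagram \<Rightarrow> (nat \<Rightarrow> 'e) \<Rightarrow> nat \<Rightarrow> 'e" where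
  "ray_shift_pos F x i = (if odd i then fst (blue_pair F (red_ray F x i) (red_ray F x (i + 1)))
     else snd (blue_pair F (red_ray F x (i - 1)) (red_ray F x i)))"

definition ray_shift :: "('v, 'e) cdiagram \<Rightarrow> (nat \<Rightarrow> 'e) \<Rightarrow> (nat \<Rightarrow> 'e)" where
  "ray_shift F x = (\<lambda>i. if i = 0
     then (THE e. e \<in> blue_edges F 0 \<and> src F e = rng F (ray_shift_pos F x 1))
     else ray_shift_pos F x i)"

definition ray_system ::
  "('v, 'e) cdiagram \<Rightarrow> (nat \<Rightarrow> 'e) topology \<times> ((nat \<Rightarrow> 'e) \<Rightarrow> (nat \<Rightarrow> 'e))" where
  "ray_system F = (ray_topology F, ray_shift F)"


section \<open>The induced maps on classes\<close>

definition Phi :: "((nat \<Rightarrow> nat) topology \<times> ((nat \<Rightarrow> nat) \<Rightarrow> (nat \<Rightarrow> nat))) set \<Rightarrow>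
    (nat, nat) cdiagram set" where
  "Phi c = (THE C. \<exists>X \<sigma> d P. (X, \<sigma>) \<in> c \<and> compatible_metric X d \<and> sigma_refined X d \<sigma> P \<and>
     C = l_class (partition_diagram \<sigma> P))"

definition Psi :: "(nat, nat) cdiagram set \<Rightarrow>
    ((nat \<Rightarrow> nat) topology \<times> ((nat \<Rightarrow> nat) \<Rightarrow> (nat \<Rightarrow> nat))) set" where
  "Psi C = (THE c. \<exists>F \<in> C. c = tc_class (ray_system F))"

end

theory Submission
  imports Defs
begin

text \<open>An \<open>l\<close>-diagram is a finite combinatorial record, level by level, of a local homeomorphism
  \<open>\<sigma>\<close> of a space \<open>X\<close>.  Every vertex above level 0 is the source of exactly one blue edge
  (\<open>blue_source\<close>), so the blue edges make the vertices an inverse system of finite sets with limit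
  \<open>X\<close>, and a vertex stands for a clopen set of rays.  The red edges record \<open>\<sigma>\<close>.  A vertex at level
  \<open>2j + 2\<close> is the source of one red edge, which lies in \<open>R(f)\<close> for one red edge \<open>f\<close> at level \<open>2j\<close>;
  hence a ray \<open>x\<close> carries a unique red ray, and the sources of the even red edges of this red ray are
  the odd vertices of \<open>\<sigma>(x)\<close>.  The clauses that turn red pairs into blue pairs and blue pairs into red
  pairs say that a red edge at level \<open>2j + 2\<close> is the same as a red edge \<open>f\<close> at level \<open>2j\<close> together
  with a vertex two levels below the source of \<open>f\<close> (\<open>red_lift\<close>).  Iterating this, the rays whose red
  ray starts with \<open>f\<close> are mapped bijectively onto all rays through the source of \<open>f\<close>
  (\<open>shift_lift\<close>, \<open>shift_inj\<close>), so \<open>\<sigma>\<close> is a local homeomorphism (\<open>ray_system_LHomeo\<close>).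

  On the other side a \<open>\<sigma>\<close>-refined sequence is a refining clopen base such that \<open>\<sigma>\<close> is injective on
  the cells of the first partition, the image of a cell of an even partition is a union of cells of
  the next one, and \<open>\<sigma>\<close> maps each later even cell into a cell of the preceding odd partition
  (\<open>sigma_refined_iff\<close>).  In this form
  whether two cells are joined by an edge is decided by any single point, which makes both the
  existence of such a sequence (\<open>adapted_exists\<close>) and the axioms of an \<open>l\<close>-diagram
  (\<open>partition_diagram_LDiag\<close>) accessible.  Sending a point to the sequence of cells that contain it
  conjugates \<open>(X, \<sigma>)\<close> to the ray system of the diagram (\<open>top_conj_ray_system\<close>).

  Everything now follows from one equivalence: two diagrams are related by \<open>\<sim>\<^sub>l\<close> if and only if their
  ray systems are conjugate (\<open>l_rel_conj\<close>, \<open>conj_l_rel\<close>).  Isomorphisms and contractions preserve the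
  ray system because blue and red paths are segments of rays and red rays, and because the shift is
  characterised without choices by \<open>shift_witness\<close>.  For the converse let \<open>F\<close> and \<open>G\<close> code the same
  system.  The vertices of \<open>F\<close> at a level partition \<open>X\<close>, and so do those of \<open>G\<close>; with rapidly
  increasing levels the two sequences of partitions can be interleaved into a single \<open>\<sigma>\<close>-refined
  sequence \<open>R\<close> (\<open>interleaving\<close>).  The diagram of \<open>R\<close> and \<open>F\<close> have a common contraction, namely the
  diagram of the partitions that \<open>R\<close> takes from \<open>F\<close>, and likewise for \<open>G\<close> (\<open>coding_equiv\<close>); so
  \<open>F\<close> and \<open>G\<close> are both equivalent to the diagram of \<open>R\<close>.

  Consequently \<open>\<Psi>\<close> is well defined and injective, \<open>\<Phi>\<close> is well defined, and \<open>\<Psi> \<circ> \<Phi>\<close> is the identity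
  by the itineraries; \<open>\<Phi> \<circ> \<Psi>\<close> is the identity because \<open>G\<close> and the diagram of a \<open>\<sigma>\<close>-refined sequence
  for the ray system of \<open>G\<close> have conjugate ray systems.\<close>

section \<open>The combinatorics of l-diagrams\<close>

locale l_diagram =
  fixes F :: "('v, 'e) cdiagram"
  assumes LDiag: "F \<in> LDiag"
begin

lemma bratteli: "separated_bratteli F" and colours: "l_colours F"
  and evens: "l_even_level_sources F" and firsts: "l_first_level_sources F"
  and two_step: "l_two_step_sources F" and red_to_blue: "l_red_to_blue F"
  and blue_to_red: "l_blue_to_red F"
  using LDiag by (auto simp: LDiag_def)

lemma finite_verts: "finite (verts F n)" and verts_nonempty: "verts F n \<noteq> {}"
  and finite_edges: "finite (edges F n)"
  using bratteli by (auto simp: separated_bratteli_def)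

lemma verts_level: "v \<in> verts F n \<Longrightarrow> v \<in> verts F n' \<Longrightarrow> n = n'"
  using bratteli unfolding separated_bratteli_def disjoint_family_on_def by blast

lemma edges_level: "e \<in> edges F n \<Longrightarrow> e \<in> edges F n' \<Longrightarrow> n = n'"
  using bratteli unfolding separated_bratteli_def disjoint_family_on_def by blast

lemma rng_edge: "e \<in> edges F n \<Longrightarrow> rng F e \<in> verts F n"
  and src_edge: "e \<in> edges F n \<Longrightarrow> src F e \<in> verts F (Suc n)"
  using bratteli unfolding separated_bratteli_def by blast+

lemma edge_level: "e \<in> edges F k \<Longrightarrow> rng F e \<in> verts F n \<Longrightarrow> k = n"
  using rng_edge verts_level by blast

lemma sep_partition: "v \<in> verts F n \<Longrightarrow> partition_on (in_edges F v) (sep F v)"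
  using bratteli by (auto simp: separated_bratteli_def)

lemma in_edges_level: "v \<in> verts F n \<Longrightarrow> in_edges F v = {e \<in> edges F n. rng F e = v}"
  unfolding in_edges_def using edge_level by auto

lemma sep_even: "v \<in> verts F (2*j) \<Longrightarrow> sep F v = {blue F v, red F v}"
  using colours by (auto simp: l_colours_def)

lemma sep_odd:
  "v \<in> verts F (2*j + 1) \<Longrightarrow>
     sep F v = insert (blue F v) (redof F ` {f \<in> red_edges F (2*j). src F f = v})"
  by (rule colours[unfolded l_colours_def, THEN conjunct2, THEN conjunct2, THEN spec, THEN bspec,
    THEN conjunct1])

lemma red_odd:
  "v \<in> verts F (2*j + 1) \<Longrightarrow> red F v = (\<Union>f \<in> {f \<in> red_edges F (2*j). src F f = v}. redof F f)"
  by (rule colours[unfolded l_colours_def, THEN conjunct2, THEN conjunct2, THEN spec, THEN bspec,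
    THEN conjunct2])

lemma blue_in_sep: "v \<in> verts F n \<Longrightarrow> blue F v \<in> sep F v"
proof (cases "even n")
  case True
  moreover assume "v \<in> verts F n"
  ultimately show ?thesis using sep_even[of v "n div 2"] by simp
next
  case False
  moreover assume "v \<in> verts F n"
  ultimately show ?thesis using sep_odd[of v "n div 2"] by simp
qed

lemma blue_red_disjoint: "v \<in> verts F n \<Longrightarrow> blue F v \<inter> red F v = {}"
  using colours by (auto simp: l_colours_def)

lemma blue_red_cover: "v \<in> verts F n \<Longrightarrow> blue F v \<union> red F v = {e \<in> edges F n. rng F e = v}"
proof (cases "even n")
  case True
  moreover assume v: "v \<in> verts F n"
  ultimately have "sep F v = {blue F v, red F v}" using sep_even[of v "n div 2"] by simp
  with partition_onD1[OF sep_partition[OF v]] in_edges_level[OF v] show ?thesis by simp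
next
  case False
  moreover assume v: "v \<in> verts F n"
  ultimately have "\<Union> (sep F v) = blue F v \<union> red F v"
    using sep_odd[of v "n div 2"] red_odd[of v "n div 2"] by simp
  with partition_onD1[OF sep_partition[OF v]] in_edges_level[OF v] show ?thesis by simp
qed

lemma blue_nonempty: "v \<in> verts F n \<Longrightarrow> blue F v \<noteq> {}"
  using blue_in_sep partition_onD3[OF sep_partition] by metis

lemma blue_iff: "v \<in> verts F n \<Longrightarrow> e \<in> blue F v \<longleftrightarrow> e \<in> blue_edges F n \<and> rng F e = v"
  using blue_red_cover[of v n] unfolding blue_edges_def by auto

lemma red_iff: "v \<in> verts F n \<Longrightarrow> e \<in> red F v \<longleftrightarrow> e \<in> red_edges F n \<and> rng F e = v"
  using blue_red_cover[of v n] unfolding red_edges_def by auto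

lemma blueI: "e \<in> blue_edges F n \<Longrightarrow> rng F e = v \<Longrightarrow> e \<in> blue F v"
  and redI: "e \<in> red_edges F n \<Longrightarrow> rng F e = v \<Longrightarrow> e \<in> red F v"
  by (auto simp: blue_edges_def red_edges_def)

lemma blue_edge: "e \<in> blue_edges F n \<Longrightarrow> e \<in> edges F n"
  and red_edge: "e \<in> red_edges F n \<Longrightarrow> e \<in> edges F n"
  by (auto simp: blue_edges_def red_edges_def)

lemma red_not_blue: "e \<in> red_edges F n \<Longrightarrow> e \<notin> blue_edges F n'"
  using blue_red_disjoint rng_edge by (fastforce simp: blue_edges_def red_edges_def)

lemma edges_coloured: "edges F n = blue_edges F n \<union> red_edges F n"
proof -
  have "e \<in> blue_edges F n \<union> red_edges F n" if "e \<in> edges F n" for e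
    using blue_red_cover[OF rng_edge[OF that]] that unfolding blue_edges_def red_edges_def by auto
  then show ?thesis by (auto simp: blue_edges_def red_edges_def)
qed

lemma redof_odd:
  assumes "f \<in> red_edges F (2*j)" "g \<in> redof F f"
  shows "g \<in> red_edges F (2*j + 1)" "rng F g = src F f"
proof -
  have v: "src F f \<in> verts F (2*j + 1)" using assms src_edge red_edge by fastforce
  then have "g \<in> red F (src F f)" using red_odd assms by blast
  then show "g \<in> red_edges F (2*j + 1)" "rng F g = src F f" using red_iff[OF v] by blast+
qed

lemma red_odd_level_redof:
  assumes "g \<in> red_edges F (2*j + 1)"
  shows "\<exists>f \<in> red_edges F (2*j). g \<in> redof F f"
proof -
  have v: "rng F g \<in> verts F (2*j + 1)" using rng_edge[OF red_edge[OF assms]] .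
  then have "g \<in> red F (rng F g)" using red_iff assms by blast
  then show ?thesis using red_odd[OF v] by blast
qed

lemmas even_sources = evens[unfolded l_even_level_sources_def, THEN spec]
lemmas blue_sources_disjoint = even_sources[THEN conjunct1]
lemmas blue_sources_cover = even_sources[THEN conjunct2, THEN conjunct1]
lemmas red_sources_disjoint = even_sources[THEN conjunct2, THEN conjunct2, THEN conjunct1]
lemmas red_sources_cover = even_sources[THEN conjunct2, THEN conjunct2, THEN conjunct2, THEN conjunct1]
lemmas sources_inj = even_sources[THEN conjunct2, THEN conjunct2, THEN conjunct2, THEN conjunct2]

lemma red_source_even:
  assumes "w \<in> verts F (2*j + 2)"
  shows "\<exists>!g. g \<in> red_edges F (2*j + 1) \<and> src F g = w"
proof -
  have "w \<in> (\<Union>v \<in> verts F (2*j + 1). src F ` red F v)"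
    using assms unfolding red_sources_cover[of j] .
  then obtain v g where vg: "v \<in> verts F (2*j + 1)" "g \<in> red F v" "src F g = w" by blast
  have "g' = g" if g': "g' \<in> red_edges F (2*j + 1)" "src F g' = w" for g'
  proof -
    have v': "rng F g' \<in> verts F (2*j + 1)" using rng_edge[OF red_edge[OF g'(1)]] .
    have m: "g' \<in> red F (rng F g')" using redI[OF g'(1)] by simp
    have "w \<in> src F ` red F (rng F g') \<inter> src F ` red F v"
      using imageI[OF m, of "src F"] imageI[OF vg(2), of "src F"] vg(3) g'(2) by simp
    then have "rng F g' = v"
      using red_sources_disjoint[of j] v' vg unfolding disjoint_family_on_def by blast
    moreover have "inj_on (src F) (red F v)" using sources_inj[of j] vg by blast
    ultimately show ?thesis using m vg g' by (auto dest: inj_onD)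
  qed
  moreover have "g \<in> red_edges F (2*j + 1)" using vg by (simp add: red_iff)
  ultimately show ?thesis using vg(3) by metis
qed

lemma blue_source_even:
  assumes "w \<in> verts F (2*j + 2)"
  shows "\<exists>!g. g \<in> blue_edges F (2*j + 1) \<and> src F g = w"
proof -
  have "w \<in> (\<Union>v \<in> verts F (2*j + 1). src F ` blue F v)"
    using assms unfolding blue_sources_cover[of j] .
  then obtain v g where vg: "v \<in> verts F (2*j + 1)" "g \<in> blue F v" "src F g = w" by blast
  have "g' = g" if g': "g' \<in> blue_edges F (2*j + 1)" "src F g' = w" for g'
  proof -
    have v': "rng F g' \<in> verts F (2*j + 1)" using rng_edge[OF blue_edge[OF g'(1)]] .
    have m: "g' \<in> blue F (rng F g')" using blueI[OF g'(1)] by simp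
    have "w \<in> src F ` blue F (rng F g') \<inter> src F ` blue F v"
      using imageI[OF m, of "src F"] imageI[OF vg(2), of "src F"] vg(3) g'(2) by simp
    then have "rng F g' = v"
      using blue_sources_disjoint[of j] v' vg unfolding disjoint_family_on_def by blast
    moreover have "inj_on (src F) (blue F v)" using sources_inj[of j] vg by blast
    ultimately show ?thesis using m vg g' by (auto dest: inj_onD)
  qed
  moreover have "g \<in> blue_edges F (2*j + 1)" using vg by (simp add: blue_iff)
  ultimately show ?thesis using vg(3) by metis
qed

text \<open>The half of \<^const>\<open>l_two_step_sources\<close> that carries information upwards: what is reached from
  an even vertex by a red pair is also reached by a blue pair.\<close>

lemma redof_blue_pair:
  assumes f: "f \<in> red_edges F (2*j)" and g: "g \<in> redof F f"
  shows "\<exists>e \<in> blue_edges F (2*j). \<exists>e' \<in> blue_edges F (2*j + 1).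
    rng F e = rng F f \<and> rng F e' = src F e \<and> src F e' = src F g"
proof -
  have v: "rng F f \<in> verts F (2*j)" using f by (simp add: rng_edge red_edge)
  have "f \<in> red F (rng F f)" using redI[OF f] by simp
  then have "src F g \<in> (\<Union>f' \<in> red F (rng F f). src F ` redof F f')" using g by blast
  moreover have "(\<Union>e \<in> blue F (rng F f). src F ` blue F (src F e)) =
      (\<Union>f' \<in> red F (rng F f). src F ` redof F f')"
    using two_step v unfolding l_two_step_sources_def by metis
  ultimately have "src F g \<in> (\<Union>e \<in> blue F (rng F f). src F ` blue F (src F e))" by simp
  then obtain e e' where e: "e \<in> blue F (rng F f)" "e' \<in> blue F (src F e)" "src F g = src F e'"
    by auto
  have e1: "e \<in> blue_edges F (2*j)" "rng F e = rng F f" using e by (simp_all add: blue_iff[OF v])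
  have "src F e \<in> verts F (2*j + 1)" using src_edge[OF blue_edge[OF e1(1)]] by simp
  then have "e' \<in> blue_edges F (2*j + 1)" "rng F e' = src F e" using e(2) by (simp_all add: blue_iff)
  with e1 e show ?thesis by auto
qed

text \<open>For an even vertex this is \<open>blue_source_even\<close>.  For an odd vertex \<open>w\<close>, existence has to be
  extracted: a blue edge into \<open>w\<close> has a source that is also the source of some red edge in some
  \<open>R(f)\<close>, hence the end of a blue pair, and that pair passes through \<open>w\<close> because blue edges at odd
  levels are determined by their sources.\<close>

lemma blue_source:
  assumes "w \<in> verts F (Suc n)"
  shows "\<exists>!e. e \<in> blue_edges F n \<and> src F e = w"
proof (cases "even n")
  case False
  then show ?thesis using blue_source_even[of w "n div 2"] assms by simp
next
  case True
  then obtain j where n: "n = 2*j" by blast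
  have w: "w \<in> verts F (2*j + 1)" using assms n by simp
  obtain b where b: "b \<in> blue_edges F (2*j + 1)" "rng F b = w"
    using blue_nonempty[OF w] blue_iff[OF w] by blast
  then have u: "src F b \<in> verts F (2*j + 2)" using src_edge[OF blue_edge] by fastforce
  obtain g where g: "g \<in> red_edges F (2*j + 1)" "src F g = src F b"
    using red_source_even[OF u] by blast
  obtain f where f: "f \<in> red_edges F (2*j)" "g \<in> redof F f" using red_odd_level_redof[OF g(1)] by blast
  obtain e e' where e: "e \<in> blue_edges F (2*j)" "e' \<in> blue_edges F (2*j + 1)"
    "rng F e' = src F e" "src F e' = src F g"
    using redof_blue_pair[OF f] by blast
  have "e' = b" using blue_source_even[OF u] e g b by metis
  then have ex: "e \<in> blue_edges F (2*j) \<and> src F e = w" using e b by simp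
  have "e1 = e" if "e1 \<in> blue_edges F (2*j)" "src F e1 = w" for e1
  proof (rule ccontr)
    assume ne: "e1 \<noteq> e"
    have v: "rng F e1 \<in> verts F (2*j)" "rng F e \<in> verts F (2*j)"
      using rng_edge[OF blue_edge] that ex by auto
    have "e1 \<in> blue F (rng F e1)" "e \<in> blue F (rng F e)"
      using blueI that ex by auto
    then have "src F e1 \<noteq> src F e" using firsts v ne unfolding l_first_level_sources_def by blast
    then show False using that ex by simp
  qed
  then show ?thesis using ex n by blast
qed

text \<open>Everything else is expressed through the choice-free data attached to one vertex \<open>w\<close>: the blue
  edge leaving it, its range \<open>parent w\<close>, and for \<open>w\<close> at an even level the red edge leaving it together
  with the red edge \<open>prior_red w\<close> to whose class that edge belongs.  In the diagram of a
  \<open>\<sigma>\<close>-refined sequence the pair \<open>red_from w\<close>, \<open>prior_red w\<close> records that \<open>\<sigma>(w)\<close> lies in the source of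
  \<open>prior_red w\<close>.\<close>

definition blue_from :: "'v \<Rightarrow> 'e" where
  "blue_from w = (THE e. e \<in> (\<Union>n. blue_edges F n) \<and> src F e = w)"

definition parent :: "'v \<Rightarrow> 'v" where
  "parent w = rng F (blue_from w)"

definition red_from :: "'v \<Rightarrow> 'e" where
  "red_from w = (THE g. g \<in> (\<Union>j. red_edges F (2*j + 1)) \<and> src F g = w)"

definition prior_red :: "'v \<Rightarrow> 'e" where
  "prior_red w = (THE f. f \<in> (\<Union>j. red_edges F (2*j)) \<and> red_from w \<in> redof F f)"

lemma blue_from_eqI:
  assumes "e \<in> blue_edges F n"
  shows "blue_from (src F e) = e"
  unfolding blue_from_def
proof (rule the_equality)
  fix e' assume e': "e' \<in> (\<Union>n. blue_edges F n) \<and> src F e' = src F e"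
  then obtain k where k: "e' \<in> blue_edges F k" by blast
  have "src F e \<in> verts F (Suc n)" "src F e' \<in> verts F (Suc k)"
    using src_edge[OF blue_edge[OF assms]] src_edge[OF blue_edge[OF k]] by auto
  then have "k = n" using verts_level e' by fastforce
  then show "e' = e" using blue_source[OF \<open>src F e \<in> verts F (Suc n)\<close>] assms k e' by metis
qed (use assms in blast)

lemma blue_from:
  assumes "w \<in> verts F (Suc n)"
  shows "blue_from w \<in> blue_edges F n" "src F (blue_from w) = w" "parent w \<in> verts F n"
proof -
  obtain e where e: "e \<in> blue_edges F n" "src F e = w" using blue_source[OF assms] by blast
  have "blue_from w = e" using blue_from_eqI e by blast
  then show "blue_from w \<in> blue_edges F n" "src F (blue_from w) = w" "parent w \<in> verts F n"
    using e rng_edge blue_edge by (auto simp: parent_def)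
qed

lemma parent_src: "e \<in> blue_edges F n \<Longrightarrow> parent (src F e) = rng F e"
  by (simp add: parent_def blue_from_eqI)

lemma red_from_eqI:
  assumes "g \<in> red_edges F (2*j + 1)"
  shows "red_from (src F g) = g"
  unfolding red_from_def
proof (rule the_equality)
  fix g' assume g': "g' \<in> (\<Union>j. red_edges F (2*j + 1)) \<and> src F g' = src F g"
  then obtain k where k: "g' \<in> red_edges F (2*k + 1)" by blast
  have w: "src F g \<in> verts F (2*j + 2)" "src F g' \<in> verts F (2*k + 2)"
    using src_edge[OF red_edge[OF assms]] src_edge[OF red_edge[OF k]] by simp_all
  then have "k = j" using verts_level[of "src F g" "2*j+2" "2*k+2"] g' by simp
  then show "g' = g" using red_source_even[OF w(1)] assms k g' by metis
qed (use assms in blast)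

lemma red_from:
  assumes "w \<in> verts F (2*j + 2)"
  shows "red_from w \<in> red_edges F (2*j + 1)" "src F (red_from w) = w"
proof -
  obtain g where g: "g \<in> red_edges F (2*j + 1)" "src F g = w" using red_source_even[OF assms] by blast
  have "red_from w = g" using red_from_eqI g by blast
  then show "red_from w \<in> red_edges F (2*j + 1)" "src F (red_from w) = w" using g by auto
qed

lemma redof_rng:
  assumes f: "f \<in> red_edges F (2*j)" and g: "g \<in> redof F f"
  shows "rng F f = parent (parent (src F g))"
  using redof_blue_pair[OF assms] parent_src by metis

text \<open>Both edges have the same range, the vertex two levels above the source of \<open>g\<close>, and over one
  even vertex the sources of the different \<open>R(f)\<close> are disjoint.\<close>

lemma redof_unique:
  assumes f: "f \<in> red_edges F (2*j)" "g \<in> redof F f" and f': "f' \<in> red_edges F (2*j')" "g \<in> redof F f'"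
  shows "f = f'"
proof -
  have "j = j'"
    using edges_level[OF red_edge[OF redof_odd(1)[OF f]] red_edge[OF redof_odd(1)[OF f']]] by simp
  then have f'': "f' \<in> red_edges F (2*j)" using f' by simp
  have v: "rng F f \<in> verts F (2*j)" using f by (simp add: rng_edge red_edge)
  have r: "rng F f' = rng F f" using redof_rng[OF f] redof_rng[OF f'' f'(2)] by simp
  have m: "f \<in> red F (rng F f)" "f' \<in> red F (rng F f)" using redI[OF f(1)] redI[OF f''] r by simp_all
  show ?thesis
  proof (rule ccontr)
    assume "f \<noteq> f'"
    then have "src F ` redof F f \<inter> src F ` redof F f' = {}"
      using two_step[unfolded l_two_step_sources_def, THEN spec, THEN bspec, OF v] m
      unfolding disjoint_family_on_def by metis
    then show False using f f' by blast
  qed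
qed

lemma prior_red_eqI:
  assumes f: "f \<in> red_edges F (2*j)" and g: "g \<in> redof F f"
  shows "prior_red (src F g) = f" "red_from (src F g) = g"
proof -
  show *: "red_from (src F g) = g" using red_from_eqI redof_odd(1)[OF f g] by blast
  show "prior_red (src F g) = f" unfolding prior_red_def *
    by (rule the_equality) (use f g redof_unique in \<open>blast+\<close>)
qed

lemma prior_red:
  assumes "w \<in> verts F (2*j + 2)"
  shows "prior_red w \<in> red_edges F (2*j)" "red_from w \<in> redof F (prior_red w)"
    "src F (prior_red w) = rng F (red_from w)"
    "rng F (prior_red w) = parent (parent w)"
proof -
  obtain f where f: "f \<in> red_edges F (2*j)" "red_from w \<in> redof F f"
    using red_odd_level_redof[OF red_from(1)[OF assms]] by blast
  have eq: "prior_red w = f" using prior_red_eqI(1)[OF f] red_from[OF assms] by simp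
  show "prior_red w \<in> red_edges F (2*j)" "red_from w \<in> redof F (prior_red w)"
    "src F (prior_red w) = rng F (red_from w)"
    "rng F (prior_red w) = parent (parent w)"
    using f eq redof_odd(2)[OF f] redof_rng[OF f] red_from(2)[OF assms] by simp_all
qed

text \<open>The next two lemmas restate \<^const>\<open>l_red_to_blue\<close> and \<^const>\<open>l_blue_to_red\<close> for single edges:
  the map \<open>f' \<mapsto> (prior_red (rng f'), src f')\<close> is a bijection from the red edges at level \<open>2j + 2\<close> to
  the pairs \<open>(f, w)\<close> of a red edge at level \<open>2j\<close> and a vertex with
  \<open>parent (parent w) = src f\<close>.\<close>

lemma red_source_grandparent:
  assumes f: "f \<in> red_edges F (2*j + 2)"
  shows "parent (parent (src F f)) = src F (prior_red (rng F f))"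
proof -
  have u: "rng F f \<in> verts F (2*j + 2)" using f by (simp add: rng_edge red_edge)
  let ?g = "red_from (rng F f)"
  have g: "?g \<in> red_edges F (2*j + 1)" "src F ?g = rng F f" using red_from[OF u] by auto
  have v: "rng F ?g \<in> verts F (2*j + 1)" using g by (simp only: rng_edge red_edge)
  have "?g \<in> red F (rng F ?g)" "f \<in> red F (src F ?g)"
    using red_iff[OF v] red_iff[OF u] f g by auto
  then obtain p where p: "fst p \<in> blue F (rng F ?g)" "snd p \<in> blue F (src F (fst p))"
    "src F (snd p) = src F f"
    using red_to_blue v unfolding l_red_to_blue_def by blast
  have p0: "fst p \<in> blue_edges F (2*j + 1)" "rng F (fst p) = rng F ?g" using p
    by (simp_all add: blue_iff[OF v])
  have "src F (fst p) \<in> verts F (2*j + 2)" using src_edge[OF blue_edge[OF p0(1)]] by simp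
  then have "snd p \<in> blue_edges F (2*j + 2)" "rng F (snd p) = src F (fst p)" using p(2)
    by (simp_all add: blue_iff)
  then have "parent (parent (src F f)) = rng F ?g" using parent_src p0 p(3) by metis
  then show ?thesis using prior_red(3)[OF u] by simp
qed

lemma red_lift:
  assumes f: "f \<in> red_edges F (2*j)" and w: "w \<in> verts F (2*j + 3)" and p: "parent (parent w) = src F f"
  shows "\<exists>!f'. f' \<in> red_edges F (2*j + 2) \<and> src F f' = w \<and> prior_red (rng F f') = f"
proof -
  have v: "src F f \<in> verts F (2*j + 1)" using src_edge[OF red_edge[OF f]] by simp
  have w1: "w \<in> verts F (Suc (2*j + 2))" using w by (simp add: numeral_eq_Suc)
  have pw: "parent w \<in> verts F (2*j + 2)" using blue_from(3)[OF w1] .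
  have pw1: "parent w \<in> verts F (Suc (2*j + 1))" using pw by simp
  have e0: "blue_from (parent w) \<in> blue F (src F f)" "src F (blue_from (parent w)) = parent w"
    using blue_from[OF pw1] p blue_iff[OF v] by (auto simp: parent_def)
  have e1: "blue_from w \<in> blue F (src F (blue_from (parent w)))" "src F (blue_from w) = w"
    using blue_from[OF w1] blue_iff[OF pw] e0 by (auto simp: parent_def)
  have ex1: "\<exists>!p. fst p \<in> redof F f \<and> rng F (fst p) = src F f \<and>
             snd p \<in> red F (src F (fst p)) \<and> src F (snd p) = w"
    using blue_to_red[unfolded l_blue_to_red_def, THEN spec, THEN bspec, OF v, THEN bspec, OF f,
        THEN mp, OF refl, THEN bspec, OF e0(1), THEN bspec, OF e1(1)]
    unfolding e1(2) .
  \<comment> \<open>The first edge of the red pair is determined by the second one, so the unique pair amounts to a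
    unique edge.\<close>
  have *: "fst p \<in> redof F f \<and> rng F (fst p) = src F f \<and>
             snd p \<in> red F (src F (fst p)) \<and> src F (snd p) = w \<longleftrightarrow>
     snd p \<in> red_edges F (2*j + 2) \<and> src F (snd p) = w \<and> prior_red (rng F (snd p)) = f \<and>
     fst p = red_from (rng F (snd p))" for p
  proof
    assume a: "fst p \<in> redof F f \<and> rng F (fst p) = src F f \<and>
             snd p \<in> red F (src F (fst p)) \<and> src F (snd p) = w"
    then have "fst p \<in> red_edges F (2*j + 1)" using redof_odd[OF f] by blast
    then have "src F (fst p) \<in> verts F (2*j + 2)" using src_edge[OF red_edge] by fastforce
    then show "snd p \<in> red_edges F (2*j + 2) \<and> src F (snd p) = w \<and> prior_red (rng F (snd p)) = f \<and>
       fst p = red_from (rng F (snd p))"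
      using a red_iff prior_red_eqI[OF f] by metis
  next
    assume a: "snd p \<in> red_edges F (2*j + 2) \<and> src F (snd p) = w \<and> prior_red (rng F (snd p)) = f \<and>
     fst p = red_from (rng F (snd p))"
    then have u: "rng F (snd p) \<in> verts F (2*j + 2)" using rng_edge[OF red_edge] by blast
    show "fst p \<in> redof F f \<and> rng F (fst p) = src F f \<and>
             snd p \<in> red F (src F (fst p)) \<and> src F (snd p) = w"
      using a prior_red[OF u] red_from[OF u] red_iff[OF u] by auto
  qed
  show ?thesis using ex1 unfolding * by (metis fst_conv snd_conv)
qed

end

section \<open>Rays and the shift on them\<close>

text \<open>For rays \<open>x\<close> and \<open>y\<close> the clauses determine \<open>r\<close> from \<open>x\<close>, and then \<open>y\<close> from its odd vertices.
  This relation, a conjunction of conditions on single edges, is visibly preserved by isomorphism and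
  contraction, while the iterated descriptions in \<^const>\<open>ray_shift\<close> are not.\<close>

definition shift_witness ::
  "('v, 'e) cdiagram \<Rightarrow> (nat \<Rightarrow> 'e) \<Rightarrow> (nat \<Rightarrow> 'e) \<Rightarrow> (nat \<Rightarrow> 'e) \<Rightarrow> bool" where
  "shift_witness F x y r \<longleftrightarrow> (\<forall>j. r (2*j) \<in> red_edges F (2*j) \<and> r (2*j + 1) \<in> redof F (r (2*j)) \<and>
     src F (r (2*j)) = rng F (y (2*j + 1)) \<and> src F (r (2*j + 1)) = rng F (x (2*j + 2)))"

context l_diagram
begin

lemma ray_edge: "x \<in> blue_rays F \<Longrightarrow> x n \<in> blue_edges F n"
  and ray_src: "x \<in> blue_rays F \<Longrightarrow> src F (x n) = rng F (x (Suc n))"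
  by (simp_all add: blue_rays_def)

lemma ray_vertex: "x \<in> blue_rays F \<Longrightarrow> rng F (x n) \<in> verts F n"
  using rng_edge[OF blue_edge[OF ray_edge]] .

lemma ray_parent: "x \<in> blue_rays F \<Longrightarrow> parent (rng F (x (Suc n))) = rng F (x n)"
  using parent_src[OF ray_edge, of x n] ray_src[of x n] by simp

lemma ray_blue_from: "x \<in> blue_rays F \<Longrightarrow> x n = blue_from (rng F (x (Suc n)))"
  using blue_from_eqI[OF ray_edge, of x n] ray_src[of x n] by simp

lemma ray_parent_pow: "x \<in> blue_rays F \<Longrightarrow> (parent ^^ k) (rng F (x (n + k))) = rng F (x n)"
  by (induction k) (simp_all add: funpow_swap1 ray_parent del: funpow.simps add: funpow.simps)

lemma ray_of_vertices:
  assumes "\<And>n. u n \<in> verts F n" "\<And>n. parent (u (Suc n)) = u n"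
  shows "(\<lambda>n. blue_from (u (Suc n))) \<in> blue_rays F" "rng F (blue_from (u (Suc n))) = u n"
  using blue_from(1)[OF assms(1)] blue_from(2)[OF assms(1)] assms(2)
    by (simp_all add: blue_rays_def parent_def)

lemma parent_pow_verts: "w \<in> verts F (n + k) \<Longrightarrow> (parent ^^ k) w \<in> verts F n"
proof (induction k arbitrary: w)
  case (Suc k)
  then have "parent w \<in> verts F (n + k)" using blue_from(3)[of w "n + k"] by simp
  then show ?case using Suc.IH[of "parent w"] by (simp add: funpow_swap1)
qed simp

text \<open>Parents fill in the levels between the prescribed ones.  The shift and the maps of rays below
  only give vertices at odd, at even, or at contracted levels.\<close>

lemma ray_cofinal:
  assumes m: "\<And>j. m j < m (Suc j)"
    and u: "\<And>j. u j \<in> verts F (m j)"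
    and p: "\<And>j. (parent ^^ (m (Suc j) - m j)) (u (Suc j)) = u j"
  shows "\<exists>x \<in> blue_rays F. \<forall>j. rng F (x (m j)) = u j"
proof -
  have sm: "strict_mono m" using m by (simp add: strict_mono_Suc_iff)
  have ge: "n \<le> m n" for n using strict_mono_imp_increasing[OF sm] .
  have pk: "(parent ^^ (m (j + k) - m j)) (u (j + k)) = u j" for j k
  proof (induction k)
    case (Suc k)
    have le: "m j \<le> m (j + k)" "m (j + k) \<le> m (Suc (j + k))"
      using sm by (simp_all add: strict_mono_less_eq)
    then have "m (j + Suc k) - m j = (m (j + k) - m j) + (m (Suc (j + k)) - m (j + k))" by simp
    then have "(parent ^^ (m (j + Suc k) - m j)) (u (j + Suc k)) =
      (parent ^^ (m (j + k) - m j)) ((parent ^^ (m (Suc (j + k)) - m (j + k))) (u (Suc (j + k))))"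
      by (simp only: funpow_add o_apply add_Suc_right)
    then show ?case using p Suc by simp
  qed simp
  \<comment> \<open>Since \<open>n \<le> m n\<close>, the vertex at level \<open>n\<close> can be read off from the \<open>n\<close>-th prescribed one.\<close>
  define a where "a n = (parent ^^ (m n - n)) (u n)" for n
  have a: "a n \<in> verts F n" for n
    unfolding a_def using parent_pow_verts[of "u n" n "m n - n"] u[of n] ge[of n] by simp
  have pa: "parent (a (Suc n)) = a n" for n
  proof -
    have "Suc (m (Suc n) - Suc n) = (m n - n) + (m (Suc n) - m n)"
      using m[of n] ge[of n] ge[of "Suc n"] by linarith
    then have "(parent ^^ Suc (m (Suc n) - Suc n)) (u (Suc n)) =
      (parent ^^ (m n - n)) ((parent ^^ (m (Suc n) - m n)) (u (Suc n)))"
      by (simp only: funpow_add o_apply)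
    then show ?thesis unfolding a_def using p by simp
  qed
  have "rng F (blue_from (a (Suc (m j)))) = u j" for j
  proof -
    have "rng F (blue_from (a (Suc (m j)))) = a (m j)" using ray_of_vertices(2)[of a] a pa by blast
    also have "\<dots> = u j" unfolding a_def using pk[of j "m j - j"] ge[of j] by simp
    finally show ?thesis .
  qed
  then show ?thesis using ray_of_vertices(1)[of a] a pa
    by (intro bexI[of _ "\<lambda>n. blue_from (a (Suc n))"]) auto
qed

lemma ray_vertex_below:
  assumes "x \<in> blue_rays F" "y \<in> blue_rays F" "rng F (x n) = rng F (y n)" "k \<le> n"
  shows "rng F (x k) = rng F (y k)"
  using ray_parent_pow[OF assms(1), of "n - k" k] ray_parent_pow[OF assms(2), of "n - k" k] assms(3,4)
  by simp

lemma ray_edge_below: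
  assumes "x \<in> blue_rays F" "y \<in> blue_rays F" "rng F (x n) = rng F (y n)" "k < n"
  shows "x k = y k"
  using ray_vertex_below[OF assms(1-3), of "Suc k"] ray_blue_from[OF assms(1), of k]
    ray_blue_from[OF assms(2), of k]
    assms(4) by simp

lemma ray_eqI:
  assumes "x \<in> blue_rays F" "y \<in> blue_rays F" "\<And>k. \<exists>n > k. rng F (x n) = rng F (y n)"
  shows "x = y"
proof
  fix k
  obtain n where "n > k" "rng F (x n) = rng F (y n)" using assms(3) by blast
  then show "x k = y k" using ray_edge_below[OF assms(1,2)] by blast
qed

lemma ray_through:
  assumes "v \<in> verts F n"
  shows "\<exists>x \<in> blue_rays F. rng F (x n) = v"
proof -
  define u where "u = rec_nat v (\<lambda>_ w. src F (SOME e. e \<in> blue F w))"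
  have u0: "u 0 = v" and uS: "u (Suc k) = src F (SOME e. e \<in> blue F (u k))" for k
    by (simp_all add: u_def)
  have st: "u (Suc k) \<in> verts F (Suc (n + k)) \<and> parent (u (Suc k)) = u k"
    if "u k \<in> verts F (n + k)" for k
  proof -
    have "(SOME e. e \<in> blue F (u k)) \<in> blue F (u k)" using blue_nonempty[OF that]
      by (simp add: some_in_eq)
    then have e: "(SOME e. e \<in> blue F (u k)) \<in> blue_edges F (n + k)"
      "rng F (SOME e. e \<in> blue F (u k)) = u k" by (simp_all add: blue_iff[OF that])
    show ?thesis using src_edge[OF blue_edge[OF e(1)]] parent_src[OF e(1)] e(2) uS by simp
  qed
  have uV: "u k \<in> verts F (n + k)" for k
    by (induction k) (use assms u0 st in auto)
  have "\<exists>x \<in> blue_rays F. \<forall>j. rng F (x (n + j)) = u j"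
    by (rule ray_cofinal) (use uV st in auto)
  then show ?thesis using u0 by (metis add.right_neutral)
qed

subsection \<open>The red ray\<close>

lemma red_pair_ray:
  assumes x: "x \<in> blue_rays F"
  shows "red_pair F (x (2*j)) (x (2*j + 1)) =
    (prior_red (rng F (x (2*j + 2))), red_from (rng F (x (2*j + 2))))"
proof -
  let ?w = "rng F (x (2*j + 2))"
  have w: "?w \<in> verts F (2*j + 2)" using ray_vertex[OF x] .
  have sw: "src F (x (2*j + 1)) = ?w" using ray_src[OF x, of "2*j + 1"] by simp
  have v: "rng F (x (2*j)) \<in> verts F (2*j)" using ray_vertex[OF x] .
  have pp: "parent (parent ?w) = rng F (x (2*j))"
    using ray_parent[OF x, of "2*j"] ray_parent[OF x, of "2*j + 1"] by simp
  note r0 = prior_red[OF w] and rp = red_from[OF w]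
  show ?thesis unfolding red_pair_def sw
  proof (rule the_equality)
    show "fst (prior_red ?w, red_from ?w) \<in> red F (rng F (x (2*j))) \<and>
      snd (prior_red ?w, red_from ?w) \<in> red F (src F (fst (prior_red ?w, red_from ?w))) \<and>
      src F (snd (prior_red ?w, red_from ?w)) = ?w \<and>
        snd (prior_red ?w, red_from ?w) \<in> redof F (fst (prior_red ?w, red_from ?w))"
      using r0 rp redI[OF r0(1)] redI[OF rp(1)] pp by simp
  next
    fix p
    assume p: "fst p \<in> red F (rng F (x (2*j))) \<and> snd p \<in> red F (src F (fst p)) \<and>
         src F (snd p) = ?w \<and> snd p \<in> redof F (fst p)"
    then have "fst p \<in> red_edges F (2*j)" by (simp add: red_iff[OF v])
    then show "p = (prior_red ?w, red_from ?w)" using prior_red_eqI[of "fst p" j "snd p"] p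
      by (simp add: prod_eq_iff)
  qed
qed

lemma red_ray_even: "x \<in> blue_rays F \<Longrightarrow> red_ray F x (2*j) = prior_red (rng F (x (2*j + 2)))"
  and red_ray_odd: "x \<in> blue_rays F \<Longrightarrow> red_ray F x (2*j + 1) = red_from (rng F (x (2*j + 2)))"
  using red_pair_ray[of x j] by (simp_all add: red_ray_def)

lemma red_ray_edge:
  assumes "x \<in> blue_rays F"
  shows "red_ray F x n \<in> red_edges F n"
proof (cases "even n")
  case True
  then obtain j where n: "n = 2*j" by blast
  show ?thesis using red_ray_even[OF assms, of j] prior_red(1)[OF ray_vertex[OF assms]] n by simp
next
  case False
  then obtain j where n: "n = 2*j + 1" using oddE by blast
  show ?thesis using red_ray_odd[OF assms, of j] red_from(1)[OF ray_vertex[OF assms]] n by simp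
qed

lemma red_ray_rng: "x \<in> blue_rays F \<Longrightarrow> rng F (red_ray F x (2*j)) = rng F (x (2*j))"
  using prior_red(4)[OF ray_vertex, of x j] red_ray_even[of x j] ray_parent[of x "2*j"]
    ray_parent[of x "2*j + 1"]
  by simp

lemma red_ray_redof: "x \<in> blue_rays F \<Longrightarrow> red_ray F x (2*j + 1) \<in> redof F (red_ray F x (2*j))"
  using prior_red(2)[OF ray_vertex, of x j] red_ray_even[of x j] red_ray_odd[of x j] by simp

lemma red_ray_src_odd: "x \<in> blue_rays F \<Longrightarrow> src F (red_ray F x (2*j + 1)) = rng F (x (2*j + 2))"
  using red_from(2)[OF ray_vertex, of x j] red_ray_odd[of x j] by simp

lemma red_ray_link: "x \<in> blue_rays F \<Longrightarrow> src F (red_ray F x n) = rng F (red_ray F x (Suc n))"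
proof (cases "even n")
  case True
  then obtain j where n: "n = 2*j" by blast
  assume x: "x \<in> blue_rays F"
  show ?thesis using prior_red(3)[OF ray_vertex[OF x], of j] red_ray_even[OF x, of j]
    red_ray_odd[OF x, of j] n by simp
next
  case False
  then obtain j where n: "n = 2*j + 1" using oddE by blast
  assume x: "x \<in> blue_rays F"
  show ?thesis using red_ray_src_odd[OF x, of j] red_ray_rng[OF x, of "Suc j"] n by simp
qed

text \<open>The source of \<open>r (2*j + 1)\<close> is a vertex of \<open>x\<close>, and it determines both \<open>r (2*j + 1)\<close> and
  \<open>r (2*j)\<close>.\<close>

lemma shift_witness_red_ray:
  assumes x: "x \<in> blue_rays F" and W: "shift_witness F x y r"
  shows "r = red_ray F x"
proof
  fix n :: nat
  obtain j where n: "n = 2*j \<or> n = 2*j + 1" by (metis evenE oddE)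
  have *: "prior_red (src F (r (2*j + 1))) = r (2*j)" "red_from (src F (r (2*j + 1))) = r (2*j + 1)"
    using W prior_red_eqI[of "r (2*j)" j "r (2*j + 1)"] unfolding shift_witness_def by metis+
  have "src F (r (2*j + 1)) = rng F (x (2*j + 2))" using W unfolding shift_witness_def by metis
  then show "r n = red_ray F x n" using * red_ray_even[OF x, of j] red_ray_odd[OF x, of j] n by auto
qed

text \<open>The definite descriptions in \<^const>\<open>ray_shift\<close> are evaluated here, once and for all.\<close>

lemma shift_eqI:
  assumes x: "x \<in> blue_rays F" and y: "y \<in> blue_rays F" and W: "shift_witness F x y r"
  shows "ray_shift F x = y"
proof -
  have r: "red_ray F x = r" using shift_witness_red_ray[OF x W] by simp
  have ry: "src F (r (2*j)) = rng F (y (2*j + 1))" for j using W unfolding shift_witness_def by metis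
  have rr: "rng F (r (2*j + 1)) = rng F (y (2*j + 1))" for j
    using red_ray_link[OF x, of "2*j"] r ry by simp
  have bp: "blue_pair F (r (2*j + 1)) (r (2*j + 2)) = (y (2*j + 1), y (2*j + 2))" for j
    unfolding blue_pair_def
  proof (rule the_equality)
    have s: "src F (r (2*j + 2)) = src F (y (2*j + 2))"
      using ry[of "Suc j"] ray_src[OF y, of "2*j + 2"] by (simp add: numeral_eq_Suc)
    have yv: "rng F (y n) \<in> verts F n" for n using ray_vertex[OF y] .
    show "fst (y (2*j + 1), y (2*j + 2)) \<in> blue F (rng F (r (2*j + 1))) \<and>
      snd (y (2*j + 1), y (2*j + 2)) \<in> blue F (src F (fst (y (2*j + 1), y (2*j + 2)))) \<and>
      src F (snd (y (2*j + 1), y (2*j + 2))) = src F (r (2*j + 2))"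
      using blueI[OF ray_edge[OF y]] ray_src[OF y] rr s by simp
    fix p assume p: "fst p \<in> blue F (rng F (r (2*j + 1))) \<and> snd p \<in> blue F (src F (fst p)) \<and>
         src F (snd p) = src F (r (2*j + 2))"
    have "rng F (r (2*j + 1)) \<in> verts F (2*j + 1)" using yv[of "2*j + 1"] rr by simp
    then have f: "fst p \<in> blue_edges F (2*j + 1)" using p by (simp add: blue_iff)
    have "src F (fst p) \<in> verts F (2*j + 2)" using src_edge[OF blue_edge[OF f]] by simp
    then have g: "snd p \<in> blue_edges F (2*j + 2)" "rng F (snd p) = src F (fst p)"
      using p by (simp_all add: blue_iff)
    \<comment> \<open>Blue edges are determined by their sources, so the pair is found from its end backwards.\<close>
    have "snd p = y (2*j + 2)" using blue_from_eqI[OF g(1)] blue_from_eqI[OF ray_edge[OF y]] p s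
      by metis
    moreover from this have "fst p = y (2*j + 1)"
      using blue_from_eqI[OF f] g(2) blue_from_eqI[OF ray_edge[OF y]] ray_src[OF y, of "2*j+1"]
        by (metis Suc_1 add_Suc_right)
    ultimately show "p = (y (2*j + 1), y (2*j + 2))" by (simp add: prod_eq_iff)
  qed
  have pos: "ray_shift_pos F x i = y i" if "i > 0" for i
  proof (cases "even i")
    case False
    then obtain j where "i = 2*j + 1" using oddE by blast
    then show ?thesis using bp[of j] by (simp add: ray_shift_pos_def r)
  next
    case True
    then have "i = 2*(i div 2 - 1) + 2" using that by presburger
    then obtain j where i: "i = 2*j + 2" by blast
    then show ?thesis using bp[of j] by (simp add: ray_shift_pos_def r)
  qed
  show ?thesis
  proof
    fix i
    have "(THE e. e \<in> blue_edges F 0 \<and> src F e = rng F (y 1)) = y 0"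
    proof (rule the_equality)
      show "y 0 \<in> blue_edges F 0 \<and> src F (y 0) = rng F (y 1)"
        using ray_edge[OF y] ray_src[OF y, of 0] by simp
      fix e assume "e \<in> blue_edges F 0 \<and> src F e = rng F (y 1)"
      then show "e = y 0" using blue_from_eqI[of e 0] ray_blue_from[OF y, of 0] by simp
    qed
    then show "ray_shift F x i = y i" using pos by (simp add: ray_shift_def)
  qed
qed

lemma parent_parent_red_src:
  assumes x: "x \<in> blue_rays F"
  shows "parent (parent (src F (red_ray F x (2*j + 2)))) = src F (red_ray F x (2*j))"
proof -
  have "red_ray F x (2*j + 2) \<in> red_edges F (2*j + 2)" using red_ray_edge[OF x] .
  from red_source_grandparent[OF this] show ?thesis
    using red_ray_rng[OF x, of "Suc j"] red_ray_even[OF x, of j] by simp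
qed

lemma ray_shift:
  assumes x: "x \<in> blue_rays F"
  shows "ray_shift F x \<in> blue_rays F" "shift_witness F x (ray_shift F x) (red_ray F x)"
proof -
  \<comment> \<open>The image is the ray through the sources of the even red edges.\<close>
  have "\<exists>y \<in> blue_rays F. \<forall>j. rng F (y (2*j + 1)) = src F (red_ray F x (2*j))"
  proof (rule ray_cofinal)
    fix j
    show "src F (red_ray F x (2*j)) \<in> verts F (2*j + 1)"
      using src_edge[OF red_edge[OF red_ray_edge[OF x]], of "2*j"] by simp
    show "(parent ^^ (2 * Suc j + 1 - (2 * j + 1))) (src F (red_ray F x (2 * Suc j))) =
      src F (red_ray F x (2 * j))"
      using parent_parent_red_src[OF x, of j] by (simp add: numeral_2_eq_2)
  qed simp
  then obtain y where y: "y \<in> blue_rays F" "\<And>j. rng F (y (2*j + 1)) = src F (red_ray F x (2*j))"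
    by blast
  have W: "shift_witness F x y (red_ray F x)"
    unfolding shift_witness_def
    using y(2) red_ray_edge[OF x] red_ray_redof[OF x] red_ray_src_odd[OF x] by simp
  have "ray_shift F x = y" using shift_eqI[OF x y(1) W] .
  then show "ray_shift F x \<in> blue_rays F" "shift_witness F x (ray_shift F x) (red_ray F x)"
    using y W by auto
qed

lemma ray_shift_odd:
  assumes "x \<in> blue_rays F"
  shows "rng F (ray_shift F x (2*j + 1)) = src F (red_ray F x (2*j))"
  using ray_shift(2)[OF assms] unfolding shift_witness_def by metis

lemma red_ray_rng_odd:
  assumes "x \<in> blue_rays F"
  shows "rng F (red_ray F x (2*j + 1)) = rng F (ray_shift F x (2*j + 1))"
  using red_ray_link[OF assms, of "2*j"] ray_shift_odd[OF assms, of j] by simp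

text \<open>Restricted to the rays whose red ray passes through a red edge \<open>f\<close> at an even level, the
  shift is a bijection onto the rays through the source of \<open>f\<close>: by \<open>red_lift\<close> the red ray can be
  continued along any given image in exactly one way, and a ray is determined by its red ray.\<close>

lemma shift_lift:
  assumes f: "f \<in> red_edges F (2*j)" and y: "y \<in> blue_rays F" and fy: "rng F (y (2*j + 1)) = src F f"
  shows "\<exists>x \<in> blue_rays F. ray_shift F x = y \<and> red_ray F x (2*j) = f"
proof -
  \<comment> \<open>The red edge at the next even level over \<open>g\<close> that points to the given image ray.\<close>
  define nx where "nx k g = (THE f'. f' \<in> red_edges F (2*(j+k) + 2) \<and>
    src F f' = rng F (y (2*(j+k) + 3)) \<and>
     prior_red (rng F f') = g)" for k g
  define h where "h = rec_nat f nx"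
  have h0: "h 0 = f" and hS: "h (Suc k) = nx k (h k)" for k by (simp_all add: h_def)
  have yv: "rng F (y n) \<in> verts F n" for n using ray_vertex[OF y] .
  have st: "h (Suc k) \<in> red_edges F (2*(j+k) + 2) \<and> src F (h (Suc k)) = rng F (y (2*(j+k) + 3)) \<and>
     prior_red (rng F (h (Suc k))) = h k"
    if "h k \<in> red_edges F (2*(j+k))" "src F (h k) = rng F (y (2*(j+k) + 1))" for k
  proof -
    have "parent (parent (rng F (y (2*(j+k) + 3)))) = src F (h k)"
      using ray_parent[OF y, of "2*(j+k) + 1"] ray_parent[OF y, of "2*(j+k) + 2"] that(2)
      by (simp add: numeral_eq_Suc)
    from theI'[OF red_lift[OF that(1) yv this]] show ?thesis unfolding hS nx_def .
  qed
  have H: "h k \<in> red_edges F (2*(j+k)) \<and> src F (h k) = rng F (y (2*(j+k) + 1))" for k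
  proof (induction k)
    case (Suc k)
    then show ?case using st[of k] by (simp add: numeral_eq_Suc)
  qed (use f fy h0 in simp)
  have R: "prior_red (rng F (h (Suc k))) = h k" for k using st H by blast
  have hv: "rng F (h k) \<in> verts F (2*(j+k))" for k using rng_edge[OF red_edge] H by blast
  have "\<exists>x \<in> blue_rays F. \<forall>k. rng F (x (2*(j+k))) = rng F (h k)"
  proof (rule ray_cofinal)
    fix k
    show "rng F (h k) \<in> verts F (2*(j+k))" by (rule hv)
    have "parent (parent (rng F (h (Suc k)))) = rng F (h k)"
      using prior_red(4)[of "rng F (h (Suc k))" "j+k"] hv[of "Suc k"] R by simp
    then show "(parent ^^ (2 * (j + Suc k) - 2 * (j + k))) (rng F (h (Suc k))) = rng F (h k)"
      by (simp add: numeral_2_eq_2)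
  qed simp
  then obtain x where x: "x \<in> blue_rays F" "\<And>k. rng F (x (2*(j+k))) = rng F (h k)" by blast
  have rx: "red_ray F x (2*(j+k)) = h k" for k
    using red_ray_even[OF x(1), of "j+k"] x(2)[of "Suc k"] R[of k] by simp
  have "ray_shift F x = y"
  proof (rule ray_eqI[OF ray_shift(1)[OF x(1)] y])
    fix k
    have "rng F (ray_shift F x (2*(j+k) + 1)) = rng F (y (2*(j+k) + 1))"
      using ray_shift_odd[OF x(1), of "j+k"] rx H by simp
    then show "\<exists>n>k. rng F (ray_shift F x n) = rng F (y n)"
      by (intro exI[of _ "2*(j+k) + 1"]) simp
  qed
  then show ?thesis using x(1) rx[of 0] h0 by auto
qed

lemma shift_inj:
  assumes x: "x \<in> blue_rays F" and x': "x' \<in> blue_rays F"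
    and s: "ray_shift F x = ray_shift F x'" and f: "red_ray F x (2*j) = red_ray F x' (2*j)"
  shows "x = x'"
proof -
  have R: "red_ray F x (2*(j+k)) = red_ray F x' (2*(j+k))" for k
  proof (induction k)
    case (Suc k)
    let ?f = "red_ray F x (2*(j+k))"
    let ?w = "rng F (ray_shift F x (2*(j+k) + 3))"
    have y: "ray_shift F x \<in> blue_rays F" using ray_shift(1)[OF x] .
    have fe: "?f \<in> red_edges F (2*(j+k))" using red_ray_edge[OF x] .
    have w: "?w \<in> verts F (2*(j+k) + 3)" using ray_vertex[OF y] .
    have p: "parent (parent ?w) = src F ?f"
      using ray_parent[OF y, of "2*(j+k) + 1"] ray_parent[OF y, of "2*(j+k) + 2"]
        ray_shift_odd[OF x, of "j+k"]
      by (simp add: numeral_eq_Suc)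
    have *: "red_ray F z (2*(j+k) + 2) \<in> red_edges F (2*(j+k) + 2) \<and>
      src F (red_ray F z (2*(j+k) + 2)) = ?w \<and>
      prior_red (rng F (red_ray F z (2*(j+k) + 2))) = ?f"
      if z: "z \<in> blue_rays F" "ray_shift F z = ray_shift F x" "red_ray F z (2*(j+k)) = ?f" for z
      using red_ray_edge[OF z(1)] ray_shift_odd[OF z(1), of "Suc (j+k)"] z(2,3)
        red_ray_rng[OF z(1), of "Suc (j+k)"] red_ray_even[OF z(1), of "j+k"]
          by (simp add: numeral_eq_Suc)
    have "red_ray F x (2*(j+k) + 2) = red_ray F x' (2*(j+k) + 2)"
      using red_lift[OF fe w p] *[OF x refl refl] *[OF x' s[symmetric] Suc[symmetric]] by blast
    then show ?case by simp
  qed (simp add: f)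
  show ?thesis
  proof (rule ray_eqI[OF x x'])
    fix k
    have "rng F (x (2*(j + Suc k))) = rng F (x' (2*(j + Suc k)))"
      using R[of "Suc k"] red_ray_rng[OF x, of "j + Suc k"] red_ray_rng[OF x', of "j + Suc k"] by simp
    then show "\<exists>n>k. rng F (x n) = rng F (x' n)" by (intro exI[of _ "2*(j + Suc k)"]) simp
  qed
qed

text \<open>Every vertex at level 1 is the source of a red edge, over which \<open>shift_lift\<close> applies.\<close>

lemma shift_onto:
  assumes y: "y \<in> blue_rays F"
  shows "\<exists>x \<in> blue_rays F. ray_shift F x = y"
proof -
  have "rng F (y 1) \<in> verts F 1" using ray_vertex[OF y] .
  also have "verts F 1 = (\<Union>v \<in> verts F 0. src F ` red F v)"
    using firsts unfolding l_first_level_sources_def by metis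
  finally obtain v f where v: "v \<in> verts F 0" "f \<in> red F v" "rng F (y 1) = src F f" by blast
  then have "f \<in> red_edges F (2*0)" by (simp add: red_iff)
  from shift_lift[OF this y] v(3) show ?thesis by auto
qed

text \<open>The shift is continuous: finitely many edges of the red ray and of the image ray depend on one
  even vertex of the ray.\<close>

lemma red_ray_below:
  assumes x: "x \<in> blue_rays F" and x': "x' \<in> blue_rays F"
    and e: "rng F (x (2*j)) = rng F (x' (2*j))" and i: "i < 2*j"
  shows "red_ray F x i = red_ray F x' i"
proof -
  obtain k where k: "i = 2*k \<or> i = 2*k + 1" by (metis evenE oddE)
  then have "2*k + 2 \<le> 2*j" using i by auto
  then have "rng F (x (2*k + 2)) = rng F (x' (2*k + 2))" using ray_vertex_below[OF x x' e] by blast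
  then show ?thesis using k red_ray_even[OF x] red_ray_even[OF x'] red_ray_odd[OF x]
    red_ray_odd[OF x'] by auto
qed

lemma ray_shift_below:
  assumes x: "x \<in> blue_rays F" and x': "x' \<in> blue_rays F"
    and e: "rng F (x (2*j + 2)) = rng F (x' (2*j + 2))" and i: "i \<le> 2*j + 1"
  shows "rng F (ray_shift F x i) = rng F (ray_shift F x' i)"
proof -
  have "red_ray F x (2*j) = red_ray F x' (2*j)" using red_ray_below[OF x x', of "Suc j"] e by simp
  then have "rng F (ray_shift F x (2*j + 1)) = rng F (ray_shift F x' (2*j + 1))"
    using ray_shift_odd[OF x] ray_shift_odd[OF x'] by simp
  then show ?thesis using ray_vertex_below[OF ray_shift(1)[OF x] ray_shift(1)[OF x']] i by blast
qed

end

section \<open>The space of rays\<close>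

context l_diagram
begin

lemma topspace_ray_topology: "topspace (ray_topology F) = blue_rays F"
proof -
  have "x \<in> \<Union> {ray_cylinder F es |es. es \<noteq> []}" if "x \<in> blue_rays F" for x
  proof -
    have "x \<in> ray_cylinder F [x 0]" using that by (simp add: ray_cylinder_def)
    then show ?thesis by blast
  qed
  then show ?thesis unfolding ray_topology_def topology_generated_by_topspace
    by (auto simp: ray_cylinder_def)
qed

lemma openin_coordinate: "openin (ray_topology F) {x \<in> blue_rays F. x n \<in> A}"
proof -
  have "{x \<in> blue_rays F. x n \<in> A} =
    \<Union> {ray_cylinder F (map x [0..<Suc n]) |x. x \<in> blue_rays F \<and> x n \<in> A}" (is "?L = \<Union> ?R")
  proof
    show "?L \<subseteq> \<Union> ?R"
    proof
      fix x assume x: "x \<in> ?L"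
      have "x \<in> ray_cylinder F (map x [0..<Suc n])" using x by (simp add: ray_cylinder_def del: upt_Suc)
      then show "x \<in> \<Union> ?R" using x by blast
    qed
    show "\<Union> ?R \<subseteq> ?L"
    proof
      fix y assume "y \<in> \<Union> ?R"
      then obtain x where x: "x n \<in> A" "y \<in> ray_cylinder F (map x [0..<Suc n])" by blast
      then have "y n = map x [0..<Suc n] ! n" by (simp add: ray_cylinder_def del: upt_Suc)
      also have "\<dots> = x n" by (simp del: upt_Suc)
      finally show "y \<in> ?L" using x by (simp add: ray_cylinder_def)
    qed
  qed
  moreover have "openin (ray_topology F) R" if "R \<in> ?R" for R
  proof -
    obtain x where "R = ray_cylinder F (map x [0..<Suc n])" using \<open>R \<in> ?R\<close> by blast
    then show ?thesis unfolding ray_topology_def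
      by (intro topology_generated_by_Basis) (auto simp del: upt_Suc)
  qed
  ultimately show ?thesis by (metis (no_types, lifting) openin_Union)
qed

lemma clopen_coordinate:
  "openin (ray_topology F) {x \<in> blue_rays F. P (x n)}"
  "closedin (ray_topology F) {x \<in> blue_rays F. P (x n)}"
proof -
  show "openin (ray_topology F) {x \<in> blue_rays F. P (x n)}"
    using openin_coordinate[of n "Collect P"] by simp
  have "topspace (ray_topology F) - {x \<in> blue_rays F. P (x n)} = {x \<in> blue_rays F. x n \<in>
    Collect (\<lambda>e. \<not> P e)}"
    by (auto simp: topspace_ray_topology)
  then have "openin (ray_topology F) (topspace (ray_topology F) - {x \<in> blue_rays F. P (x n)})"
    by (simp only: openin_coordinate)
  then show "closedin (ray_topology F) {x \<in> blue_rays F. P (x n)}"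
    by (auto simp: closedin_def topspace_ray_topology)
qed

text \<open>A vertex determines all earlier edges of the rays through it, so an initial path may be replaced
  by its last vertex in the description of the topology.\<close>

lemma ray_base:
  assumes "openin (ray_topology F) U" "x \<in> U"
  shows "\<exists>n. \<forall>y \<in> blue_rays F. rng F (y n) = rng F (x n) \<longrightarrow> y \<in> U"
proof -
  let ?T = "\<lambda>U. U \<subseteq> blue_rays F \<and>
    (\<forall>x \<in> U. \<exists>n. \<forall>y \<in> blue_rays F. rng F (y n) = rng F (x n) \<longrightarrow> y \<in> U)"
  have "istopology ?T" unfolding istopology_def
  proof (intro conjI allI impI)
    fix S T assume S: "?T S" and T: "?T T"
    show "S \<inter> T \<subseteq> blue_rays F" using S by blast
    show "\<forall>x \<in> S \<inter> T. \<exists>n. \<forall>y \<in> blue_rays F. rng F (y n) = rng F (x n) \<longrightarrow> y \<in> S \<inter> T"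
    proof
      fix x assume x: "x \<in> S \<inter> T"
      obtain a where a: "\<forall>y \<in> blue_rays F. rng F (y a) = rng F (x a) \<longrightarrow> y \<in> S" using S x by blast
      obtain b where b: "\<forall>y \<in> blue_rays F. rng F (y b) = rng F (x b) \<longrightarrow> y \<in> T" using T x by blast
      have xr: "x \<in> blue_rays F" using S x by blast
      have "y \<in> S \<inter> T" if y: "y \<in> blue_rays F" "rng F (y (max a b)) = rng F (x (max a b))" for y
        using ray_vertex_below[OF y(1) xr y(2), of a] ray_vertex_below[OF y(1) xr y(2), of b] a b y(1)
        by simp
      then show "\<exists>n. \<forall>y \<in> blue_rays F. rng F (y n) = rng F (x n) \<longrightarrow> y \<in> S \<inter> T" by blast
    qed
  next
    fix K assume "\<forall>S\<in>K. ?T S"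
    then show "\<Union>K \<subseteq> blue_rays F"
      "\<forall>x \<in> \<Union>K. \<exists>n. \<forall>y \<in> blue_rays F. rng F (y n) = rng F (x n) \<longrightarrow> y \<in> \<Union>K"
      by (blast, meson UnionE UnionI)
  qed
  moreover have "?T S" if "S \<in> {ray_cylinder F es |es. es \<noteq> []}" for S
  proof -
    obtain es where es: "S = ray_cylinder F es" using \<open>S \<in> _\<close> by blast
    have "y \<in> S" if x: "x \<in> S" and y: "y \<in> blue_rays F"
      "rng F (y (length es)) = rng F (x (length es))" for x y
    proof -
      have "x \<in> blue_rays F" using x es by (simp add: ray_cylinder_def)
      then have "y i = x i" if "i < length es" for i
        using ray_edge_below[of y x "length es" i] y that by simp
      then show ?thesis using x y(1) es by (simp add: ray_cylinder_def)
    qed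
    moreover have "S \<subseteq> blue_rays F" using es by (auto simp: ray_cylinder_def)
    ultimately show ?thesis by blast
  qed
  moreover have "generate_topology_on {ray_cylinder F es |es. es \<noteq> []} U"
    using assms(1) by (simp add: ray_topology_def openin_topology_generated_by_iff)
  ultimately have "?T U" by (rule generate_topology_on_coarsest)
  then show ?thesis using assms(2) by blast
qed

lemma ray_continuousI:
  assumes h: "\<And>x. x \<in> topspace X \<Longrightarrow> h x \<in> blue_rays F"
    and op: "\<And>n v. v \<in> verts F n \<Longrightarrow> openin X {x \<in> topspace X. rng F (h x n) = v}"
  shows "continuous_map X (ray_topology F) h"
  unfolding continuous_map_def
proof (intro conjI allI impI)
  show "h \<in> topspace X \<rightarrow> topspace (ray_topology F)" using h by (auto simp: topspace_ray_topology)
  fix U assume U: "openin (ray_topology F) U"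
  show "openin X {x \<in> topspace X. h x \<in> U}"
  proof (subst openin_subopen, intro ballI)
    fix x assume x: "x \<in> {x \<in> topspace X. h x \<in> U}"
    obtain n where n: "\<forall>y \<in> blue_rays F. rng F (y n) = rng F (h x n) \<longrightarrow> y \<in> U"
      using ray_base[OF U, of "h x"] x by blast
    let ?T = "{z \<in> topspace X. rng F (h z n) = rng F (h x n)}"
    have "openin X ?T" using op[OF ray_vertex[OF h]] x by blast
    moreover have "?T \<subseteq> {x \<in> topspace X. h x \<in> U}" using n h by blast
    ultimately show "\<exists>T. openin X T \<and> x \<in> T \<and> T \<subseteq> {x \<in> topspace X. h x \<in> U}"
      using x by (intro exI[of _ ?T]) simp
  qed
qed

abbreviation "edge_product \<equiv> product_topology (\<lambda>n. discrete_topology (edges F n)) UNIV"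

text \<open>Compactness and metrizability are inherited from a countable product of finite discrete spaces,
  in which the rays form a closed set.\<close>

lemma ray_topology_product: "ray_topology F = subtopology edge_product (blue_rays F)"
proof (rule topology_eq[THEN iffD2], intro allI iffI)
  have tp: "blue_rays F \<subseteq> topspace edge_product" using blue_edge[OF ray_edge] by (auto simp: PiE_def)
  have proj: "openin edge_product {x \<in> topspace edge_product. x n \<in> A}" if "A \<subseteq> edges F n" for n A
    by (rule openin_continuous_map_preimage[OF continuous_map_product_projection]) (use that in auto)
  {
    fix S assume "openin (subtopology edge_product (blue_rays F)) S"
    moreover have "continuous_map (ray_topology F) (subtopology edge_product (blue_rays F)) id"
    proof (rule continuous_map_into_subtopology)
      show "continuous_map (ray_topology F) edge_product id"
        unfolding continuous_map_componentwise_UNIV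
      proof
        fix k
        have "openin (ray_topology F) {x \<in> blue_rays F. x k \<in> A}" for A by (rule openin_coordinate)
        then show "continuous_map (ray_topology F) (discrete_topology (edges F k)) (\<lambda>x. id x k)"
          using blue_edge[OF ray_edge] by (auto simp: continuous_map_def topspace_ray_topology)
      qed
    qed (simp add: topspace_ray_topology)
    ultimately show "openin (ray_topology F) S"
      using openin_continuous_map_preimage[of "ray_topology F" _ id S] openin_subset[of _ S]
      by (fastforce simp: topspace_ray_topology Int_absorb1 Collect_conj_eq dest: openin_subset)
  }
  {
    fix S assume S: "openin (ray_topology F) S"
    show "openin (subtopology edge_product (blue_rays F)) S"
    proof (subst openin_subopen, intro ballI)
      fix x assume x: "x \<in> S"
      have xr: "x \<in> blue_rays F" using openin_subset[OF S] x by (auto simp: topspace_ray_topology)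
      obtain n where n: "\<forall>y \<in> blue_rays F. rng F (y n) = rng F (x n) \<longrightarrow> y \<in> S"
        using ray_base[OF S x] by blast
      let ?T = "{y \<in> topspace edge_product. y n \<in> {e \<in> edges F n. rng F e = rng F (x n)}} \<inter> blue_rays F"
      have "openin (subtopology edge_product (blue_rays F)) ?T"
        by (intro openin_subtopology_Int proj) blast
      moreover have "x \<in> ?T" using xr tp blue_edge[OF ray_edge[OF xr]] by auto
      moreover have "?T \<subseteq> S" using n by auto
      ultimately show "\<exists>T. openin (subtopology edge_product (blue_rays F)) T \<and> x \<in> T \<and> T \<subseteq> S" by blast
    qed
  }
qed

lemma compact_ray_topology: "compact_space (ray_topology F)"
proof -
  have tp: "blue_rays F \<subseteq> topspace edge_product" using blue_edge[OF ray_edge] by (auto simp: PiE_def)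
  have proj: "closedin edge_product {x \<in> topspace edge_product. x n \<in> A}" if "A \<subseteq> edges F n" for n A
    by (rule closedin_continuous_map_preimage[OF continuous_map_product_projection]) (use that in auto)
  let ?C = "\<lambda>n e. {x \<in> topspace edge_product. x n \<in> {e}} \<inter>
     {x \<in> topspace edge_product. x (Suc n) \<in> {e' \<in> edges F (Suc n). rng F e' = src F e}}"
  have cl: "closedin edge_product (?C n e)" if "e \<in> blue_edges F n" for n e
    using that blue_edge[OF that] by (intro closedin_Int proj) auto
  have fin: "finite (blue_edges F n)" for n
    using finite_edges[of n] by (auto simp: blue_edges_def intro: finite_subset)
  have "closedin edge_product (\<Inter>n. \<Union>e \<in> blue_edges F n. ?C n e)"
    using cl fin by (intro closedin_INT closedin_Union) auto
  also have "(\<Inter>n. \<Union>e \<in> blue_edges F n. ?C n e) = blue_rays F"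
  proof
    show "(\<Inter>n. \<Union>e \<in> blue_edges F n. ?C n e) \<subseteq> blue_rays F" by (auto simp: blue_rays_def)
    show "blue_rays F \<subseteq> (\<Inter>n. \<Union>e \<in> blue_edges F n. ?C n e)"
    proof (intro subsetI INT_I)
      fix x n assume x: "x \<in> blue_rays F"
      have "x \<in> ?C n (x n)"
        using tp x blue_edge[OF ray_edge[OF x]] ray_src[OF x] by auto
      then show "x \<in> (\<Union>e \<in> blue_edges F n. ?C n e)" using ray_edge[OF x, of n] by blast
    qed
  qed
  finally have "closedin edge_product (blue_rays F)" .
  moreover have "compact_space edge_product"
    using finite_edges by (simp add: compact_space_product_topology compact_space_discrete_topology)
  ultimately show ?thesis
    unfolding ray_topology_product using closedin_compact_space compact_space_subtopology by blast
qed

lemma metrizable_ray_topology: "metrizable_space (ray_topology F)"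
  unfolding ray_topology_product
  by (intro metrizable_space_subtopology) (simp add: metrizable_space_product_topology)

lemma Hausdorff_ray_topology: "Hausdorff_space (ray_topology F)"
  by (rule metrizable_imp_Hausdorff_space[OF metrizable_ray_topology])

lemma totally_disconnected_ray_topology: "totally_disconnected_space (ray_topology F)"
  unfolding totally_disconnected_space_def
proof (intro allI impI)
  fix S assume S: "connectedin (ray_topology F) S"
  have "x = y" if "x \<in> S" "y \<in> S" for x y
  proof
    fix n
    let ?T = "{z \<in> blue_rays F. z n = x n}"
    have "S \<subseteq> ?T \<or> disjnt S ?T"
      using connectedin_clopen_cases[OF S] clopen_coordinate[of "\<lambda>e. e = x n"] by blast
    moreover have "x \<in> ?T" using S that by (auto simp: connectedin_def topspace_ray_topology)
    ultimately have "y \<in> ?T" using that by (auto simp: disjnt_def)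
    then show "x n = y n" by simp
  qed
  then show "\<exists>a. S \<subseteq> {a}" by blast
qed

lemma rays_nonempty: "blue_rays F \<noteq> {}"
proof -
  obtain v where "v \<in> verts F 0" using verts_nonempty[of 0] by blast
  from ray_through[OF this] show ?thesis by blast
qed

lemma continuous_ray_shift: "continuous_map (ray_topology F) (ray_topology F) (ray_shift F)"
proof (rule ray_continuousI)
  show "ray_shift F x \<in> blue_rays F" if "x \<in> topspace (ray_topology F)" for x
    using ray_shift(1) that by (simp add: topspace_ray_topology)
  fix n v
  show "openin (ray_topology F) {x \<in> topspace (ray_topology F). rng F (ray_shift F x n) = v}"
  proof (subst openin_subopen, intro ballI)
    fix x assume "x \<in> {x \<in> topspace (ray_topology F). rng F (ray_shift F x n) = v}"
    then have x: "x \<in> blue_rays F" "rng F (ray_shift F x n) = v"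
      by (simp_all add: topspace_ray_topology)
    let ?T = "{z \<in> blue_rays F. rng F (z (2*n + 2)) = rng F (x (2*n + 2))}"
    have "?T \<subseteq> {x \<in> topspace (ray_topology F). rng F (ray_shift F x n) = v}"
    proof
      fix z assume z: "z \<in> ?T"
      have "rng F (ray_shift F z n) = rng F (ray_shift F x n)"
        by (rule ray_shift_below[of z x n]) (use z x in auto)
      then show "z \<in> {x \<in> topspace (ray_topology F). rng F (ray_shift F x n) = v}"
        using z x by (simp add: topspace_ray_topology)
    qed
    moreover have "openin (ray_topology F) ?T" by (rule clopen_coordinate)
    ultimately show "\<exists>T. openin (ray_topology F) T \<and> x \<in> T \<and>
        T \<subseteq> {x \<in> topspace (ray_topology F). rng F (ray_shift F x n) = v}"
      using x by (intro exI[of _ ?T]) auto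
  qed
qed

text \<open>The clopen set of rays with a given first red edge is mapped bijectively onto the clopen set of
  rays through its source, and a continuous bijection of compact Hausdorff spaces is a homeomorphism.\<close>

lemma local_homeomorphism_ray_shift: "local_homeomorphism (ray_topology F) (ray_shift F)"
  unfolding local_homeomorphism_def
proof (intro conjI ballI continuous_ray_shift)
  fix x assume "x \<in> topspace (ray_topology F)"
  then have x: "x \<in> blue_rays F" by (simp add: topspace_ray_topology)
  let ?f = "red_ray F x 0"
  let ?U = "{z \<in> blue_rays F. red_ray F z 0 = ?f}"
  have U: "?U = {z \<in> blue_rays F. prior_red (rng F (z 2)) = ?f}"
    using red_ray_even[of _ 0] by (auto simp: numeral_2_eq_2)
  have cU: "closedin (ray_topology F) ?U" and oU: "openin (ray_topology F) ?U"
    unfolding U by (rule clopen_coordinate)+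
  have f: "?f \<in> red_edges F (2*0)" using red_ray_edge[OF x] by simp
  have im: "ray_shift F ` ?U = {y \<in> blue_rays F. rng F (y 1) = src F ?f}"
  proof (intro equalityI subsetI)
    fix y assume "y \<in> ray_shift F ` ?U"
    then obtain z where z: "z \<in> blue_rays F" "red_ray F z 0 = ?f" "y = ray_shift F z" by blast
    then show "y \<in> {y \<in> blue_rays F. rng F (y 1) = src F ?f}"
      using ray_shift(1)[OF z(1)] ray_shift_odd[OF z(1), of 0] by simp
  next
    fix y assume "y \<in> {y \<in> blue_rays F. rng F (y 1) = src F ?f}"
    then obtain z where "z \<in> blue_rays F" "ray_shift F z = y" "red_ray F z 0 = ?f"
      using shift_lift[OF f, of y] by auto
    then show "y \<in> ray_shift F ` ?U" by blast
  qed
  have "homeomorphic_map (subtopology (ray_topology F) ?U) (subtopology (ray_topology F) (ray_shift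
    F ` ?U)) (ray_shift F)"
  proof (rule continuous_imp_homeomorphic_map)
    show "continuous_map (subtopology (ray_topology F) ?U) (subtopology (ray_topology F) (ray_shift
      F ` ?U)) (ray_shift F)"
      by (rule continuous_map_into_subtopology)
        (auto intro: continuous_map_from_subtopology continuous_ray_shift)
    show "compact_space (subtopology (ray_topology F) ?U)"
      using closedin_compact_space[OF compact_ray_topology cU] compact_space_subtopology by blast
    show "Hausdorff_space (subtopology (ray_topology F) (ray_shift F ` ?U))"
      by (rule Hausdorff_space_subtopology[OF Hausdorff_ray_topology])
    show "ray_shift F ` topspace (subtopology (ray_topology F) ?U) =
        topspace (subtopology (ray_topology F) (ray_shift F ` ?U))"
      using im by (auto simp: topspace_ray_topology)
    show "inj_on (ray_shift F) (topspace (subtopology (ray_topology F) ?U))"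
      by (rule inj_onI) (use shift_inj[of _ _ 0] in \<open>auto simp: topspace_ray_topology\<close>)
  qed
  moreover have "openin (ray_topology F) (ray_shift F ` ?U)" unfolding im by (rule clopen_coordinate)
  moreover have "x \<in> ?U" using x by simp
  ultimately show "\<exists>U. openin (ray_topology F) U \<and> x \<in> U \<and> openin (ray_topology F) (ray_shift F ` U) \<and>
      homeomorphic_map (subtopology (ray_topology F) U) (subtopology (ray_topology F) (ray_shift F
        ` U)) (ray_shift F)"
    using oU by blast
qed

theorem ray_system_LHomeo: "ray_system F \<in> LHomeo"
proof -
  have "ray_shift F ` blue_rays F = blue_rays F"
    using ray_shift(1) shift_onto by (force simp: image_iff)
  moreover have "ray_topology F \<noteq> trivial_topology"
    using rays_nonempty topspace_ray_topology by auto
  ultimately show ?thesis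
    unfolding LHomeo_def ray_system_def
    using totally_disconnected_ray_topology compact_ray_topology metrizable_ray_topology
      local_homeomorphism_ray_shift by (simp add: topspace_ray_topology)
qed

end

section \<open>Clopen partitions and \<open>\<sigma>\<close>-refined sequences\<close>

definition cell_of :: "'a set set \<Rightarrow> 'a \<Rightarrow> 'a set" where
  "cell_of Q x = (THE Z. Z \<in> Q \<and> x \<in> Z)"

text \<open>The purely topological part of being \<open>\<sigma>\<close>-refined: for a compact space the metric condition on
  diameters and the condition on generating the topology both amount to the last clause.\<close>

definition clopen_base :: "'a topology \<Rightarrow> (nat \<Rightarrow> 'a set set) \<Rightarrow> bool" where
  "clopen_base X P \<longleftrightarrow> (\<forall>n. clopen_partition X (P n)) \<and> (\<forall>n. P n \<precsim>p P (Suc n)) \<and>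
     (\<forall>U x. openin X U \<longrightarrow> x \<in> U \<longrightarrow> (\<exists>n. \<exists>Z \<in> P n. x \<in> Z \<and> Z \<subseteq> U))"

text \<open>What remains of the conditions on \<open>P\<^sup>\<sigma>\<close> and \<open>\<sigma>\<^sup>-\<^sup>1(P)\<close> once fibre cardinalities are eliminated:
  they are replaced by conditions on pairs of cells of consecutive partitions.\<close>

definition sigma_adapted :: "('a \<Rightarrow> 'a) \<Rightarrow> (nat \<Rightarrow> 'a set set) \<Rightarrow> bool" where
  "sigma_adapted \<sigma> P \<longleftrightarrow> (\<forall>Z \<in> P 0. inj_on \<sigma> Z) \<and>
     (\<forall>j. \<forall>Z \<in> P (2*j). \<forall>Z' \<in> P (2*j + 1). \<sigma> ` Z \<inter> Z' \<noteq> {} \<longrightarrow> Z' \<subseteq> \<sigma> ` Z) \<and>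
     (\<forall>j. \<forall>Z' \<in> P (2*j + 2). \<exists>Z \<in> P (2*j + 1). \<sigma> ` Z' \<subseteq> Z)"

lemma cell_of_eqI:
  assumes "partition_on A Q" "Z \<in> Q" "x \<in> Z"
  shows "cell_of Q x = Z"
  unfolding cell_of_def using assms partition_onD2[OF assms(1)]
  by (intro the_equality) (auto simp: disjoint_def)

lemma cell_of:
  assumes "partition_on A Q" "x \<in> A"
  shows "cell_of Q x \<in> Q" "x \<in> cell_of Q x"
proof -
  obtain Z where "Z \<in> Q" "x \<in> Z" using assms by (auto simp: partition_on_def)
  then show "cell_of Q x \<in> Q" "x \<in> cell_of Q x" using cell_of_eqI[OF assms(1)] by auto
qed

lemma clopen_partition_cell:
  assumes "clopen_partition X Q"
  shows "x \<in> topspace X \<Longrightarrow> cell_of Q x \<in> Q" "x \<in> topspace X \<Longrightarrow> x \<in> cell_of Q x"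
    "Z \<in> Q \<Longrightarrow> x \<in> Z \<Longrightarrow> cell_of Q x = Z" "Z \<in> Q \<Longrightarrow> Z \<subseteq> topspace X" "Z \<in> Q \<Longrightarrow> Z \<noteq> {}"
  using assms cell_of[of "topspace X" Q] cell_of_eqI[of "topspace X" Q]
  by (auto simp: clopen_partition_def partition_on_def)

lemma refined_byD: "P \<precsim>p Q \<Longrightarrow> Z' \<in> Q \<Longrightarrow> \<exists>Z \<in> P. Z' \<subseteq> Z"
  by (simp add: refined_by_def)

lemma refined_by_trans: "P \<precsim>p Q \<Longrightarrow> Q \<precsim>p R \<Longrightarrow> P \<precsim>p R"
  unfolding refined_by_def by (meson order_trans)

lemma refined_by_chain:
  assumes "\<And>n. P n \<precsim>p P (Suc n)" "n \<le> k"
  shows "P n \<precsim>p P k"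
  using assms(2)
proof (induction k rule: dec_induct)
  case (step k)
  then show ?case using refined_by_trans assms(1) by blast
qed (auto simp: refined_by_def)

lemma
  assumes "clopen_base X P"
  shows clopen_base_partition: "clopen_partition X (P n)"
    and clopen_base_refine: "n \<le> k \<Longrightarrow> P n \<precsim>p P k"
    and clopen_base_nbhd: "openin X U \<Longrightarrow> x \<in> U \<Longrightarrow> \<exists>n. \<exists>Z \<in> P n. x \<in> Z \<and> Z \<subseteq> U"
  using assms refined_by_chain[of P n k] unfolding clopen_base_def by blast+

lemma refined_cell_subset:
  assumes "clopen_partition X P" "clopen_partition X Q" "P \<precsim>p Q"
    and "Z \<in> P" "Z' \<in> Q" "x \<in> Z" "x \<in> Z'"
  shows "Z' \<subseteq> Z"
proof -
  obtain Y where Y: "Y \<in> P" "Z' \<subseteq> Y" using assms by (auto simp: refined_by_def)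
  then have "Y = Z" using clopen_partition_cell(3)[OF assms(1)] assms by blast
  then show ?thesis using Y by simp
qed

lemma clopen_base_cell_antimono:
  assumes "clopen_base X P" "n \<le> k" "x \<in> topspace X"
  shows "cell_of (P k) x \<subseteq> cell_of (P n) x"
  using refined_cell_subset[OF clopen_base_partition[OF assms(1)] clopen_base_partition[OF assms(1)]
      clopen_base_refine[OF assms(1,2)]] clopen_partition_cell(1,2)[OF clopen_base_partition[OF
        assms(1)]] assms(3)
  by metis

text \<open>The analogue of the Lebesgue number lemma: by compactness finitely many cells, each inside a
  member of the cover, cover the space, and a cell of a later partition lies in one of them.\<close>

lemma clopen_base_refines_cover:
  assumes X: "compact_space X" and P: "clopen_base X P"
    and op: "\<And>U. U \<in> \<U> \<Longrightarrow> openin X U" and cov: "topspace X \<subseteq> \<Union>\<U>"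
  shows "\<exists>N. \<forall>n \<ge> N. \<forall>Z \<in> P n. \<exists>U \<in> \<U>. Z \<subseteq> U"
proof -
  let ?\<C> = "{Z. \<exists>n. Z \<in> P n \<and> (\<exists>U \<in> \<U>. Z \<subseteq> U)}"
  have "openin X Z" if "Z \<in> ?\<C>" for Z
    using that clopen_base_partition[OF P] by (auto simp: clopen_partition_def)
  moreover have "topspace X \<subseteq> \<Union>?\<C>"
  proof
    fix x assume "x \<in> topspace X"
    then obtain U where U: "U \<in> \<U>" "x \<in> U" using cov by blast
    then obtain n Z where "Z \<in> P n" "x \<in> Z" "Z \<subseteq> U" using clopen_base_nbhd[OF P op] by blast
    then show "x \<in> \<Union>?\<C>" using U by blast
  qed
  ultimately obtain \<F> where F: "finite \<F>" "\<F> \<subseteq> ?\<C>" "topspace X \<subseteq> \<Union>\<F>"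
    using X unfolding compact_space_alt by meson
  have "\<forall>Z \<in> \<F>. \<exists>n. Z \<in> P n \<and> (\<exists>U \<in> \<U>. Z \<subseteq> U)" using F(2) by blast
  from bchoice[OF this] obtain lev where
    lev: "\<And>Z. Z \<in> \<F> \<Longrightarrow> Z \<in> P (lev Z) \<and> (\<exists>U \<in> \<U>. Z \<subseteq> U)" by blast
  define N where "N = Max (insert 0 (lev ` \<F>))"
  have N: "lev Z \<le> N" if "Z \<in> \<F>" for Z unfolding N_def using F(1) that by simp
  have "\<exists>U \<in> \<U>. Z \<subseteq> U" if n: "n \<ge> N" and Z: "Z \<in> P n" for n Z
  proof -
    note cp = clopen_partition_cell[OF clopen_base_partition[OF P]]
    obtain x where x: "x \<in> Z" "x \<in> topspace X" using cp(4,5)[OF Z] by blast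
    then obtain Y where Y: "Y \<in> \<F>" "x \<in> Y" using F(3) by blast
    have "lev Y \<le> n" using N[OF Y(1)] n by simp
    then have "Z \<subseteq> Y"
      using refined_cell_subset[OF clopen_base_partition[OF P] clopen_base_partition[OF P]
          clopen_base_refine[OF P]] lev[OF Y(1)] Z x Y by blast
    then show ?thesis using lev[OF Y(1)] by blast
  qed
  then show ?thesis by blast
qed

text \<open>Apply the previous lemma to the covers consisting of \<open>C\<close> and its complement.\<close>

lemma clopen_base_decides:
  assumes X: "compact_space X" and P: "clopen_base X P"
    and C: "finite \<C>" "\<And>C. C \<in> \<C> \<Longrightarrow> openin X C \<and> closedin X C"
  shows "\<exists>N. \<forall>n \<ge> N. \<forall>Z \<in> P n. \<forall>C \<in> \<C>. Z \<inter> C \<noteq> {} \<longrightarrow> Z \<subseteq> C"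
  using C
proof (induction \<C> rule: finite_induct)
  case (insert C \<C>)
  obtain N where N: "\<forall>n \<ge> N. \<forall>Z \<in> P n. \<forall>C \<in> \<C>. Z \<inter> C \<noteq> {} \<longrightarrow> Z \<subseteq> C"
    using insert.IH insert.prems by blast
  have "\<exists>N. \<forall>n \<ge> N. \<forall>Z \<in> P n. \<exists>U \<in> {C, topspace X - C}. Z \<subseteq> U"
    by (rule clopen_base_refines_cover[OF X P]) (use insert.prems in auto)
  then obtain N' where N': "\<forall>n \<ge> N'. \<forall>Z \<in> P n. \<exists>U \<in> {C, topspace X - C}. Z \<subseteq> U" by blast
  have "\<forall>n \<ge> max N N'. \<forall>Z \<in> P n. \<forall>D \<in> insert C \<C>. Z \<inter> D \<noteq> {} \<longrightarrow> Z \<subseteq> D"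
  proof (intro allI impI ballI)
    fix n Z D assume n: "max N N' \<le> n" and Z: "Z \<in> P n" and D: "D \<in> insert C \<C>" "Z \<inter> D \<noteq> {}"
    have "Z \<subseteq> C \<or> Z \<subseteq> topspace X - C" using N' n Z by auto
    moreover have "N \<le> n" using n by simp
    then have "D \<in> \<C> \<Longrightarrow> Z \<subseteq> D" using N Z D(2) by blast
    ultimately show "Z \<subseteq> D" using D by blast
  qed
  then show ?case by blast
qed simp

lemma clopen_base_generates:
  assumes P: "clopen_base X P"
  shows "topology_generated_by (\<Union>n. P n) = X"
proof (rule topology_eq[THEN iffD2], intro allI iffI)
  have op: "openin X Z" if "Z \<in> P n" for Z n
    using that clopen_base_partition[OF P] by (auto simp: clopen_partition_def)
  fix S
  {
    assume "openin (topology_generated_by (\<Union>n. P n)) S"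
    then have "generate_topology_on (\<Union>n. P n) S" by (simp add: openin_topology_generated_by_iff)
    then show "openin X S"
      by (rule generate_topology_on_coarsest[rotated 2]) (use op in auto)
  next
    assume S: "openin X S"
    show "openin (topology_generated_by (\<Union>n. P n)) S"
    proof (subst openin_subopen, intro ballI)
      fix x assume "x \<in> S"
      then obtain n Z where "Z \<in> P n" "x \<in> Z" "Z \<subseteq> S" using clopen_base_nbhd[OF P S] by blast
      then show "\<exists>T. openin (topology_generated_by (\<Union>n. P n)) T \<and> x \<in> T \<and> T \<subseteq> S"
        using topology_generated_by_Basis[of Z "\<Union>n. P n"] by blast
    qed
  }
qed

lemma clopen_baseI_generated:
  assumes P: "\<And>n. clopen_partition X (P n)" and R: "\<And>n. P n \<precsim>p P (Suc n)"
    and G: "topology_generated_by (\<Union>n. P n) = X"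
  shows "clopen_base X P"
proof -
  let ?T = "\<lambda>U. \<forall>x \<in> U. \<exists>n. \<exists>Z \<in> P n. x \<in> Z \<and> Z \<subseteq> U"
  have "istopology ?T" unfolding istopology_def
  proof (intro conjI allI impI)
    fix S T assume S: "?T S" and T: "?T T"
    show "?T (S \<inter> T)"
    proof
      fix x assume x: "x \<in> S \<inter> T"
      obtain a A where a: "A \<in> P a" "x \<in> A" "A \<subseteq> S" using S x by blast
      obtain b B where b: "B \<in> P b" "x \<in> B" "B \<subseteq> T" using T x by blast
      have xt: "x \<in> topspace X" using clopen_partition_cell(4)[OF P] a by blast
      let ?Z = "cell_of (P (max a b)) x"
      have Z: "?Z \<in> P (max a b)" "x \<in> ?Z" using clopen_partition_cell(1,2)[OF P xt] by blast+
      have "?Z \<subseteq> A" "?Z \<subseteq> B"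
        using refined_cell_subset[OF P P refined_by_chain[where P =
          P, OF R, of _ "max a b"]] a b Z max.cobounded1 max.cobounded2 by blast+
      then show "\<exists>n. \<exists>Z \<in> P n. x \<in> Z \<and> Z \<subseteq> S \<inter> T" using Z a b by blast
    qed
  next
    fix K assume K: "\<forall>S \<in> K. ?T S"
    show "?T (\<Union>K)"
    proof
      fix x assume "x \<in> \<Union>K"
      then obtain S where S: "S \<in> K" "x \<in> S" by blast
      then obtain n Z where "Z \<in> P n" "x \<in> Z" "Z \<subseteq> S" using K by meson
      then show "\<exists>n. \<exists>Z \<in> P n. x \<in> Z \<and> Z \<subseteq> \<Union>K" using S(1) by blast
    qed
  qed
  moreover have "?T S" if "S \<in> (\<Union>n. P n)" for S using that by blast
  moreover have "generate_topology_on (\<Union>n. P n) U" if "openin X U" for U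
    using that G openin_topology_generated_by_iff[of "\<Union>n. P n" U] by simp
  ultimately have "?T U" if "openin X U" for U
    using generate_topology_on_coarsest[of ?T "\<Union>n. P n" U] that by blast
  then show ?thesis using P R unfolding clopen_base_def by blast
qed

lemma clopen_base_diam:
  assumes X: "compact_space X" and ne: "topspace X \<noteq> {}" and d: "compatible_metric X d"
    and P: "clopen_base X P"
  shows "(\<lambda>n. partition_diam d (P n)) \<longlonglongrightarrow> 0"
proof (rule LIMSEQ_I)
  interpret M: Metric_space "topspace X" d using d by (simp add: compatible_metric_def)
  have mt: "M.mtopology = X" using d by (simp add: compatible_metric_def)
  fix r :: real assume r: "0 < r"
  \<comment> \<open>Balls of radius \<open>r/3\<close> have diameter at most \<open>2r/3\<close>, strictly less than \<open>r\<close>.\<close>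
  let ?\<U> = "(\<lambda>c. M.mball c (r/3)) ` topspace X"
  have "\<exists>N. \<forall>n \<ge> N. \<forall>Z \<in> P n. \<exists>U \<in> ?\<U>. Z \<subseteq> U"
  proof (rule clopen_base_refines_cover[OF X P])
    show "openin X U" if "U \<in> ?\<U>" for U using that M.openin_mball mt by auto
    show "topspace X \<subseteq> \<Union>?\<U>" using r by auto
  qed
  then obtain N where N: "\<forall>n \<ge> N. \<forall>Z \<in> P n. \<exists>U \<in> ?\<U>. Z \<subseteq> U" by blast
  have "norm (partition_diam d (P n) - 0) < r" if n: "n \<ge> N" for n
  proof -
    note cp = clopen_base_partition[OF P, of n]
    have sd: "0 \<le> set_diam d Z \<and> set_diam d Z \<le> 2*r/3" if Z: "Z \<in> P n" for Z
    proof -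
      obtain c where c: "c \<in> topspace X" "Z \<subseteq> M.mball c (r/3)" using N n Z by blast
      have le: "d x y \<le> 2*r/3" if "x \<in> Z" "y \<in> Z" for x y
      proof -
        have xy: "x \<in> topspace X" "y \<in> topspace X" "d c x < r/3" "d c y < r/3" using c that by auto
        have "d x y \<le> d x c + d c y" using M.triangle xy c by blast
        then show ?thesis using xy M.commute[of x c] by linarith
      qed
      obtain x where x: "x \<in> Z" using clopen_partition_cell(5)[OF cp Z] by blast
      have "d x x \<le> set_diam d Z" unfolding set_diam_def
        by (rule cSup_upper) (use x le in \<open>auto intro: bdd_aboveI[where M = "2*r/3"]\<close>)
      moreover have "d x x \<ge> 0" by (rule M.nonneg)
      moreover have "set_diam d Z \<le> 2*r/3" unfolding set_diam_def
        by (rule cSup_least) (use x le in auto)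
      ultimately show ?thesis by linarith
    qed
    have fin: "finite (set_diam d ` P n)" using cp by (simp add: clopen_partition_def)
    have "P n \<noteq> {}" using clopen_partition_cell(1)[OF cp] ne by blast
    then have "partition_diam d (P n) \<in> set_diam d ` P n"
      unfolding partition_diam_def using Max_in[OF fin] by blast
    then show ?thesis using sd r by fastforce
  qed
  then show "\<exists>no. \<forall>n\<ge>no. norm (partition_diam d (P n) - 0) < r" by blast
qed

text \<open>The join omits empty intersections, so a cell of \<open>R\<close> has to be nonempty to lie in a member of
  the join.\<close>

lemma join_refined_iff:
  assumes "{} \<notin> R"
  shows "(P \<or>p Q) \<precsim>p R \<longleftrightarrow> P \<precsim>p R \<and> Q \<precsim>p R"
proof
  assume J: "(P \<or>p Q) \<precsim>p R"
  have "(\<exists>A \<in> P. Z \<subseteq> A) \<and> (\<exists>B \<in> Q. Z \<subseteq> B)" if "Z \<in> R" for Z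
  proof -
    obtain W where "W \<in> (P \<or>p Q)" "Z \<subseteq> W" using J \<open>Z \<in> R\<close> by (auto simp: refined_by_def)
    moreover from this obtain A B where "A \<in> P" "B \<in> Q" "W = A \<inter> B" by (auto simp: join_def)
    ultimately show ?thesis by blast
  qed
  then show "P \<precsim>p R \<and> Q \<precsim>p R" by (simp add: refined_by_def)
next
  assume a: "P \<precsim>p R \<and> Q \<precsim>p R"
  show "(P \<or>p Q) \<precsim>p R" unfolding refined_by_def
  proof
    fix Z assume Z: "Z \<in> R"
    obtain A where A: "A \<in> P" "Z \<subseteq> A" using refined_byD[of P R] a Z by blast
    obtain B where B: "B \<in> Q" "Z \<subseteq> B" using refined_byD[of Q R] a Z by blast
    note AB = A B
    have "A \<inter> B \<noteq> {}" using AB Z assms by (metis Int_greatest subset_empty)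
    then have "A \<inter> B \<in> (P \<or>p Q)" unfolding join_def using A(1) B(1)
      by (intro CollectI exI[of _ A] exI[of _ B]) simp
    then show "\<exists>Y \<in> (P \<or>p Q). Z \<subseteq> Y" by (rule bexI[rotated]) (use AB in auto)
  qed
qed

text \<open>The conditions relating two consecutive partitions; they hold for a fixed first partition as
  soon as the second one is fine enough.\<close>

definition good_step :: "('a \<Rightarrow> 'a) \<Rightarrow> nat \<Rightarrow> 'a set set \<Rightarrow> 'a set set \<Rightarrow> bool" where
  "good_step \<sigma> i A B \<longleftrightarrow> A \<precsim>p B \<and>
     (even i \<longrightarrow> (\<forall>Z \<in> A. \<forall>Z' \<in> B. \<sigma> ` Z \<inter> Z' \<noteq> {} \<longrightarrow> Z' \<subseteq> \<sigma> ` Z)) \<and>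
     (odd i \<longrightarrow> (\<forall>Z' \<in> B. \<exists>Z \<in> A. \<sigma> ` Z' \<subseteq> Z))"

lemma good_steps_adapted:
  assumes "\<And>Z. Z \<in> P 0 \<Longrightarrow> inj_on \<sigma> Z" "\<And>i. good_step \<sigma> i (P i) (P (Suc i))"
  shows "sigma_adapted \<sigma> P"
  unfolding sigma_adapted_def
proof (intro conjI allI)
  show "\<forall>Z \<in> P 0. inj_on \<sigma> Z" using assms(1) by blast
  fix j
  show "\<forall>Z \<in> P (2*j). \<forall>Z' \<in> P (2*j + 1). \<sigma> ` Z \<inter> Z' \<noteq> {} \<longrightarrow> Z' \<subseteq> \<sigma> ` Z"
    using assms(2)[of "2*j"] by (simp add: good_step_def)
  show "\<forall>Z' \<in> P (2*j + 2). \<exists>Z \<in> P (2*j + 1). \<sigma> ` Z' \<subseteq> Z"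
    using assms(2)[of "2*j + 1"] by (simp add: good_step_def)
qed

locale lhomeo =
  fixes X :: "'a topology" and \<sigma> :: "'a \<Rightarrow> 'a"
  assumes LHomeo: "(X, \<sigma>) \<in> LHomeo"
begin

lemma nonempty: "topspace X \<noteq> {}" and totally_disconnected: "totally_disconnected_space X"
  and compact: "compact_space X" and metrizable: "metrizable_space X"
  and local_homeo: "local_homeomorphism X \<sigma>" and onto: "\<sigma> ` topspace X = topspace X"
  using LHomeo by (auto simp: LHomeo_def)

lemma Hausdorff: "Hausdorff_space X"
  by (rule metrizable_imp_Hausdorff_space[OF metrizable])

lemma continuous: "continuous_map X X \<sigma>"
  using local_homeo by (simp add: local_homeomorphism_def)

lemma maps: "x \<in> topspace X \<Longrightarrow> \<sigma> x \<in> topspace X"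
  using onto by blast

lemma open_image:
  assumes W: "openin X W"
  shows "openin X (\<sigma> ` W)"
proof (subst openin_subopen, intro ballI)
  fix y assume "y \<in> \<sigma> ` W"
  then obtain x where x: "x \<in> W" "y = \<sigma> x" by blast
  then have "x \<in> topspace X" using openin_subset[OF W] by blast
  then obtain U where U: "openin X U" "x \<in> U" "openin X (\<sigma> ` U)"
    "homeomorphic_map (subtopology X U) (subtopology X (\<sigma> ` U)) \<sigma>"
    using local_homeo unfolding local_homeomorphism_def by blast
  have "openin (subtopology X U) (U \<inter> W)" using W by (simp add: openin_subtopology_Int2)
  then have "openin (subtopology X (\<sigma> ` U)) (\<sigma> ` (U \<inter> W))"
    using homeomorphic_imp_open_map[OF U(4)] by (simp add: open_map_def)
  then have "openin X (\<sigma> ` (U \<inter> W))" using openin_trans_full U(3) by blast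
  then show "\<exists>T. openin X T \<and> y \<in> T \<and> T \<subseteq> \<sigma> ` W" using x U(2) by blast
qed

lemma clopen_image:
  assumes "openin X W" "closedin X W"
  shows "openin X (\<sigma> ` W)" "closedin X (\<sigma> ` W)"
  using open_image[OF assms(1)] image_compactin[OF closedin_compact_space[OF compact assms(2)]
    continuous]
    compactin_imp_closedin[OF Hausdorff] by auto

text \<open>In a compact Hausdorff space a connected component has a base of clopen neighbourhoods, and
  here the components are points.\<close>

lemma clopen_nbhd:
  assumes U: "openin X U" "x \<in> U"
  shows "\<exists>C. openin X C \<and> closedin X C \<and> x \<in> C \<and> C \<subseteq> U"
proof -
  have x: "x \<in> topspace X" using openin_subset[OF U(1)] U(2) by blast
  have "connectedin X (connected_component_of_set X x)" by (rule connectedin_connected_component_of)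
  then obtain a where a: "connected_component_of_set X x \<subseteq> {a}"
    using totally_disconnected unfolding totally_disconnected_space_def by blast
  moreover have "x \<in> connected_component_of_set X x" using x by (simp add: connected_component_of_refl)
  ultimately have "connected_component_of_set X x = {x}" by blast
  then have "{x} \<in> connected_components_of X"
    using x by (metis connected_component_in_connected_components_of)
  then obtain C D where "openin X C" "openin X D" "disjnt C D" "C \<union> D = topspace X" "{x} \<subseteq> C" "C \<subseteq> U"
    using wilder_locally_compact_component_thm[of X "{x}" U] U x
      compact_imp_locally_compact_space[OF compact] Hausdorff by auto
  moreover from this have "closedin X C"
    by (metis Diff_cancel Un_Diff closedin_def disjnt_def Diff_triv sup_bot.left_neutral Un_upper1
      disjnt_sym)
  ultimately show ?thesis by blast
qed

text \<open>The atoms of the finite Boolean algebra generated by \<open>\<C>\<close> and a finite clopen cover that refines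
  \<open>\<U>\<close>.\<close>

lemma fine_partition:
  assumes op: "\<And>U. U \<in> \<U> \<Longrightarrow> openin X U" and cov: "topspace X \<subseteq> \<Union>\<U>"
    and fin: "finite \<C>" and clo: "\<And>C. C \<in> \<C> \<Longrightarrow> openin X C \<and> closedin X C"
  shows "\<exists>P. clopen_partition X P \<and>
    (\<forall>Z \<in> P. (\<exists>U \<in> \<U>. Z \<subseteq> U) \<and> (\<forall>C \<in> \<C>. Z \<inter> C \<noteq> {} \<longrightarrow> Z \<subseteq> C))"
proof -
  let ?\<D> = "{C. openin X C \<and> closedin X C \<and> (\<exists>U \<in> \<U>. C \<subseteq> U)}"
  have "topspace X \<subseteq> \<Union>?\<D>"
  proof
    fix x assume "x \<in> topspace X"
    then obtain U where U: "U \<in> \<U>" "x \<in> U" using cov by blast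
    then obtain C where "openin X C" "closedin X C" "x \<in> C" "C \<subseteq> U" using clopen_nbhd[OF op] by blast
    then show "x \<in> \<Union>?\<D>" using U by blast
  qed
  moreover have "openin X C" if "C \<in> ?\<D>" for C using that by blast
  ultimately obtain \<F> where F: "finite \<F>" "\<F> \<subseteq> ?\<D>" "topspace X \<subseteq> \<Union>\<F>"
    using compact unfolding compact_space_alt by meson
  let ?\<G> = "\<F> \<union> \<C>"
  define atm where "atm S = {y \<in> topspace X. \<forall>C \<in> ?\<G>. y \<in> C \<longleftrightarrow> C \<in> S}" for S
  let ?P = "atm ` Pow ?\<G> - {{}}"
  have clG: "openin X C \<and> closedin X C" if "C \<in> ?\<G>" for C using that F(2) clo by blast
  have finG: "finite ?\<G>" using F fin by simp
  have eq: "atm S = topspace X \<inter> (\<Inter>C \<in> ?\<G>. if C \<in> S then C else topspace X - C)" for S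
    by (auto simp: atm_def split: if_splits)
  have "openin X (atm S)" "closedin X (atm S)" for S
  proof -
    show "openin X (atm S)"
    proof (cases "?\<G> = {}")
      case False
      then show ?thesis unfolding eq using clG finG
        by (intro openin_Int openin_topspace openin_INT2) auto
    qed (simp add: atm_def)
    show "closedin X (atm S)"
    proof (cases "?\<G> = {}")
      case False
      then show ?thesis unfolding eq using clG
        by (intro closedin_Int closedin_topspace closedin_INT) auto
    qed (simp add: atm_def)
  qed
  moreover have "partition_on (topspace X) ?P"
  proof (rule partition_onI)
    show "\<Union>?P = topspace X"
    proof (intro equalityI subsetI)
      fix x assume x: "x \<in> topspace X"
      define S where "S = {C \<in> ?\<G>. x \<in> C}"
      have xS: "x \<in> atm S" using x by (auto simp: atm_def S_def)
      have "S \<in> Pow ?\<G>" unfolding S_def by blast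
      then have "atm S \<in> atm ` Pow ?\<G>" by (rule imageI)
      then have "atm S \<in> ?P" using xS by fastforce
      then show "x \<in> \<Union>?P" using xS by (rule UnionI)
    qed (auto simp: atm_def)
    show "disjnt p q" if pq: "p \<in> ?P" "q \<in> ?P" "p \<noteq> q" for p q
    proof -
      obtain S T where ST: "p = atm S" "S \<subseteq> ?\<G>" "q = atm T" "T \<subseteq> ?\<G>" using pq by blast
      have "S = T" if "z \<in> atm S" "z \<in> atm T" for z using that ST(2,4) unfolding atm_def by blast
      then show ?thesis using pq(3) ST by (auto simp: disjnt_iff)
    qed
  qed auto
  ultimately have "clopen_partition X ?P" using finG by (auto simp: clopen_partition_def)
  moreover have "(\<exists>U \<in> \<U>. Z \<subseteq> U) \<and> (\<forall>C \<in> \<C>. Z \<inter> C \<noteq> {} \<longrightarrow> Z \<subseteq> C)" if Z: "Z \<in> ?P" for Z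
  proof -
    obtain S where S: "Z = atm S" "S \<subseteq> ?\<G>" using Z by blast
    obtain x where x: "x \<in> Z" using Z by blast
    then have "x \<in> topspace X" using S by (simp add: atm_def)
    then obtain C where C: "C \<in> \<F>" "x \<in> C" using F(3) by blast
    have dec: "Z \<subseteq> D" if "D \<in> ?\<G>" "Z \<inter> D \<noteq> {}" for D using that S by (auto simp: atm_def)
    then have "Z \<subseteq> C" using C x by blast
    moreover obtain U where "U \<in> \<U>" "C \<subseteq> U" using C F(2) by blast
    ultimately show ?thesis using dec by blast
  qed
  ultimately show ?thesis by blast
qed

text \<open>Each cell contains at most one point of the fibre.\<close>

lemma card_fibre:
  assumes P: "clopen_partition X P" and inj: "\<And>Z. Z \<in> P \<Longrightarrow> inj_on \<sigma> Z"
  shows "card (fibre X \<sigma> x) = card {Z \<in> P. x \<in> \<sigma> ` Z}"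
proof -
  note cp = clopen_partition_cell[OF P]
  have "inj_on (cell_of P) (fibre X \<sigma> x)"
  proof (rule inj_onI)
    fix y z assume y: "y \<in> fibre X \<sigma> x" and z: "z \<in> fibre X \<sigma> x" and e: "cell_of P y = cell_of P z"
    then have t: "y \<in> topspace X" "z \<in> topspace X" "\<sigma> y = \<sigma> z" by (auto simp: fibre_def)
    then show "y = z" using inj_onD[OF inj[OF cp(1)[OF t(1)]], of y z] cp(2)[OF t(1)]
      cp(2)[OF t(2)] e by simp
  qed
  moreover have "cell_of P ` fibre X \<sigma> x = {Z \<in> P. x \<in> \<sigma> ` Z}"
  proof (intro equalityI subsetI)
    fix Z assume "Z \<in> cell_of P ` fibre X \<sigma> x"
    then show "Z \<in> {Z \<in> P. x \<in> \<sigma> ` Z}" using cp(1,2) by (auto simp: fibre_def)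
  next
    fix Z assume "Z \<in> {Z \<in> P. x \<in> \<sigma> ` Z}"
    then obtain y where y: "Z \<in> P" "y \<in> Z" "\<sigma> y = x" by blast
    then have "y \<in> fibre X \<sigma> x" "cell_of P y = Z" using cp(3,4) by (auto simp: fibre_def)
    then show "Z \<in> cell_of P ` fibre X \<sigma> x" by blast
  qed
  ultimately show ?thesis by (metis card_image)
qed

text \<open>By \<open>card_fibre\<close>, the element of \<open>P\<^sup>\<sigma>\<close> that contains \<open>x\<close> is the set of points that lie in exactly
  the same images \<open>\<sigma>(Z)\<close> as \<open>x\<close>.  So a partition refines \<open>P\<^sup>\<sigma>\<close> if and only if each \<open>\<sigma>(Z)\<close> is
  a union of its cells.\<close>

lemma image_partition_refined_iff:
  assumes P: "clopen_partition X P" and inj: "\<And>Z. Z \<in> P \<Longrightarrow> inj_on \<sigma> Z" and Q: "clopen_partition X Q"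
  shows "image_partition X \<sigma> P \<precsim>p Q \<longleftrightarrow> (\<forall>Z \<in> P. \<forall>Z' \<in> Q. \<sigma> ` Z \<inter> Z' \<noteq> {} \<longrightarrow> Z' \<subseteq> \<sigma> ` Z)"
proof
  note cf = card_fibre[OF P inj]
  have finP: "finite P" using P by (simp add: clopen_partition_def)
  assume R: "image_partition X \<sigma> P \<precsim>p Q"
  show "\<forall>Z \<in> P. \<forall>Z' \<in> Q. \<sigma> ` Z \<inter> Z' \<noteq> {} \<longrightarrow> Z' \<subseteq> \<sigma> ` Z"
  proof (intro ballI impI)
    fix Z Z' assume Z: "Z \<in> P" "Z' \<in> Q" "\<sigma> ` Z \<inter> Z' \<noteq> {}"
    then obtain x where x: "x \<in> \<sigma> ` Z" "x \<in> Z'" by blast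
    obtain W where W: "W \<in> image_partition X \<sigma> P" "Z' \<subseteq> W" using R Z(2) by (auto simp: refined_by_def)
    then obtain k S where k: "k \<in> {1..max_fibre X \<sigma>}" and S: "S \<subseteq> P" "card S = k"
      and We: "W = (\<Inter>Z \<in> S. \<sigma> ` Z) - fibre_ge X \<sigma> (k + 1)"
      unfolding image_partition_def by blast
    have xW: "x \<in> W" using x W by blast
    have "x \<in> topspace X" using x Z clopen_partition_cell(4)[OF Q] by blast
    then have "card {Z \<in> P. x \<in> \<sigma> ` Z} \<le> card S"
      using xW We S(2) cf[of x] by (simp add: fibre_ge_def)
    moreover have "S \<subseteq> {Z \<in> P. x \<in> \<sigma> ` Z}" using S(1) xW We by blast
    \<comment> \<open>The images indexed by \<open>S\<close> contain \<open>x\<close>, and there are no others because \<open>x\<close> has at most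
      \<open>card S\<close> preimages.\<close>
    ultimately have "S = {Z \<in> P. x \<in> \<sigma> ` Z}" using finP card_seteq[of "{Z \<in> P. x \<in> \<sigma> ` Z}" S] by simp
    then have "Z \<in> S" using Z(1) x(1) by blast
    then show "Z' \<subseteq> \<sigma> ` Z" using W(2) We by blast
  qed
next
  note cf = card_fibre[OF P inj]
  have finP: "finite P" using P by (simp add: clopen_partition_def)
  assume R: "\<forall>Z \<in> P. \<forall>Z' \<in> Q. \<sigma> ` Z \<inter> Z' \<noteq> {} \<longrightarrow> Z' \<subseteq> \<sigma> ` Z"
  show "image_partition X \<sigma> P \<precsim>p Q" unfolding refined_by_def
  proof
    fix Z' assume Z': "Z' \<in> Q"
    obtain x where x: "x \<in> Z'" using clopen_partition_cell(5)[OF Q Z'] by blast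
    have xt: "x \<in> topspace X" using x Z' clopen_partition_cell(4)[OF Q] by blast
    let ?S = "\<lambda>x. {Z \<in> P. x \<in> \<sigma> ` Z}"
    let ?k = "card (?S x)"
    let ?W = "(\<Inter>Z \<in> ?S x. \<sigma> ` Z) - fibre_ge X \<sigma> (?k + 1)"
    have "Z' \<subseteq> ?W"
    proof
      fix y assume y: "y \<in> Z'"
      have "?S y = ?S x" using R Z' x y by blast
      then have "y \<notin> fibre_ge X \<sigma> (?k + 1)" using cf[of y] by (simp add: fibre_ge_def)
      moreover have "y \<in> (\<Inter>Z \<in> ?S x. \<sigma> ` Z)" using R Z' x y by blast
      ultimately show "y \<in> ?W" by blast
    qed
    moreover have "?W \<in> image_partition X \<sigma> P"
    proof -
      obtain z where z: "z \<in> topspace X" "\<sigma> z = x" using onto xt by (metis imageE)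
      then have "cell_of P z \<in> ?S x" using clopen_partition_cell(1,2)[OF P] by blast
      then have "?S x \<noteq> {}" by blast
      then have "1 \<le> ?k" using finP by (simp add: Suc_le_eq card_gt_0_iff)
      moreover have "?k \<le> max_fibre X \<sigma>"
      proof -
        have "card (fibre X \<sigma> x) \<le> max_fibre X \<sigma>" unfolding max_fibre_def
        proof (rule cSUP_upper[OF xt])
          show "bdd_above ((\<lambda>x. card (fibre X \<sigma> x)) ` topspace X)"
            unfolding bdd_above_def using cf card_mono[OF finP, of "?S _"] by auto
        qed
        then show ?thesis using cf[of x] by simp
      qed
      moreover have "?W \<noteq> {}" using \<open>Z' \<subseteq> ?W\<close> x by blast
      ultimately show ?thesis unfolding image_partition_def
        by (intro UN_I[of ?k] CollectI exI[of _ "?S x"]) auto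
    qed
    ultimately show "\<exists>W \<in> image_partition X \<sigma> P. Z' \<subseteq> W" by blast
  qed
qed

lemma preimage_partition_refined_iff:
  assumes Q: "clopen_partition X Q"
  shows "preimage_partition X \<sigma> P \<precsim>p Q \<longleftrightarrow> (\<forall>Z' \<in> Q. \<exists>Z \<in> P. \<sigma> ` Z' \<subseteq> Z)"
proof -
  have "Z' \<subseteq> {x \<in> topspace X. \<sigma> x \<in> Z} \<longleftrightarrow> \<sigma> ` Z' \<subseteq> Z" if "Z' \<in> Q" for Z Z'
    using clopen_partition_cell(4)[OF Q that] by blast
  then show ?thesis unfolding refined_by_def preimage_partition_def by auto
qed

lemma adapted_inj:
  assumes P: "clopen_base X P" and A: "sigma_adapted \<sigma> P" and Z: "Z \<in> P n"
  shows "inj_on \<sigma> Z"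
proof -
  obtain Y where "Y \<in> P 0" "Z \<subseteq> Y" using refined_byD[OF clopen_base_refine[OF P, of 0 n] Z] by blast
  moreover from this have "inj_on \<sigma> Y" using A by (simp add: sigma_adapted_def)
  ultimately show ?thesis using inj_on_subset by blast
qed

text \<open>The right-hand side does not mention the metric, and it is the form in which \<open>\<sigma>\<close>-refined
  sequences are constructed and used.\<close>

theorem sigma_refined_iff:
  assumes d: "compatible_metric X d"
  shows "sigma_refined X d \<sigma> P \<longleftrightarrow> clopen_base X P \<and> sigma_adapted \<sigma> P"
proof
  assume S: "sigma_refined X d \<sigma> P"
  then have cp: "clopen_partition X (P n)" and rf: "P n \<precsim>p P (Suc n)" for n
    by (auto simp: sigma_refined_def)
  have ne: "{} \<notin> P n" for n using clopen_partition_cell(5)[OF cp] by blast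
  have inj0: "inj_on \<sigma> Z" if "Z \<in> P 0" for Z
  proof -
    have "homeomorphic_map (subtopology X Z) (subtopology X (\<sigma> ` Z)) \<sigma>"
      using S that by (simp add: sigma_refined_def)
    from homeomorphic_imp_injective_map[OF this] show ?thesis
      using clopen_partition_cell(4)[OF cp that] by (simp add: Int_absorb1)
  qed
  have base: "clopen_base X P"
    using clopen_baseI_generated[where P = P, OF cp rf] S by (simp add: sigma_refined_def)
  have inj: "inj_on \<sigma> Z" if Z: "Z \<in> P n" for Z n
  proof -
    obtain Y where "Y \<in> P 0" "Z \<subseteq> Y"
      using refined_byD[OF clopen_base_refine[OF base, of 0 n] Z] by blast
    then show ?thesis using inj0 inj_on_subset by blast
  qed
  have "(P (2*j) \<or>p image_partition X \<sigma> (P (2*j))) \<precsim>p P (2*j + 1)" for j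
    using S by (simp add: sigma_refined_def)
  then have "image_partition X \<sigma> (P (2*j)) \<precsim>p P (2*j + 1)" for j
    unfolding join_refined_iff[OF ne] by (rule conjunct2)
  then have "\<forall>Z \<in> P (2*j). \<forall>Z' \<in> P (2*j + 1). \<sigma> ` Z \<inter> Z' \<noteq> {} \<longrightarrow> Z' \<subseteq> \<sigma> ` Z" for j
    using image_partition_refined_iff[where P = "P (2*j)" and Q = "P (2*j + 1)", OF cp inj cp] by simp
  moreover have "(P (2*j + 1) \<or>p preimage_partition X \<sigma> (P (2*j + 1))) \<precsim>p P (2*j + 2)" for j
    using S by (simp add: sigma_refined_def)
  then have "preimage_partition X \<sigma> (P (2*j + 1)) \<precsim>p P (2*j + 2)" for j
    unfolding join_refined_iff[OF ne] by (rule conjunct2)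
  then have "\<forall>Z' \<in> P (2*j + 2). \<exists>Z \<in> P (2*j + 1). \<sigma> ` Z' \<subseteq> Z" for j
    unfolding preimage_partition_refined_iff[OF cp] .
  ultimately show "clopen_base X P \<and> sigma_adapted \<sigma> P"
    using base inj0 by (simp add: sigma_adapted_def)
next
  assume a: "clopen_base X P \<and> sigma_adapted \<sigma> P"
  then have base: "clopen_base X P" and A: "sigma_adapted \<sigma> P" by auto
  note cp = clopen_base_partition[OF base] and inj = adapted_inj[OF base A]
  have ne: "{} \<notin> P n" for n using clopen_partition_cell(5)[OF cp] by blast
  have rf: "P n \<precsim>p P (Suc n)" for n using clopen_base_refine[OF base] by simp
  have hom: "homeomorphic_map (subtopology X Z) (subtopology X (\<sigma> ` Z)) \<sigma>" if Z: "Z \<in> P 0" for Z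
  proof (rule continuous_imp_homeomorphic_map)
    have Zt: "Z \<subseteq> topspace X" using clopen_partition_cell(4)[OF cp Z] .
    have cl: "closedin X Z" using cp[of 0] Z by (simp add: clopen_partition_def)
    show "continuous_map (subtopology X Z) (subtopology X (\<sigma> ` Z)) \<sigma>"
      by (rule continuous_map_into_subtopology) (auto intro: continuous_map_from_subtopology continuous)
    show "compact_space (subtopology X Z)"
      using closedin_compact_space[OF compact cl] compact_space_subtopology by blast
    show "Hausdorff_space (subtopology X (\<sigma> ` Z))" by (rule Hausdorff_space_subtopology[OF Hausdorff])
    show "\<sigma> ` topspace (subtopology X Z) = topspace (subtopology X (\<sigma> ` Z))" using Zt maps by auto
    show "inj_on \<sigma> (topspace (subtopology X Z))" using inj[OF Z] Zt by (simp add: Int_absorb1)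
  qed
  have im: "(P (2*j) \<or>p image_partition X \<sigma> (P (2*j))) \<precsim>p P (2*j + 1)" for j
    unfolding join_refined_iff[OF ne]
    using image_partition_refined_iff[where P = "P (2*j)" and Q = "P (2*j + 1)", OF cp inj cp]
      rf[of "2*j"] A by (simp add: sigma_adapted_def)
  have pre: "(P (2*j + 1) \<or>p preimage_partition X \<sigma> (P (2*j + 1))) \<precsim>p P (2*j + 2)" for j
    unfolding join_refined_iff[OF ne] preimage_partition_refined_iff[OF cp]
    using rf[of "2*j + 1"] A by (simp add: sigma_adapted_def)
  show "sigma_refined X d \<sigma> P" unfolding sigma_refined_def
    using cp hom rf clopen_base_generates[OF base] clopen_base_diam[OF compact nonempty d base] im pre
    by blast
qed

text \<open>A partition that decides membership in these finitely many clopen sets may follow \<open>A\<close> at an even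
  as well as at an odd position.\<close>

definition test_sets :: "'a set set \<Rightarrow> 'a set set" where
  "test_sets A = A \<union> (`) \<sigma> ` A \<union> preimage_partition X \<sigma> A"

lemma test_sets_clopen:
  assumes "clopen_partition X A"
  shows "finite (test_sets A)" "C \<in> test_sets A \<Longrightarrow> openin X C \<and> closedin X C"
  using assms clopen_image openin_continuous_map_preimage[OF continuous]
    closedin_continuous_map_preimage[OF continuous]
  by (auto simp: test_sets_def clopen_partition_def preimage_partition_def)

lemma good_stepI:
  assumes A: "clopen_partition X A" and B: "clopen_partition X B"
    and D: "\<forall>Z \<in> B. \<forall>C \<in> test_sets A. Z \<inter> C \<noteq> {} \<longrightarrow> Z \<subseteq> C"
  shows "good_step \<sigma> i A B"
proof -
  note cA = clopen_partition_cell[OF A] and cB = clopen_partition_cell[OF B]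
  have dec: "Z' \<subseteq> C" if "Z' \<in> B" "C \<in> test_sets A" "x \<in> Z'" "x \<in> C" for Z' C x
  proof -
    have "Z' \<inter> C \<noteq> {}" using that(3,4) by blast
    then show ?thesis using D that(1,2) by meson
  qed
  have "\<exists>Z \<in> A. Z' \<subseteq> Z" if Z': "Z' \<in> B" for Z'
  proof -
    obtain x where x: "x \<in> Z'" using cB(5)[OF Z'] by blast
    then have "x \<in> topspace X" using cB(4)[OF Z'] by blast
    then have c: "cell_of A x \<in> A" "x \<in> cell_of A x" using cA(1,2) by blast+
    then have "cell_of A x \<in> test_sets A" by (simp add: test_sets_def)
    then show ?thesis using dec[OF Z' _ x c(2)] c(1) by blast
  qed
  moreover have "Z' \<subseteq> \<sigma> ` Z" if Z: "Z \<in> A" "Z' \<in> B" "\<sigma> ` Z \<inter> Z' \<noteq> {}" for Z Z'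
  proof -
    obtain y where y: "y \<in> Z'" "y \<in> \<sigma> ` Z" using Z(3) by blast
    have "\<sigma> ` Z \<in> test_sets A" using Z(1) by (simp add: test_sets_def)
    then show ?thesis using dec[OF Z(2) _ y] by blast
  qed
  moreover have "\<exists>Z \<in> A. \<sigma> ` Z' \<subseteq> Z" if Z': "Z' \<in> B" for Z'
  proof -
    obtain x where x: "x \<in> Z'" using cB(5)[OF Z'] by blast
    then have xt: "x \<in> topspace X" using cB(4)[OF Z'] by blast
    let ?Z = "cell_of A (\<sigma> x)"
    have c: "?Z \<in> A" "\<sigma> x \<in> ?Z" using cA(1,2)[OF maps[OF xt]] by blast+
    let ?C = "{x \<in> topspace X. \<sigma> x \<in> ?Z}"
    have "?C \<in> test_sets A" using c(1) by (auto simp: test_sets_def preimage_partition_def)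
    moreover have "x \<in> ?C" using xt c(2) by simp
    ultimately have "Z' \<subseteq> ?C" using dec[OF Z' _ x] by blast
    then have "\<sigma> ` Z' \<subseteq> ?Z" by blast
    then show ?thesis using c(1) by blast
  qed
  ultimately show ?thesis by (simp add: good_step_def refined_by_def)
qed

text \<open>Choose the partitions one after the other, each subordinate to a cover by open sets of
  small diameter on which \<open>\<sigma>\<close> is injective, and each fine enough to follow the previous one.\<close>

theorem adapted_exists: "\<exists>P. clopen_base X P \<and> sigma_adapted \<sigma> P"
proof -
  obtain d where d: "Metric_space (topspace X) d" "Metric_space.mtopology (topspace X) d = X"
    using metrizable unfolding metrizable_space_def by (metis Metric_space.topspace_mtopology)
  interpret M: Metric_space "topspace X" d by (rule d(1))
  let ?cov = "\<lambda>n. {V. openin X V \<and> inj_on \<sigma> V \<and> (\<exists>c \<in> topspace X. V \<subseteq> M.mball c (1 / real (Suc n)))}"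
  have cov: "topspace X \<subseteq> \<Union>(?cov n)" for n
  proof
    fix x assume x: "x \<in> topspace X"
    then obtain U where U: "openin X U" "x \<in> U"
      "homeomorphic_map (subtopology X U) (subtopology X (\<sigma> ` U)) \<sigma>"
      using local_homeo unfolding local_homeomorphism_def by blast
    have "inj_on \<sigma> U" using homeomorphic_imp_injective_map[OF U(3)] openin_subset[OF U(1)]
      by (simp add: Int_absorb1)
    moreover have "openin X (M.mball x (1 / real (Suc n)))" using M.openin_mball d(2) by simp
    ultimately have "U \<inter> M.mball x (1 / real (Suc n)) \<in> ?cov n"
      using U x by (auto intro: inj_on_subset openin_Int)
    moreover have "x \<in> U \<inter> M.mball x (1 / real (Suc n))" using U x by simp
    ultimately show "x \<in> \<Union>(?cov n)" by blast
  qed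
  have op: "\<And>V n. V \<in> ?cov n \<Longrightarrow> openin X V" by blast
  let ?A = "\<lambda>n P. clopen_partition X P \<and> (\<forall>Z \<in> P. \<exists>V \<in> ?cov n. Z \<subseteq> V)"
  have "\<exists>P. \<forall>n. ?A n (P n) \<and> (\<forall>Z \<in> P (Suc n). \<forall>C \<in> test_sets (P n). Z \<inter> C \<noteq> {} \<longrightarrow> Z \<subseteq> C)"
  proof (rule dependent_nat_choice)
    have "\<exists>P. clopen_partition X P \<and>
        (\<forall>Z \<in> P. (\<exists>V \<in> ?cov 0. Z \<subseteq> V) \<and> (\<forall>C \<in> {}. Z \<inter> C \<noteq> {} \<longrightarrow> Z \<subseteq> C))"
      by (rule fine_partition) (use cov[of 0] in auto)
    then show "\<exists>P. ?A 0 P" by meson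
    fix P n assume P: "?A n P"
    have "\<exists>Q. clopen_partition X Q \<and> (\<forall>Z \<in> Q. (\<exists>V \<in> ?cov (Suc n). Z \<subseteq> V) \<and>
        (\<forall>C \<in> test_sets P. Z \<inter> C \<noteq> {} \<longrightarrow> Z \<subseteq> C))"
      by (intro fine_partition op cov test_sets_clopen) (use P in blast)+
    then show "\<exists>Q. ?A (Suc n) Q \<and> (\<forall>Z \<in> Q. \<forall>C \<in> test_sets P. Z \<inter> C \<noteq> {} \<longrightarrow> Z \<subseteq> C)"
      by meson
  qed
  then obtain P where P0: "\<forall>n. ?A n (P n) \<and> (\<forall>Z \<in> P (Suc n). \<forall>C \<in> test_sets (P n). Z \<inter> C \<noteq> {} \<longrightarrow> Z \<subseteq> C)"
    by (rule exE)
  note P = P0[THEN spec, THEN conjunct1, THEN conjunct1] P0[THEN spec, THEN conjunct1,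
    THEN conjunct2, THEN bspec]
    P0[THEN spec, THEN conjunct2]
  note cp = clopen_partition_cell[OF P(1)]
  have good: "good_step \<sigma> i (P i) (P (Suc i))" for i by (rule good_stepI[OF P(1) P(1) P(3)])
  then have rf: "P n \<precsim>p P (Suc n)" for n by (simp add: good_step_def)
  have "\<exists>n. \<exists>Z \<in> P n. x \<in> Z \<and> Z \<subseteq> U" if U: "openin X U" "x \<in> U" for U x
  proof -
    obtain r where r: "r > 0" "M.mball x r \<subseteq> U" using U M.openin_mtopology d(2) by metis
    have x: "x \<in> topspace X" using openin_subset[OF U(1)] U(2) by blast
    obtain n where n: "1 / real (Suc n) < r / 2" using nat_approx_posE[of "r/2"] r by auto
    let ?Z = "cell_of (P n) x"
    have Z: "?Z \<in> P n" "x \<in> ?Z" using cp(1,2)[OF x] by blast+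
    obtain c where c: "c \<in> topspace X" "?Z \<subseteq> M.mball c (1 / real (Suc n))" using P(2)[OF Z(1)] by blast
    have "y \<in> U" if y: "y \<in> ?Z" for y
    proof -
      have "y \<in> topspace X" "d c y < r/2" "d c x < r/2" using y Z c n by auto
      moreover have "d x y \<le> d x c + d c y" using M.triangle calculation x c by blast
      ultimately have "d x y < r" using M.commute[of x c] by linarith
      then show ?thesis using r(2) x \<open>y \<in> topspace X\<close> by auto
    qed
    then show ?thesis using Z by blast
  qed
  then have base: "clopen_base X P" using P(1) rf by (simp add: clopen_base_def)
  have "inj_on \<sigma> Z" if "Z \<in> P 0" for Z using P(2)[OF that] inj_on_subset by blast
  then have "sigma_adapted \<sigma> P" by (rule good_steps_adapted[OF _ good])
  then show ?thesis using base by blast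
qed

end

section \<open>The diagram of a \<open>\<sigma>\<close>-refined sequence\<close>

locale adapted_sequence = lhomeo +
  fixes P :: "nat \<Rightarrow> 'a set set"
  assumes base: "clopen_base X P" and adapted: "sigma_adapted \<sigma> P"
begin

abbreviation "cell n x \<equiv> cell_of (P n) x"
abbreviation "D \<equiv> partition_diagram \<sigma> P"

lemma partition: "clopen_partition X (P n)"
  by (rule clopen_base_partition[OF base])

lemmas cell = clopen_partition_cell[OF partition]

lemma cell_cases:
  assumes "Z \<in> P n"
  shows "\<exists>x \<in> topspace X. x \<in> Z \<and> Z = cell n x"
proof -
  obtain x where "x \<in> Z" using cell(5)[OF assms] by blast
  then show ?thesis using cell(3,4)[OF assms] by blast
qed

lemma cell_antimono: "n \<le> k \<Longrightarrow> x \<in> topspace X \<Longrightarrow> cell k x \<subseteq> cell n x"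
  by (rule clopen_base_cell_antimono[OF base])

lemma cell_subset_iff:
  assumes "W \<in> P k" "Z \<in> P n" "x \<in> W" "n \<le> k"
  shows "W \<subseteq> Z \<longleftrightarrow> x \<in> Z"
  using refined_cell_subset[OF partition partition clopen_base_refine[OF base assms(4)]] assms by blast

lemma inj: "Z \<in> P n \<Longrightarrow> inj_on \<sigma> Z"
  by (rule adapted_inj[OF base adapted])

text \<open>Adaptedness makes one point decide the incidence of cells under \<open>\<sigma>\<close>, in both parities.  All axioms
  of \<^const>\<open>LDiag\<close> are verified for \<open>D\<close> by choosing a point and taking its cells and those
  of its image or of a preimage.\<close>

lemma image_supset_iff:
  assumes "Z \<in> P (2*j)" "Z' \<in> P (2*j + 1)" "y \<in> Z'"
  shows "Z' \<subseteq> \<sigma> ` Z \<longleftrightarrow> y \<in> \<sigma> ` Z"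
proof
  assume "y \<in> \<sigma> ` Z"
  then have "\<sigma> ` Z \<inter> Z' \<noteq> {}" using assms(3) by blast
  then show "Z' \<subseteq> \<sigma> ` Z" using adapted assms(1,2) by (simp add: sigma_adapted_def)
qed (use assms in blast)

lemma image_subset_iff:
  assumes "Z \<in> P (2*j + 1)" "W \<in> P (2*j + 2)" "x \<in> W"
  shows "\<sigma> ` W \<subseteq> Z \<longleftrightarrow> \<sigma> x \<in> Z"
proof
  assume x: "\<sigma> x \<in> Z"
  obtain Y where Y: "Y \<in> P (2*j + 1)" "\<sigma> ` W \<subseteq> Y"
    using adapted[unfolded sigma_adapted_def, THEN conjunct2, THEN conjunct2, THEN spec,
      THEN bspec, OF assms(2)]
    by blast
  then have "Y = Z" using cell(3)[OF Y(1), of "\<sigma> x"] cell(3)[OF assms(1) x] assms(3) by blast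
  then show "\<sigma> ` W \<subseteq> Z" using Y by simp
qed (use assms in blast)

lemma fields [simp]:
  "verts D n = {n} \<times> P n" "edges D n = pblue_edges P n \<union> pred_edges \<sigma> P n"
  "rng D = pedge_rng" "src D = pedge_src" "blue D = pblue P" "red D = pred \<sigma> P" "redof D = predof \<sigma> P"
  by (simp_all add: partition_diagram_def)

lemma in_pblue: "e \<in> pblue P (n, Z) \<longleftrightarrow> Z \<in> P n \<and> (\<exists>W \<in> P (Suc n). W \<subseteq> Z \<and> e = (Blue, n, W, Z))"
  by (auto simp: pblue_def pblue_edges_def)

lemma in_pred_even: "e \<in> pred \<sigma> P (2*j, Z) \<longleftrightarrow> Z \<in> P (2*j) \<and> (\<exists>W \<in> P (2*j + 1). W \<subseteq> \<sigma> ` Z \<and>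
  e = (Red, 2*j, W, Z))"
  by (auto simp: pred_def pred_edges_def)

lemma in_pred_odd: "e \<in> pred \<sigma> P (2*j + 1, Z) \<longleftrightarrow> Z \<in> P (2*j + 1) \<and> (\<exists>W \<in> P (2*j + 2). \<sigma> ` W \<subseteq> Z \<and>
  e = (Red, 2*j + 1, W, Z))"
  by (auto simp: pred_def pred_edges_def)

lemma in_predof:
  "g \<in> predof \<sigma> P (c, 2*j, Z, Y) \<longleftrightarrow> Z \<in> P (2*j + 1) \<and> (\<exists>W \<in> P (2*j + 2). \<sigma> ` W \<subseteq> Z \<and> W \<subseteq> Y \<and>
    g = (Red, 2*j + 1, W, Z))"
proof -
  have "g \<in> predof \<sigma> P (c, 2*j, Z, Y) \<longleftrightarrow> g \<in> pred \<sigma> P (2*j + 1, Z) \<and> snd (pedge_src g) \<subseteq> Y"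
    by (simp add: predof_def)
  then show ?thesis unfolding in_pred_odd by auto
qed

lemma in_pred_edges_even: "f \<in> pred_edges \<sigma> P (2*j) \<longleftrightarrow> (\<exists>W \<in> P (2*j + 1). \<exists>Z \<in> P (2*j). W \<subseteq> \<sigma> ` Z \<and>
  f = (Red, 2*j, W, Z))"
  by (auto simp: pred_edges_def)

lemma blue_edges_D: "blue_edges D n = pblue_edges P n"
  by (auto simp: blue_edges_def pblue_def pblue_edges_def pred_edges_def)

lemma red_edges_D: "red_edges D n = pred_edges \<sigma> P n"
  by (cases "even n") (auto simp: red_edges_def pred_def pblue_edges_def pred_edges_def)

lemma in_edges_D: "in_edges D (n, Z) = pblue P (n, Z) \<union> pred \<sigma> P (n, Z)"
proof -
  have "fst (pedge_rng e) = m" if "e \<in> pblue_edges P m \<union> pred_edges \<sigma> P m" for e :: "'a pedge" and m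
    using that by (auto simp: pblue_edges_def pred_edges_def)
  then show ?thesis by (fastforce simp: in_edges_def pblue_def pred_def)
qed

lemma pblue_nonempty:
  assumes "Z \<in> P n"
  shows "pblue P (n, Z) \<noteq> {}"
proof -
  obtain x where x: "x \<in> topspace X" "Z = cell n x" using cell_cases[OF assms] by blast
  then have "(Blue, n, cell (Suc n) x, Z) \<in> pblue P (n, Z)"
    unfolding in_pblue using cell(1) cell_antimono[of n "Suc n" x] by auto
  then show ?thesis by blast
qed

lemma pred_even_nonempty:
  assumes "Z \<in> P (2*j)"
  shows "pred \<sigma> P (2*j, Z) \<noteq> {}"
proof -
  obtain x where x: "x \<in> topspace X" "x \<in> Z" using cell_cases[OF assms] by blast
  let ?W = "cell (2*j + 1) (\<sigma> x)"
  have W: "?W \<in> P (2*j + 1)" "\<sigma> x \<in> ?W" using cell(1,2) maps[OF x(1)] by blast+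
  then have "?W \<subseteq> \<sigma> ` Z" using image_supset_iff[OF assms W] x(2) by blast
  then have "(Red, 2*j, ?W, Z) \<in> pred \<sigma> P (2*j, Z)" unfolding in_pred_even using W assms by blast
  then show ?thesis by blast
qed

lemma predof_nonempty:
  assumes "Z \<in> P (2*j + 1)" "Y \<in> P (2*j)" "Z \<subseteq> \<sigma> ` Y"
  shows "predof \<sigma> P (c, 2*j, Z, Y) \<noteq> {}"
proof -
  obtain x where x: "x \<in> Y" "\<sigma> x \<in> Z" using cell_cases[OF assms(1)] assms(3) by blast
  have xt: "x \<in> topspace X" using cell(4)[OF assms(2)] x by blast
  let ?W = "cell (2*j + 2) x"
  have W: "?W \<in> P (2*j + 2)" "x \<in> ?W" using cell(1,2)[OF xt] by blast+
  have "\<sigma> ` ?W \<subseteq> Z" using image_subset_iff[OF assms(1) W] x by blast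
  moreover have "?W \<subseteq> Y" using cell_subset_iff[OF W(1) assms(2) W(2)] x by simp
  ultimately have "(Red, 2*j + 1, ?W, Z) \<in> predof \<sigma> P (c, 2*j, Z, Y)" unfolding in_predof
    using W assms by blast
  then show ?thesis by blast
qed

text \<open>For a point \<open>x\<close> of the source of a red edge \<open>g\<close> at an odd level, \<open>g\<close> belongs to the class of the red
  edge with range the cell of \<open>x\<close>.\<close>

lemma pred_odd_Union:
  assumes "Z \<in> P (2*j + 1)"
  shows "pred \<sigma> P (2*j + 1, Z) = (\<Union>f \<in> {f \<in> pred_edges \<sigma> P (2*j). pedge_src f =
    (2*j + 1, Z)}. predof \<sigma> P f)"
proof (intro equalityI subsetI)
  fix g assume "g \<in> pred \<sigma> P (2*j + 1, Z)"
  then obtain W where W: "W \<in> P (2*j + 2)" "\<sigma> ` W \<subseteq> Z" "g = (Red, 2*j + 1, W, Z)"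
    unfolding in_pred_odd by blast
  obtain x where x: "x \<in> topspace X" "x \<in> W" using cell_cases[OF W(1)] by blast
  let ?Y = "cell (2*j) x"
  have Y: "?Y \<in> P (2*j)" "x \<in> ?Y" using cell(1,2)[OF x(1)] by blast+
  have "\<sigma> x \<in> Z" using W x by blast
  then have "Z \<subseteq> \<sigma> ` ?Y" using image_supset_iff[OF Y(1) assms] Y by blast
  then have "(Red, 2*j, Z, ?Y) \<in> {f \<in> pred_edges \<sigma> P (2*j). pedge_src f = (2*j + 1, Z)}"
    using Y assms in_pred_edges_even by auto
  moreover have "W \<subseteq> ?Y" using cell_subset_iff[OF W(1) Y(1) x(2)] Y(2) by simp
  then have "g \<in> predof \<sigma> P (Red, 2*j, Z, ?Y)" unfolding in_predof using W assms by blast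
  ultimately show "g \<in> (\<Union>f \<in> {f \<in> pred_edges \<sigma> P (2*j). pedge_src f = (2*j + 1, Z)}. predof \<sigma> P f)"
    by blast
next
  fix g assume "g \<in> (\<Union>f \<in> {f \<in> pred_edges \<sigma> P (2*j). pedge_src f = (2*j + 1, Z)}. predof \<sigma> P f)"
  then obtain f where f: "pedge_src f = (2*j + 1, Z)" "g \<in> predof \<sigma> P f" by blast
  then show "g \<in> pred \<sigma> P (2*j + 1, Z)" by (simp add: predof_def)
qed

lemma sep_even_D: "sep D (2*j, Z) = {pblue P (2*j, Z), pred \<sigma> P (2*j, Z)}"
  by (simp add: partition_diagram_def)

lemma sep_odd_D: "sep D (2*j + 1, Z) = insert (pblue P (2*j + 1, Z))
    (predof \<sigma> P ` {f \<in> pred_edges \<sigma> P (2*j). pedge_src f = (2*j + 1, Z)})"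
  by (simp add: partition_diagram_def)

lemma pblue_pred_disjoint: "pblue P v \<inter> pred \<sigma> P v' = {}"
  by (auto simp: pblue_def pred_def pblue_edges_def pred_edges_def)

lemma predof_disjoint:
  assumes f: "f \<in> pred_edges \<sigma> P (2*j)" and f': "f' \<in> pred_edges \<sigma> P (2*j)"
    and g: "pedge_src g = pedge_src g'" "g \<in> predof \<sigma> P f" "g' \<in> predof \<sigma> P f'"
  shows "f = f'"
proof -
  obtain Z Y where fe: "f = (Red, 2*j, Z, Y)" "Y \<in> P (2*j)" "Z \<in> P (2*j + 1)"
    using f in_pred_edges_even by blast
  obtain Z' Y' where fe': "f' = (Red, 2*j, Z', Y')" "Y' \<in> P (2*j)" "Z' \<in> P (2*j + 1)"
    using f' in_pred_edges_even by blast
  obtain W where W: "W \<in> P (2*j + 2)" "\<sigma> ` W \<subseteq> Z" "W \<subseteq> Y" "g = (Red, 2*j + 1, W, Z)"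
    using g(2) unfolding fe in_predof by blast
  obtain W' where W': "W' \<in> P (2*j + 2)" "\<sigma> ` W' \<subseteq> Z'" "W' \<subseteq> Y'" "g' = (Red, 2*j + 1, W', Z')"
    using g(3) unfolding fe' in_predof by blast
  have "W = W'" using g(1) W W' by simp
  moreover obtain x where "x \<in> W" using cell(5)[OF W(1)] by blast
  ultimately have "x \<in> Y" "x \<in> Y'" "\<sigma> x \<in> Z" "\<sigma> x \<in> Z'" using W W' by blast+
  then show ?thesis using cell(3) fe fe' by metis
qed

lemma separated_bratteli_D: "separated_bratteli D"
proof -
  have fin: "finite (P n)" for n using partition by (auto simp: clopen_partition_def)
  obtain x where x: "x \<in> topspace X" using nonempty by blast
  have ne: "P n \<noteq> {}" for n using cell(1)[OF x] by blast
  have "pblue_edges P n \<union> pred_edges \<sigma> P n \<subseteq> {Blue, Red} \<times> {n} \<times> P (Suc n) \<times> P n" for n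
    by (auto simp: pblue_edges_def pred_edges_def)
  then have finE: "finite (pblue_edges P n \<union> pred_edges \<sigma> P n)" for n
    by (rule finite_subset) (simp add: fin)
  have bl: "(Blue, n, cell (Suc n) x, cell n x) \<in> pblue_edges P n" if "x \<in> topspace X" for n x
    using cell(1)[OF that] cell_antimono[of n "Suc n" x] that by (auto simp: pblue_edges_def)
  have r: "pedge_rng ` (pblue_edges P n \<union> pred_edges \<sigma> P n) = {n} \<times> P n" for n
  proof
    show "{n} \<times> P n \<subseteq> pedge_rng ` (pblue_edges P n \<union> pred_edges \<sigma> P n)"
    proof
      fix v assume "v \<in> {n} \<times> P n"
      then obtain x where "x \<in> topspace X" "v = (n, cell n x)" using cell_cases by blast
      then show "v \<in> pedge_rng ` (pblue_edges P n \<union> pred_edges \<sigma> P n)"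
        using bl[of x n] by (intro image_eqI[of _ _ "(Blue, n, cell (Suc n) x, cell n x)"]) auto
    qed
  qed (auto simp: pblue_edges_def pred_edges_def)
  have s: "pedge_src ` (pblue_edges P n \<union> pred_edges \<sigma> P n) = {Suc n} \<times> P (Suc n)" for n
  proof
    show "{Suc n} \<times> P (Suc n) \<subseteq> pedge_src ` (pblue_edges P n \<union> pred_edges \<sigma> P n)"
    proof
      fix v assume "v \<in> {Suc n} \<times> P (Suc n)"
      then obtain x where "x \<in> topspace X" "v = (Suc n, cell (Suc n) x)" using cell_cases by blast
      then show "v \<in> pedge_src ` (pblue_edges P n \<union> pred_edges \<sigma> P n)"
        using bl[of x n] by (intro image_eqI[of _ _ "(Blue, n, cell (Suc n) x, cell n x)"]) auto
    qed
  qed (auto simp: pblue_edges_def pred_edges_def)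
  have part: "partition_on (in_edges D v) (sep D v)" if v: "v \<in> verts D n" for v n
  proof (cases "even n")
    case True
    then obtain j Z where Z: "v = (2*j, Z)" "Z \<in> P (2*j)" using v by auto
    show ?thesis unfolding Z(1) in_edges_D sep_even_D
      using pblue_nonempty[OF Z(2)] pred_even_nonempty[OF Z(2)] pblue_pred_disjoint[of "(2*j, Z)"
        "(2*j, Z)"]
      by (intro partition_onI) (auto simp: disjnt_def)
  next
    case False
    then obtain j Z where Z: "v = (2*j + 1, Z)" "Z \<in> P (2*j + 1)" using v by (auto elim: oddE)
    let ?S = "{f \<in> pred_edges \<sigma> P (2*j). pedge_src f = (2*j + 1, Z)}"
    show ?thesis unfolding Z(1) in_edges_D sep_odd_D
    proof (rule partition_onI)
      show "\<Union>(insert (pblue P (2*j + 1, Z)) (predof \<sigma> P ` ?S)) =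
        pblue P (2*j + 1, Z) \<union> pred \<sigma> P (2*j + 1, Z)"
        unfolding pred_odd_Union[OF Z(2)] by simp
      show "{} \<notin> insert (pblue P (2*j + 1, Z)) (predof \<sigma> P ` ?S)"
      proof -
        have "predof \<sigma> P f \<noteq> {}" if f: "f \<in> ?S" for f
        proof -
          obtain Y where "f = (Red, 2*j, Z, Y)" "Y \<in> P (2*j)" "Z \<subseteq> \<sigma> ` Y"
            using f unfolding in_pred_edges_even by auto
          then show ?thesis using predof_nonempty[OF Z(2)] by simp
        qed
        then show ?thesis using pblue_nonempty[OF Z(2)] by blast
      qed
      fix p q assume p: "p \<in> insert (pblue P (2*j + 1, Z)) (predof \<sigma> P ` ?S)"
        and q: "q \<in> insert (pblue P (2*j + 1, Z)) (predof \<sigma> P ` ?S)" and pq: "p \<noteq> q"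
      have bd: "disjnt (pblue P (2*j + 1, Z)) (predof \<sigma> P f)" for f
        using pblue_pred_disjoint unfolding predof_def disjnt_def by blast
      have rd: "disjnt (predof \<sigma> P f) (predof \<sigma> P f')" if "f \<in> ?S" "f' \<in> ?S" "f \<noteq> f'" for f f'
      proof -
        have "f \<in> pred_edges \<sigma> P (2*j)" "f' \<in> pred_edges \<sigma> P (2*j)" using that by blast+
        then have "\<not> (g \<in> predof \<sigma> P f \<and> g \<in> predof \<sigma> P f')" for g
          using predof_disjoint[of f j f' g g] that(3) by blast
        then show ?thesis unfolding disjnt_iff by blast
      qed
      consider f where "p = pblue P (2*j + 1, Z)" "q = predof \<sigma> P f"
        | f where "q = pblue P (2*j + 1, Z)" "p = predof \<sigma> P f"
        | f f' where "f \<in> ?S" "f' \<in> ?S" "p = predof \<sigma> P f" "q = predof \<sigma> P f'"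
        using p q pq by blast
      then show "disjnt p q"
      proof cases
        case (1 f)
        then show ?thesis using bd by simp
      next
        case (2 f)
        then show ?thesis using bd[of f] by (simp add: disjnt_sym)
      next
        case 3
        then have "f \<noteq> f'" using pq by blast
        then show ?thesis using rd[OF 3(1,2)] 3(3,4) by simp
      qed
    qed
  qed
  show ?thesis unfolding separated_bratteli_def
  proof (intro conjI allI ballI)
    fix n
    show "finite (verts D n)" "verts D n \<noteq> {}" using fin ne by auto
    show "finite (edges D n)" using finE by simp
    show "edges D n \<noteq> {}" using bl[OF x, of n] by auto
    show "rng D ` edges D n = verts D n" "src D ` edges D n = verts D (Suc n)" using r s by simp_all
  next
    show "disjoint_family (verts D)" by (auto simp: disjoint_family_on_def)
    show "disjoint_family (edges D)" by (auto simp: disjoint_family_on_def pblue_edges_def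
      pred_edges_def)
    fix v assume "v \<in> \<Union> (range (verts D))"
    then show "partition_on (in_edges D v) (sep D v)" using part by blast
  qed
qed

lemma l_colours_D: "l_colours D"
  unfolding l_colours_def
proof (intro conjI allI ballI)
  fix n v assume "v \<in> verts D n"
  show "blue D v \<inter> red D v = {}" using pblue_pred_disjoint by simp
next
  fix j v assume "v \<in> verts D (2*j)"
  then show "sep D v = {blue D v, red D v}" using sep_even_D by auto
next
  fix j v assume "v \<in> verts D (2*j + 1)"
  then obtain Z where v: "v = (2*j + 1, Z)" "Z \<in> P (2*j + 1)" by auto
  show "sep D v = insert (blue D v) (redof D ` {f \<in> red_edges D (2*j). src D f = v})"
    unfolding v(1) sep_odd_D red_edges_D by simp
  show "red D v = (\<Union>f \<in> {f \<in> red_edges D (2*j). src D f = v}. redof D f)"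
    using pred_odd_Union[OF v(2)] unfolding v(1) red_edges_D by simp
qed

lemma src_pblue: "pedge_src ` pblue P (n, Z) = {(Suc n, W) | W. W \<in> P (Suc n) \<and> Z \<in> P n \<and> W \<subseteq> Z}"
  unfolding set_eq_iff image_iff Bex_def in_pblue by auto

lemma src_pred_odd:
  "pedge_src ` pred \<sigma> P (2*j + 1, Z) = {(2*j + 2, W) | W. W \<in> P (2*j + 2) \<and> Z \<in> P (2*j + 1) \<and>
    \<sigma> ` W \<subseteq> Z}"
  unfolding set_eq_iff image_iff Bex_def in_pred_odd by auto

lemma src_pred_even:
  "pedge_src ` pred \<sigma> P (2*j, Z) = {(2*j + 1, W) | W. W \<in> P (2*j + 1) \<and> Z \<in> P (2*j) \<and> W \<subseteq> \<sigma> ` Z}"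
  unfolding set_eq_iff image_iff Bex_def in_pred_even by auto

lemma src_predof:
  "pedge_src ` predof \<sigma> P (c, 2*j, Z, Y) =
     {(2*j + 2, W) | W. W \<in> P (2*j + 2) \<and> Z \<in> P (2*j + 1) \<and> \<sigma> ` W \<subseteq> Z \<and> W \<subseteq> Y}"
  unfolding set_eq_iff image_iff Bex_def in_predof by auto

lemma subset_unique:
  assumes "W \<in> P k" "Z \<in> P n" "Z' \<in> P n" "W \<subseteq> Z" "W \<subseteq> Z'"
  shows "Z = Z'"
proof -
  obtain x where "x \<in> W" using cell(5)[OF assms(1)] by blast
  then show ?thesis using cell(3)[OF assms(2), of x] cell(3)[OF assms(3), of x] assms(4,5) by blast
qed

lemma image_unique:
  assumes "W \<in> P k" "Z \<in> P n" "Z' \<in> P n" "\<sigma> ` W \<subseteq> Z" "\<sigma> ` W \<subseteq> Z'"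
  shows "Z = Z'"
proof -
  obtain x where "x \<in> W" using cell(5)[OF assms(1)] by blast
  then show ?thesis using cell(3)[OF assms(2), of "\<sigma> x"] cell(3)[OF assms(3), of "\<sigma> x"] assms(4,5)
    by blast
qed

lemma UN_level: "(\<Union>v \<in> {n} \<times> A. f v) = (\<Union>Z \<in> A. f (n, Z))"
  by auto

lemma verts_blue_sources: "{Suc n} \<times> P (Suc n) = (\<Union>v \<in> {n} \<times> P n. pedge_src ` pblue P v)"
proof -
  have "\<exists>Z \<in> P n. W \<subseteq> Z" if "W \<in> P (Suc n)" for W
    using refined_byD[OF clopen_base_refine[OF base, of n "Suc n"] that] by simp
  then show ?thesis unfolding UN_level src_pblue by blast
qed

lemma disjoint_blue_sources: "disjoint_family_on (\<lambda>v. pedge_src ` pblue P v) ({n} \<times> P n)"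
  unfolding disjoint_family_on_def
proof (intro ballI impI)
  fix v v' assume "v \<in> {n} \<times> P n" "v' \<in> {n} \<times> P n" "v \<noteq> v'"
  then obtain Z Z' where Z: "v = (n, Z)" "v' = (n, Z')" "Z \<noteq> Z'" by blast
  show "pedge_src ` pblue P v \<inter> pedge_src ` pblue P v' = {}"
    unfolding Z(1,2) src_pblue using subset_unique[of _ "Suc n" Z n Z'] Z(3) by blast
qed

lemma blue_source_inj: "e \<in> pblue P (n, Z) \<Longrightarrow> e' \<in> pblue P (n, Z') \<Longrightarrow> pedge_src e = pedge_src e' \<Longrightarrow> e = e'"
proof -
  assume e: "e \<in> pblue P (n, Z)" "e' \<in> pblue P (n, Z')" "pedge_src e = pedge_src e'"
  obtain W where W: "W \<in> P (Suc n)" "W \<subseteq> Z" "e = (Blue, n, W, Z)" "Z \<in> P n"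
    using e(1) unfolding in_pblue by blast
  obtain W' where W': "W' \<in> P (Suc n)" "W' \<subseteq> Z'" "e' = (Blue, n, W', Z')" "Z' \<in> P n"
    using e(2) unfolding in_pblue by blast
  have "W = W'" using e(3) W W' by simp
  then show "e = e'" using subset_unique[OF W(1,4) W'(4)] W W' by simp
qed

lemma l_even_level_sources_D: "l_even_level_sources D"
  unfolding l_even_level_sources_def
proof (intro allI conjI ballI)
  fix j
  show "disjoint_family_on (\<lambda>v. src D ` blue D v) (verts D (2*j + 1))"
    using disjoint_blue_sources by simp
  show "verts D (2*j + 2) = (\<Union>v \<in> verts D (2*j + 1). src D ` blue D v)"
    using verts_blue_sources[of "2*j + 1"] by simp
  have im: "pedge_src ` pred \<sigma> P (2*j + 1, Z) \<inter> pedge_src ` pred \<sigma> P (2*j + 1, Z') = {}"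
    if "Z \<noteq> Z'" for Z Z'
    unfolding src_pred_odd using image_unique[of _ "2*j + 2" Z "2*j + 1" Z'] that by blast
  then show "disjoint_family_on (\<lambda>v. src D ` red D v) (verts D (2*j + 1))"
    unfolding disjoint_family_on_def by auto
  have ex: "\<exists>Z \<in> P (2*j + 1). \<sigma> ` W \<subseteq> Z" if "W \<in> P (2*j + 2)" for W
    using adapted that by (simp add: sigma_adapted_def)
  show "verts D (2*j + 2) = (\<Union>v \<in> verts D (2*j + 1). src D ` red D v)"
  proof -
    have "(\<Union>v \<in> verts D (2*j + 1). src D ` red D v) = (\<Union>Z \<in>
      P (2*j + 1). pedge_src ` pred \<sigma> P (2*j + 1, Z))"
      unfolding fields UN_level ..
    also have "\<dots> = {2*j + 2} \<times> P (2*j + 2)"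
    proof (intro equalityI subsetI)
      fix w assume "w \<in> {2*j + 2} \<times> P (2*j + 2)"
      then obtain W where W: "w = (2*j + 2, W)" "W \<in> P (2*j + 2)" by blast
      then obtain Z where "Z \<in> P (2*j + 1)" "\<sigma> ` W \<subseteq> Z" using ex by blast
      then show "w \<in> (\<Union>Z \<in> P (2*j + 1). pedge_src ` pred \<sigma> P (2*j + 1, Z))"
        unfolding src_pred_odd using W by blast
    qed (unfold src_pred_odd, blast)
    finally show ?thesis by (simp only: fields)
  qed
  fix v assume "v \<in> verts D (2*j + 1)"
  then obtain Z where v: "v = (2*j + 1, Z)" "Z \<in> P (2*j + 1)" by auto
  show "inj_on (src D) (blue D v)" unfolding v(1) by (rule inj_onI) (use blue_source_inj in auto)
  show "inj_on (src D) (red D v)"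
  proof (rule inj_onI)
    fix e e' assume "e \<in> red D v" "e' \<in> red D v" "src D e = src D e'"
    then have "e \<in> pred \<sigma> P (2*j + 1, Z)" "e' \<in> pred \<sigma> P (2*j + 1, Z)" "pedge_src e = pedge_src e'"
      by (simp_all add: v)
    then show "e = e'" unfolding in_pred_odd by auto
  qed
qed

lemma l_first_level_sources_D: "l_first_level_sources D"
  unfolding l_first_level_sources_def
proof (intro conjI allI ballI impI)
  show "disjoint_family_on (\<lambda>v. src D ` blue D v) (verts D 0)" using disjoint_blue_sources by simp
  show "verts D 1 = (\<Union>v \<in> verts D 0. src D ` blue D v)" using verts_blue_sources[of 0] by simp
  have "\<exists>Z \<in> P 0. W \<subseteq> \<sigma> ` Z" if W: "W \<in> P 1" for W
  proof -
    obtain y where y: "y \<in> W" "y \<in> topspace X" using cell_cases[OF W] by blast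
    obtain x where x: "x \<in> topspace X" "y = \<sigma> x" using onto y(2) by (metis imageE)
    then have "cell 0 x \<in> P (2*0)" "y \<in> \<sigma> ` cell 0 x" using cell(1,2)[OF x(1)] by auto
    then show ?thesis using image_supset_iff[of "cell 0 x" 0 W y] W y(1) by auto
  qed
  then have "(\<Union>Z \<in> P (2*0). pedge_src ` pred \<sigma> P (2*0, Z)) = {1} \<times> P 1" unfolding src_pred_even by auto
  then show "verts D 1 = (\<Union>v \<in> verts D 0. src D ` red D v)" unfolding fields UN_level by simp
next
  fix j v1 v2 e e'
  assume "v1 \<in> verts D (2*j)" "v2 \<in> verts D (2*j)" "e \<in> blue D v1" "e' \<in> blue D v2" "e \<noteq> e'"
  then show "src D e \<noteq> src D e'"
    using blue_source_inj[of e "2*j" "snd v1" e' "snd v2"] by auto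
qed

text \<open>Both unions consist of all cells \<open>W \<subseteq> Y\<close>: the blue pair passes through the cell of a point
  \<open>x \<in> W\<close>, the red pair through the cell of \<open>\<sigma> x\<close>.\<close>

lemma l_two_step_sources_D: "l_two_step_sources D"
  unfolding l_two_step_sources_def
proof (intro allI ballI conjI)
  fix j v assume "v \<in> verts D (2*j)"
  then obtain Y where v: "v = (2*j, Y)" "Y \<in> P (2*j)" by auto
  have bl: "blue D v = {(Blue, 2*j, Z, Y) | Z. Z \<in> P (2*j + 1) \<and> Z \<subseteq> Y}"
    unfolding v(1) using v(2) in_pblue by auto
  have rd: "red D v = {(Red, 2*j, Z, Y) | Z. Z \<in> P (2*j + 1) \<and> Z \<subseteq> \<sigma> ` Y}"
    unfolding v(1) fields(6) using v(2) in_pred_even by blast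
  show "disjoint_family_on (\<lambda>e. src D ` blue D (src D e)) (blue D v)"
    unfolding disjoint_family_on_def
  proof (intro ballI impI)
    fix e e' assume e: "e \<in> blue D v" "e' \<in> blue D v" "e \<noteq> e'"
    then obtain Z Z' where Z: "e = (Blue, 2*j, Z, Y)" "e' = (Blue, 2*j, Z', Y)" "Z \<noteq> Z'"
      unfolding bl by blast
    show "src D ` blue D (src D e) \<inter> src D ` blue D (src D e') = {}"
      unfolding Z(1,2) fields pedge_src.simps src_pblue
      using subset_unique[of _ "Suc (Suc (2*j))" Z "Suc (2*j)" Z'] Z(3) by blast
  qed
  have sr: "src D ` redof D (Red, 2*j, Z, Y) = {(2*j + 2, W) | W. W \<in> P (2*j + 2) \<and> Z \<in> P (2*j + 1) \<and>
    \<sigma> ` W \<subseteq> Z \<and> W \<subseteq> Y}" for Z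
    using src_predof by simp
  show "disjoint_family_on (\<lambda>f. src D ` redof D f) (red D v)"
    unfolding disjoint_family_on_def
  proof (intro ballI impI)
    fix f f' assume f: "f \<in> red D v" "f' \<in> red D v" "f \<noteq> f'"
    then obtain Z Z' where Z: "f = (Red, 2*j, Z, Y)" "f' = (Red, 2*j, Z', Y)" "Z \<noteq> Z'" unfolding rd
      by blast
    show "src D ` redof D f \<inter> src D ` redof D f' = {}"
      unfolding Z(1,2) sr using image_unique[of _ "2*j + 2" Z "2*j + 1" Z'] Z(3) by blast
  qed
  have "(\<Union>e \<in> blue D v. src D ` blue D (src D e)) = {(2*j + 2, W) | W. W \<in> P (2*j + 2) \<and> W \<subseteq> Y}"
  proof (intro equalityI subsetI)
    fix w assume "w \<in> (\<Union>e \<in> blue D v. src D ` blue D (src D e))"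
    then obtain Z where Z: "Z \<subseteq> Y" "w \<in> src D ` blue D (src D (Blue, 2*j, Z, Y))" unfolding bl by blast
    then show "w \<in> {(2*j + 2, W) | W. W \<in> P (2*j + 2) \<and> W \<subseteq> Y}" by (auto simp: src_pblue)
  next
    fix w assume "w \<in> {(2*j + 2, W) | W. W \<in> P (2*j + 2) \<and> W \<subseteq> Y}"
    then obtain W where W: "w = (2*j + 2, W)" "W \<in> P (2*j + 2)" "W \<subseteq> Y" by blast
    obtain x where x: "x \<in> W" "x \<in> topspace X" using cell_cases[OF W(2)] by blast
    let ?Z = "cell (2*j + 1) x"
    have Z: "?Z \<in> P (2*j + 1)" "x \<in> ?Z" using cell(1,2)[OF x(2)] by blast+
    have "W \<subseteq> ?Z" "?Z \<subseteq> Y"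
      using cell_subset_iff[OF W(2) Z(1) x(1)] cell_subset_iff[OF Z(1) v(2) Z(2)] Z(2) W(3) x(1) by auto
    then have "(Blue, 2*j, ?Z, Y) \<in> blue D v" "w \<in> src D ` blue D (src D (Blue, 2*j, ?Z, Y))"
      unfolding bl using Z W by (auto simp: src_pblue)
    then show "w \<in> (\<Union>e \<in> blue D v. src D ` blue D (src D e))" by blast
  qed
  also have "\<dots> = (\<Union>f \<in> red D v. src D ` redof D f)"
  proof (intro equalityI subsetI)
    fix w assume "w \<in> {(2*j + 2, W) | W. W \<in> P (2*j + 2) \<and> W \<subseteq> Y}"
    then obtain W where W: "w = (2*j + 2, W)" "W \<in> P (2*j + 2)" "W \<subseteq> Y" by blast
    obtain x where x: "x \<in> W" "x \<in> topspace X" using cell_cases[OF W(2)] by blast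
    let ?Z = "cell (2*j + 1) (\<sigma> x)"
    have Z: "?Z \<in> P (2*j + 1)" "\<sigma> x \<in> ?Z" using cell(1,2)[OF maps[OF x(2)]] by blast+
    have "\<sigma> ` W \<subseteq> ?Z" using image_subset_iff[OF Z(1) W(2) x(1)] Z(2) by blast
    moreover have "?Z \<subseteq> \<sigma> ` Y" using image_supset_iff[OF v(2) Z] W(3) x(1) by blast
    ultimately have "(Red, 2*j, ?Z, Y) \<in> red D v" "w \<in> src D ` redof D (Red, 2*j, ?Z, Y)"
      unfolding rd sr using Z W by auto
    then show "w \<in> (\<Union>f \<in> red D v. src D ` redof D f)" by blast
  next
    fix w assume "w \<in> (\<Union>f \<in> red D v. src D ` redof D f)"
    then obtain Z where "w \<in> src D ` redof D (Red, 2*j, Z, Y)" unfolding rd by blast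
    then show "w \<in> {(2*j + 2, W) | W. W \<in> P (2*j + 2) \<and> W \<subseteq> Y}" unfolding sr by blast
  qed
  finally show "(\<Union>e \<in> blue D v. src D ` blue D (src D e)) = (\<Union>f \<in> red D v. src D ` redof D f)" .
qed

text \<open>The middle vertex of the blue pair is the cell of any point of the last source.\<close>

lemma l_red_to_blue_D: "l_red_to_blue D"
  unfolding l_red_to_blue_def
proof (intro allI ballI)
  fix j v f0 f1
  assume v: "v \<in> verts D (2*j + 1)" and f0: "f0 \<in> red D v" and f1: "f1 \<in> red D (src D f0)"
  obtain Z where Z: "v = (2*j + 1, Z)" "Z \<in> P (2*j + 1)" using v by auto
  have "f0 \<in> pred \<sigma> P (2*j + 1, Z)" using f0 Z by simp
  then obtain W where W: "W \<in> P (2*j + 2)" "\<sigma> ` W \<subseteq> Z" "f0 = (Red, 2*j + 1, W, Z)"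
    unfolding in_pred_odd by blast
  have "f1 \<in> pred \<sigma> P (2*(j + 1), W)" using f1 W by simp
  then obtain T where T: "T \<in> P (2*(j + 1) + 1)" "T \<subseteq> \<sigma> ` W" "f1 = (Red, 2*(j + 1), T, W)"
    unfolding in_pred_even by blast
  obtain y where y: "y \<in> T" "y \<in> topspace X" using cell_cases[OF T(1)] by blast
  let ?V = "cell (2*j + 2) y"
  have V: "?V \<in> P (2*j + 2)" "y \<in> ?V" using cell(1,2)[OF y(2)] by blast+
  have TV: "T \<subseteq> ?V" using cell_subset_iff[OF T(1) V(1) y(1)] V(2) by simp
  have VZ: "?V \<subseteq> Z" using cell_subset_iff[OF V(1) Z(2) V(2)] y(1) T(2) W(2) by auto
  show "\<exists>!p. fst p \<in> blue D v \<and> snd p \<in> blue D (src D (fst p)) \<and> src D (snd p) = src D f1"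
  proof (rule ex1I[of _ "((Blue, 2*j + 1, ?V, Z), (Blue, 2*j + 2, T, ?V))"])
    show "fst ((Blue, 2*j + 1, ?V, Z), (Blue, 2*j + 2, T, ?V)) \<in> blue D v \<and>
      snd ((Blue, 2*j + 1, ?V, Z), (Blue, 2*j + 2, T, ?V)) \<in>
        blue D (src D (fst ((Blue, 2*j + 1, ?V, Z), (Blue, 2*j + 2, T, ?V)))) \<and>
      src D (snd ((Blue, 2*j + 1, ?V, Z), (Blue, 2*j + 2, T, ?V))) = src D f1"
      using Z V TV VZ T by (simp add: in_pblue)
    fix p assume p: "fst p \<in> blue D v \<and> snd p \<in> blue D (src D (fst p)) \<and> src D (snd p) = src D f1"
    then obtain V' where V': "V' \<in> P (2*j + 2)" "fst p = (Blue, 2*j + 1, V', Z)" using Z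
      by (auto simp: in_pblue)
    then obtain T' where T': "T' \<subseteq> V'" "snd p = (Blue, 2*j + 2, T', V')" using p
      by (auto simp: in_pblue)
    then have "T' = T" using p T by simp
    then have "V' = ?V" using cell(3)[OF V'(1), of y] y T' by blast
    then show "p = ((Blue, 2*j + 1, ?V, Z), (Blue, 2*j + 2, T, ?V))"
      using V' T' \<open>T' = T\<close> by (simp add: prod_eq_iff)
  qed
qed

text \<open>A point \<open>y\<close> in the last source has a preimage \<open>x \<in> Y\<close>, and the middle vertex of the red pair is
  the cell of \<open>x\<close>.  Uniqueness holds because \<open>\<sigma>\<close> is injective on \<open>Y\<close>.\<close>

lemma l_blue_to_red_D: "l_blue_to_red D"
  unfolding l_blue_to_red_def
proof (intro allI ballI impI)
  fix j v g e0 e1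
  assume v: "v \<in> verts D (2*j + 1)" and g: "g \<in> red_edges D (2*j)" "src D g = v"
    and e0: "e0 \<in> blue D v" and e1: "e1 \<in> blue D (src D e0)"
  obtain Z where Z: "v = (2*j + 1, Z)" "Z \<in> P (2*j + 1)" using v by auto
  obtain Y where Y: "Y \<in> P (2*j)" "Z \<subseteq> \<sigma> ` Y" "g = (Red, 2*j, Z, Y)"
    using g Z unfolding red_edges_D in_pred_edges_even by auto
  obtain W where W: "W \<in> P (2*j + 2)" "W \<subseteq> Z" "e0 = (Blue, 2*j + 1, W, Z)" using e0 Z
    by (auto simp: in_pblue)
  obtain T where T: "T \<in> P (2*j + 3)" "T \<subseteq> W" "e1 = (Blue, 2*j + 2, T, W)"
    using e1 W by (auto simp: in_pblue numeral_eq_Suc)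
  obtain y where y: "y \<in> T" using cell(5)[OF T(1)] by blast
  then obtain x where x: "x \<in> Y" "y = \<sigma> x" using T W Y by blast
  have xt: "x \<in> topspace X" using cell(4)[OF Y(1)] x by blast
  let ?V = "cell (2*j + 2) x"
  have V: "?V \<in> P (2*j + 2)" "x \<in> ?V" using cell(1,2)[OF xt] by blast+
  have VY: "?V \<subseteq> Y" using cell_subset_iff[OF V(1) Y(1) V(2)] x by simp
  have VZ: "\<sigma> ` ?V \<subseteq> Z" using image_subset_iff[OF Z(2) V] x y T W by blast
  have V2: "?V \<in> P (2*(j + 1))" and T2: "T \<in> P (2*(j + 1) + 1)" using V(1) T(1)
    by (simp_all add: numeral_eq_Suc)
  have TV: "T \<subseteq> \<sigma> ` ?V" using image_supset_iff[OF V2 T2 y] x V(2) by blast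
  have c1: "fst p \<in> redof D g \<longleftrightarrow> (\<exists>U \<in> P (2*j + 2). \<sigma> ` U \<subseteq> Z \<and> U \<subseteq> Y \<and>
    fst p = (Red, 2*j + 1, U, Z))" for p
    unfolding Y(3) fields in_predof using Z(2) by blast
  have c2: "e \<in> red D (2*j + 2, U) \<longleftrightarrow> U \<in> P (2*j + 2) \<and> (\<exists>T \<in> P (2*j + 3). T \<subseteq> \<sigma> ` U \<and>
    e = (Red, 2*j + 2, T, U))" for e U
    using in_pred_even[of e "j + 1" U] by (simp add: numeral_eq_Suc)
  show "\<exists>!p. fst p \<in> redof D g \<and> rng D (fst p) = v \<and> snd p \<in> red D (src D (fst p)) \<and>
    src D (snd p) = src D e1"
  proof (rule ex1I[of _ "((Red, 2*j + 1, ?V, Z), (Red, 2*j + 2, T, ?V))"])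
    have "src D (Red, 2*j + 1, ?V, Z) = (2*j + 2, ?V)" by simp
    then show "fst ((Red, 2*j + 1, ?V, Z), (Red, 2*j + 2, T, ?V)) \<in> redof D g \<and>
      rng D (fst ((Red, 2*j + 1, ?V, Z), (Red, 2*j + 2, T, ?V))) = v \<and>
      snd ((Red, 2*j + 1, ?V, Z), (Red, 2*j + 2, T, ?V)) \<in>
        red D (src D (fst ((Red, 2*j + 1, ?V, Z), (Red, 2*j + 2, T, ?V)))) \<and>
      src D (snd ((Red, 2*j + 1, ?V, Z), (Red, 2*j + 2, T, ?V))) = src D e1"
      unfolding c1 using V VY VZ TV T Z c2
        by (auto simp: c1[of "(_, _)", unfolded fst_conv] simp del: fields(7))
    fix p
    assume p: "fst p \<in> redof D g \<and> rng D (fst p) = v \<and> snd p \<in> red D (src D (fst p)) \<and>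
      src D (snd p) = src D e1"
    then obtain U where U: "U \<in> P (2*j + 2)" "U \<subseteq> Y" "fst p = (Red, 2*j + 1, U, Z)" unfolding c1
      by blast
    have "src D (fst p) = (2*j + 2, U)" using U by simp
    then obtain T' where T': "T' \<subseteq> \<sigma> ` U" "snd p = (Red, 2*j + 2, T', U)" using p c2 by metis
    then have TT: "T' = T" using p T by simp
    then obtain x' where x': "x' \<in> U" "y = \<sigma> x'" using T' y by blast
    then have "x' = x" using inj_onD[OF inj[OF Y(1)], of x' x] x U by blast
    then have "U = ?V" using cell(3)[OF U(1) x'(1)] by simp
    then show "p = ((Red, 2*j + 1, ?V, Z), (Red, 2*j + 2, T, ?V))" using U T' TT
      by (simp add: prod_eq_iff)
  qed
qed

theorem partition_diagram_LDiag: "D \<in> LDiag"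
  unfolding LDiag_def
  using separated_bratteli_D l_colours_D l_even_level_sources_D l_first_level_sources_D
    l_two_step_sources_D l_red_to_blue_D l_blue_to_red_D by simp


sublocale D: l_diagram D
  by (rule l_diagram.intro[OF partition_diagram_LDiag])

definition itinerary :: "'a \<Rightarrow> nat \<Rightarrow> 'a pedge" where
  "itinerary x n = (Blue, n, cell (Suc n) x, cell n x)"

lemma itinerary_ray: "x \<in> topspace X \<Longrightarrow> itinerary x \<in> blue_rays D"
  unfolding blue_rays_def blue_edges_D
  using cell(1)[of x] cell_antimono[of _ "Suc _" x] by (auto simp: itinerary_def pblue_edges_def)

text \<open>The red ray of the itinerary of \<open>x\<close> alternates between cells of \<open>x\<close> and cells of \<open>\<sigma> x\<close>, as
  \<^const>\<open>shift_witness\<close> asks.\<close>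

lemma itinerary_shift:
  assumes x: "x \<in> topspace X"
  shows "ray_shift D (itinerary x) = itinerary (\<sigma> x)"
proof (rule D.shift_eqI[OF itinerary_ray[OF x] itinerary_ray[OF maps[OF x]]])
  define r where "r n = (if even n then (Red, n, cell (Suc n) (\<sigma> x), cell n x)
      else (Red, n, cell (Suc n) x, cell n (\<sigma> x)))" for n
  show "shift_witness D (itinerary x) (itinerary (\<sigma> x)) r" unfolding shift_witness_def
  proof (intro allI conjI)
    fix j
    note c = cell(1,2)[OF x] and c' = cell(1,2)[OF maps[OF x]]
    have "cell (2*j + 1) (\<sigma> x) \<subseteq> \<sigma> ` cell (2*j) x" using image_supset_iff[OF c(1) c'(1) c'(2)] c(2)
      by blast
    then show "r (2*j) \<in> red_edges D (2*j)"
      unfolding red_edges_D in_pred_edges_even using c(1) c'(1) by (auto simp: r_def)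
    have "\<sigma> ` cell (2*j + 2) x \<subseteq> cell (2*j + 1) (\<sigma> x)"
      using image_subset_iff[OF c'(1) c(1) c(2)] c'(2) by blast
    moreover have "cell (2*j + 2) x \<subseteq> cell (2*j) x" using cell_antimono[OF _ x, of "2*j" "2*j + 2"]
      by simp
    ultimately show "r (2*j + 1) \<in> redof D (r (2*j))"
      using c(1)[of "2*j + 2"] c'(1)[of "2*j + 1"] in_predof[of "r (2*j + 1)" Red j]
        by (simp add: r_def)
    show "src D (r (2*j)) = rng D (itinerary (\<sigma> x) (2*j + 1))" by (simp add: r_def itinerary_def)
    show "src D (r (2*j + 1)) = rng D (itinerary x (2*j + 2))" by (simp add: r_def itinerary_def)
  qed
qed

lemma itinerary_inj: "inj_on itinerary (topspace X)"
proof (rule inj_onI, rule ccontr)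
  fix x y assume x: "x \<in> topspace X" and y: "y \<in> topspace X" and e: "itinerary x = itinerary y"
    and "x \<noteq> y"
  then obtain U where U: "openin X U" "x \<in> U" "y \<notin> U"
    using Hausdorff unfolding Hausdorff_space_def disjnt_def by blast
  obtain n Z where Z: "Z \<in> P n" "x \<in> Z" "Z \<subseteq> U" using clopen_base_nbhd[OF base U(1,2)] by blast
  have "cell n x = cell n y" using fun_cong[OF e, of n] by (simp add: itinerary_def)
  then have "y \<in> Z" using cell(2)[OF y] cell(3)[OF Z(1,2)] by metis
  then show False using Z U by blast
qed

text \<open>The vertices of a ray are a decreasing sequence of nonempty closed sets, which have a common
  point by compactness.\<close>

lemma itinerary_onto:
  assumes r: "r \<in> blue_rays D"
  shows "\<exists>x \<in> topspace X. r = itinerary x"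
proof -
  have "r n \<in> pblue_edges P n" for n using D.ray_edge[OF r] unfolding blue_edges_D .
  then obtain W Z where WZ: "\<And>n. r n = (Blue, n, W n, Z n)" "\<And>n. Z n \<in> P n" "\<And>n. W n \<subseteq> Z n"
    unfolding pblue_edges_def mem_Collect_eq by metis
  have W: "W n = Z (Suc n)" for n using D.ray_src[OF r, of n] WZ(1) by simp
  have "(\<Inter>n. Z n) \<noteq> {}"
  proof (rule compact_space_imp_nest[OF compact])
    show "closedin X (Z n)" for n using partition[of n] WZ(2)[of n] by (simp add: clopen_partition_def)
    show "Z n \<noteq> {}" for n using cell(5)[OF WZ(2)] .
    show "decseq Z" using WZ(3) W by (simp add: decseq_Suc_iff)
  qed
  then obtain x where x: "\<And>n. x \<in> Z n" by blast
  have "cell n x = Z n" for n using cell(3)[OF WZ(2) x] .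
  then have "r = itinerary x" using WZ(1) W by (auto simp: itinerary_def)
  moreover have "x \<in> topspace X" using cell(4)[OF WZ(2)] x by blast
  ultimately show ?thesis by blast
qed

lemma itinerary_homeomorphic: "homeomorphic_map X (ray_topology D) itinerary"
proof (rule continuous_imp_homeomorphic_map[OF _ compact D.Hausdorff_ray_topology])
  show "continuous_map X (ray_topology D) itinerary"
  proof (rule D.ray_continuousI[OF itinerary_ray])
    fix n v assume "v \<in> verts D n"
    then obtain Z where Z: "v = (n, Z)" "Z \<in> P n" by auto
    have "{x \<in> topspace X. rng D (itinerary x n) = v} = Z"
      using cell(2,3)[of _ n] cell(4)[OF Z(2)] Z by (auto simp: itinerary_def)
    then show "openin X {x \<in> topspace X. rng D (itinerary x n) = v}"
      using partition[of n] Z(2) by (simp add: clopen_partition_def)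
  qed
  show "itinerary ` topspace X = topspace (ray_topology D)"
    unfolding D.topspace_ray_topology using itinerary_ray itinerary_onto by blast
qed (rule itinerary_inj)

theorem top_conj_ray_system: "top_conj (X, \<sigma>) (ray_system D)"
  unfolding top_conj_def ray_system_def
  using itinerary_homeomorphic itinerary_shift by (intro exI[of _ itinerary]) simp

end

section \<open>Topological conjugacy and isomorphism of diagrams\<close>

lemma top_conj_refl: "top_conj p p"
  unfolding top_conj_def by (intro exI[of _ id]) simp

lemma top_conj_sym:
  assumes "p \<in> LHomeo" "top_conj p q"
  shows "top_conj q p"
proof -
  obtain X \<sigma> Y \<tau> where pq: "p = (X, \<sigma>)" "q = (Y, \<tau>)" by (metis surj_pair)
  interpret lhomeo X \<sigma> by (rule lhomeo.intro) (use assms(1) pq in simp)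
  obtain h where h: "homeomorphic_map X Y h" "\<And>x. x \<in> topspace X \<Longrightarrow> h (\<sigma> x) = \<tau> (h x)"
    using assms(2) unfolding top_conj_def pq by auto
  obtain g where g: "homeomorphic_maps X Y h g" using h(1) unfolding homeomorphic_map_maps by blast
  have gh: "g (h x) = x" if "x \<in> topspace X" for x using g that by (simp add: homeomorphic_maps_def)
  have "g (\<tau> y) = \<sigma> (g y)" if y: "y \<in> topspace Y" for y
  proof -
    have gy: "g y \<in> topspace X" "h (g y) = y"
      using g y by (auto simp: homeomorphic_maps_def continuous_map_def)
    then have "\<tau> y = h (\<sigma> (g y))" using h(2)[OF gy(1)] by simp
    then show ?thesis using gh maps[OF gy(1)] by simp
  qed
  moreover have "homeomorphic_map Y X g"
    using g homeomorphic_maps_sym homeomorphic_maps_map by blast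
  ultimately show ?thesis unfolding top_conj_def pq by auto
qed

lemma top_conj_trans:
  assumes "top_conj p q" "top_conj q r"
  shows "top_conj p r"
proof -
  obtain h where h: "homeomorphic_map (fst p) (fst q) h"
    "\<forall>x \<in> topspace (fst p). h (snd p x) = snd q (h x)"
    using assms(1) unfolding top_conj_def by blast
  obtain k where k: "homeomorphic_map (fst q) (fst r) k"
    "\<forall>x \<in> topspace (fst q). k (snd q x) = snd r (k x)"
    using assms(2) unfolding top_conj_def by blast
  have "h x \<in> topspace (fst q)" if "x \<in> topspace (fst p)" for x
    using homeomorphic_imp_surjective_map[OF h(1)] that by blast
  then show ?thesis unfolding top_conj_def
    using homeomorphic_map_compose[OF h(1) k(1)] h(2) k(2) by (intro exI[of _ "k \<circ> h"]) simp
qed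

text \<open>Used to transport \<^const>\<open>l_red_to_blue\<close> and \<^const>\<open>l_blue_to_red\<close> along a relabelling.\<close>

lemma ex1_pair_image:
  assumes "\<exists>!p. A (fst p) (snd p)" "\<And>a b. A a b \<Longrightarrow> B (\<phi> a) (\<phi> b)"
    and "\<And>p q. B p q \<Longrightarrow> \<exists>a b. p = \<phi> a \<and> q = \<phi> b \<and> A a b"
  shows "\<exists>!p. B (fst p) (snd p)"
proof (rule ex_ex1I)
  show "\<exists>p. B (fst p) (snd p)" using assms(1,2) by (metis fst_conv snd_conv)
  show "p = q" if "B (fst p) (snd p)" "B (fst q) (snd q)" for p q
    using assms(1) assms(3)[OF that(1)] assms(3)[OF that(2)] by (metis fst_conv snd_conv prod_eqI)
qed

text \<open>\<^const>\<open>l_class\<close> is built from diagrams over the natural numbers, so a diagram over other types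
  has to be copied.  The copy \<open>G\<close> is the image of \<open>F\<close> under two injections.\<close>

locale ldiag_relabelling = l_diagram F
  for F :: "('v, 'e) cdiagram" +
  fixes G :: "('w, 'f) cdiagram" and \<phi>0 :: "'v \<Rightarrow> 'w" and \<phi>1 :: "'e \<Rightarrow> 'f"
  assumes inj0: "inj_on \<phi>0 (\<Union>n. verts F n)" and inj1: "inj_on \<phi>1 (\<Union>n. edges F n)"
    and V: "verts G n = \<phi>0 ` verts F n" and E: "edges G n = \<phi>1 ` edges F n"
    and rngG: "e \<in> edges F n \<Longrightarrow> rng G (\<phi>1 e) = \<phi>0 (rng F e)"
    and srcG: "e \<in> edges F n \<Longrightarrow> src G (\<phi>1 e) = \<phi>0 (src F e)"
    and sepG: "v \<in> verts F n \<Longrightarrow> sep G (\<phi>0 v) = (`) \<phi>1 ` sep F v"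
    and blueG: "v \<in> verts F n \<Longrightarrow> blue G (\<phi>0 v) = \<phi>1 ` blue F v"
    and redG: "v \<in> verts F n \<Longrightarrow> red G (\<phi>0 v) = \<phi>1 ` red F v"
    and redofG: "f \<in> red_edges F (2*j) \<Longrightarrow> redof G (\<phi>1 f) = \<phi>1 ` redof F f"
begin

lemma eq0: "v \<in> verts F n \<Longrightarrow> w \<in> verts F k \<Longrightarrow> \<phi>0 v = \<phi>0 w \<longleftrightarrow> v = w"
  using inj_onD[OF inj0, of v w] by blast

lemma eq1: "e \<in> edges F n \<Longrightarrow> e' \<in> edges F k \<Longrightarrow> \<phi>1 e = \<phi>1 e' \<longleftrightarrow> e = e'"
  using inj_onD[OF inj1, of e e'] by blast

lemma src_image: "A \<subseteq> edges F n \<Longrightarrow> src G ` \<phi>1 ` A = \<phi>0 ` src F ` A"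
  using srcG by (force simp: image_image)

lemma blue_sub: "v \<in> verts F n \<Longrightarrow> blue F v \<subseteq> edges F n"
  and red_sub: "v \<in> verts F n \<Longrightarrow> red F v \<subseteq> edges F n"
  using blue_red_cover[of v n] by blast+

lemma redof_sub: "f \<in> red_edges F (2*j) \<Longrightarrow> redof F f \<subseteq> edges F (2*j + 1)"
  using redof_odd(1) red_edge by blast

lemma red_edges_G: "red_edges G n = \<phi>1 ` red_edges F n"
proof (intro equalityI subsetI)
  fix f assume "f \<in> red_edges G n"
  then obtain e where e: "e \<in> edges F n" "f = \<phi>1 e" "\<phi>1 e \<in> red G (rng G (\<phi>1 e))"
    unfolding red_edges_def E by blast
  have v: "rng F e \<in> verts F n" using rng_edge[OF e(1)] .
  have "\<phi>1 e \<in> \<phi>1 ` red F (rng F e)" using e(3) redG[OF v] rngG[OF e(1)] by simp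
  then obtain e' where e': "e' \<in> red F (rng F e)" "\<phi>1 e = \<phi>1 e'" by blast
  have "e' \<in> edges F n" using e'(1) red_sub[OF v] by blast
  then have "e = e'" using eq1[OF e(1)] e'(2) by blast
  then show "f \<in> \<phi>1 ` red_edges F n" using e e' by (simp add: red_edges_def)
next
  fix f assume "f \<in> \<phi>1 ` red_edges F n"
  then obtain e where e: "e \<in> edges F n" "e \<in> red F (rng F e)" "f = \<phi>1 e" by (auto simp: red_edges_def)
  then show "f \<in> red_edges G n" using redG[OF rng_edge[OF e(1)]] rngG[OF e(1)]
    by (auto simp: red_edges_def E)
qed

lemma in_edges_G:
  assumes v: "v \<in> verts F n"
  shows "in_edges G (\<phi>0 v) = \<phi>1 ` in_edges F v"
proof (intro equalityI subsetI)
  fix f assume "f \<in> in_edges G (\<phi>0 v)"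
  then obtain k e where e: "e \<in> edges F k" "f = \<phi>1 e" "rng G (\<phi>1 e) = \<phi>0 v"
    unfolding in_edges_def E by blast
  then have "rng F e = v" using eq0[OF rng_edge[OF e(1)] v] rngG[OF e(1)] by simp
  then show "f \<in> \<phi>1 ` in_edges F v" using e by (auto simp: in_edges_def)
next
  fix f assume "f \<in> \<phi>1 ` in_edges F v"
  then obtain e k where "e \<in> edges F k" "rng F e = v" "f = \<phi>1 e" by (auto simp: in_edges_def)
  then show "f \<in> in_edges G (\<phi>0 v)" using rngG by (auto simp: in_edges_def E)
qed

lemma image_disjoint0: "A \<subseteq> verts F n \<Longrightarrow> B \<subseteq> verts F k \<Longrightarrow> A \<inter> B = {} \<Longrightarrow> \<phi>0 ` A \<inter> \<phi>0 ` B = {}"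
  using inj_on_image_Int[OF inj0, of A B] by blast

lemma image_disjoint1: "A \<subseteq> edges F n \<Longrightarrow> B \<subseteq> edges F k \<Longrightarrow> A \<inter> B = {} \<Longrightarrow> \<phi>1 ` A \<inter> \<phi>1 ` B = {}"
  using inj_on_image_Int[OF inj1, of A B] by blast

lemma bratteli_G: "separated_bratteli G"
  unfolding separated_bratteli_def
proof (intro conjI allI ballI)
  fix n
  show "finite (verts G n)" "verts G n \<noteq> {}" using V finite_verts verts_nonempty by auto
  have "edges F n \<noteq> {}" using bratteli by (simp add: separated_bratteli_def)
  then show "finite (edges G n)" "edges G n \<noteq> {}" using E finite_edges by auto
  have ri: "rng G ` \<phi>1 ` edges F n = \<phi>0 ` rng F ` edges F n"
    unfolding image_image by (rule image_cong[OF refl]) (rule rngG)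
  have "rng F ` edges F n = verts F n" "src F ` edges F n = verts F (Suc n)"
    using bratteli by (simp_all add: separated_bratteli_def)
  then show "rng G ` edges G n = verts G n" "src G ` edges G n = verts G (Suc n)"
    unfolding E V ri src_image[OF order_refl] by simp_all
next
  show "disjoint_family (verts G)" unfolding disjoint_family_on_def V
  proof (intro ballI impI)
    fix m n :: nat assume "m \<noteq> n"
    then have "verts F m \<inter> verts F n = {}" using verts_level by blast
    then show "\<phi>0 ` verts F m \<inter> \<phi>0 ` verts F n = {}" by (rule image_disjoint0[OF order_refl order_refl])
  qed
  show "disjoint_family (edges G)" unfolding disjoint_family_on_def E
  proof (intro ballI impI)
    fix m n :: nat assume "m \<noteq> n"
    then have "edges F m \<inter> edges F n = {}" using edges_level by blast
    then show "\<phi>1 ` edges F m \<inter> \<phi>1 ` edges F n = {}" by (rule image_disjoint1[OF order_refl order_refl])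
  qed
  fix w assume "w \<in> (\<Union>n. verts G n)"
  then obtain n v where v: "v \<in> verts F n" "w = \<phi>0 v" unfolding V by blast
  have "inj_on \<phi>1 (in_edges F v)"
    using inj1 by (rule inj_on_subset) (auto simp: in_edges_def)
  moreover have "(`) \<phi>1 ` sep F v - {{}} = (`) \<phi>1 ` sep F v"
    using partition_onD3[OF sep_partition[OF v(1)]] by auto
  ultimately have "partition_on (\<phi>1 ` in_edges F v) ((`) \<phi>1 ` sep F v)"
    using partition_on_inj_image[OF sep_partition[OF v(1)], of \<phi>1] by simp
  then show "partition_on (in_edges G w) (sep G w)" using in_edges_G[OF v(1)] sepG[OF v(1)] v(2) by simp
qed

lemma red_fibre_G:
  assumes v: "v \<in> verts F (2*j + 1)"
  shows "{f \<in> red_edges G (2*j). src G f = \<phi>0 v} = \<phi>1 ` {f \<in> red_edges F (2*j). src F f = v}"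
proof -
  have "src G (\<phi>1 f) = \<phi>0 v \<longleftrightarrow> src F f = v" if f: "f \<in> red_edges F (2*j)" for f
  proof -
    have "src F f \<in> verts F (2*j + 1)" using src_edge[OF red_edge[OF f]] by simp
    then show ?thesis using srcG[OF red_edge[OF f]] eq0 v by simp
  qed
  then show ?thesis unfolding red_edges_G by blast
qed

lemma colours_G: "l_colours G"
  unfolding l_colours_def
proof (intro conjI allI ballI)
  fix n w assume "w \<in> verts G n"
  then obtain v where v: "v \<in> verts F n" "w = \<phi>0 v" unfolding V by blast
  show "blue G w \<inter> red G w = {}" unfolding v(2) blueG[OF v(1)] redG[OF v(1)]
    by (rule image_disjoint1[OF blue_sub[OF v(1)] red_sub[OF v(1)] blue_red_disjoint[OF v(1)]])
next
  fix j w assume "w \<in> verts G (2*j)"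
  then obtain v where v: "v \<in> verts F (2*j)" "w = \<phi>0 v" unfolding V by blast
  show "sep G w = {blue G w, red G w}" unfolding v(2) blueG[OF v(1)] redG[OF v(1)] sepG[OF v(1)]
    sep_even[OF v(1)]
    by simp
next
  fix j w assume "w \<in> verts G (2*j + 1)"
  then obtain v where v: "v \<in> verts F (2*j + 1)" "w = \<phi>0 v" unfolding V by blast
  have im: "redof G ` \<phi>1 ` {f \<in> red_edges F (2*j). src F f = v} = (`) \<phi>1 ` redof F ` {f \<in>
    red_edges F (2*j). src F f = v}"
    unfolding image_image by (rule image_cong) (use redofG in auto)
  show "sep G w = insert (blue G w) (redof G ` {f \<in> red_edges G (2*j). src G f = w})"
    unfolding v(2) red_fibre_G[OF v(1)] blueG[OF v(1)] sepG[OF v(1)] sep_odd[OF v(1)] im by simp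
  have "red G w = \<phi>1 ` (\<Union>(redof F ` {f \<in> red_edges F (2*j). src F f = v}))"
    unfolding v(2) redG[OF v(1)] by (simp only: red_odd[OF v(1)])
  also have "\<dots> = \<Union> ((`) \<phi>1 ` redof F ` {f \<in> red_edges F (2*j). src F f = v})" by (rule image_Union)
  finally show "red G w = (\<Union>f \<in> {f \<in> red_edges G (2*j). src G f = w}. redof G f)"
    unfolding v(2) red_fibre_G[OF v(1)] im .
qed

lemma src_blue_G: "v \<in> verts F n \<Longrightarrow> src G ` blue G (\<phi>0 v) = \<phi>0 ` src F ` blue F v"
  using blueG[of v n] src_image[OF blue_sub[of v n]] by simp

lemma src_red_G: "v \<in> verts F n \<Longrightarrow> src G ` red G (\<phi>0 v) = \<phi>0 ` src F ` red F v"
  using redG[of v n] src_image[OF red_sub[of v n]] by simp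

lemma src_sub: "A \<subseteq> edges F n \<Longrightarrow> src F ` A \<subseteq> verts F (Suc n)"
  using src_edge by blast

lemma disjoint_family_G:
  assumes "disjoint_family_on (\<lambda>v. src F ` A v) I"
    and "\<And>v. v \<in> I \<Longrightarrow> A v \<subseteq> edges F n" "\<And>v. v \<in> I \<Longrightarrow> B (\<psi> v) = \<phi>0 ` src F ` A v"
  shows "disjoint_family_on B (\<psi> ` I)"
  unfolding disjoint_family_on_def
proof (intro ballI impI)
  fix a b assume ab: "a \<in> \<psi> ` I" "b \<in> \<psi> ` I" "a \<noteq> b"
  then obtain v w where vw: "v \<in> I" "w \<in> I" "a = \<psi> v" "b = \<psi> w" "v \<noteq> w" by blast
  have "src F ` A v \<inter> src F ` A w = {}" using assms(1) vw by (simp add: disjoint_family_on_def)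
  then show "B a \<inter> B b = {}"
    unfolding vw(3,4) assms(3)[OF vw(1)] assms(3)[OF vw(2)]
    by (rule image_disjoint0[OF src_sub[OF assms(2)[OF vw(1)]] src_sub[OF assms(2)[OF vw(2)]]])
qed

lemma UN_src_G:
  assumes "\<And>v. v \<in> I \<Longrightarrow> B (\<psi> v) = \<phi>0 ` C v"
  shows "(\<Union>w \<in> \<psi> ` I. B w) = \<phi>0 ` (\<Union>v \<in> I. C v)"
  using assms by auto

lemma inj_src_G:
  assumes "inj_on (src F) A" "A \<subseteq> edges F n"
  shows "inj_on (src G) (\<phi>1 ` A)"
proof (rule inj_onI)
  fix a b assume "a \<in> \<phi>1 ` A" "b \<in> \<phi>1 ` A" "src G a = src G b"
  then obtain e e' where e: "e \<in> A" "e' \<in> A" "a = \<phi>1 e" "b = \<phi>1 e'" "src G (\<phi>1 e) = src G (\<phi>1 e')"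
    by blast
  have "e \<in> edges F n" "e' \<in> edges F n" using e assms(2) by blast+
  then have "src F e = src F e'" using e(5) srcG eq0[OF src_edge src_edge] by metis
  then show "a = b" using inj_onD[OF assms(1)] e by blast
qed

lemma evens_G: "l_even_level_sources G"
  unfolding l_even_level_sources_def
proof (intro allI conjI ballI)
  fix j
  show "disjoint_family_on (\<lambda>v. src G ` blue G v) (verts G (2*j + 1))"
    unfolding V by (rule disjoint_family_G[OF blue_sources_disjoint]) (use blue_sub src_blue_G in auto)
  show "disjoint_family_on (\<lambda>v. src G ` red G v) (verts G (2*j + 1))"
    unfolding V by (rule disjoint_family_G[OF red_sources_disjoint]) (use red_sub src_red_G in auto)
  show "verts G (2*j + 2) = (\<Union>v \<in> verts G (2*j + 1). src G ` blue G v)"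
    unfolding V blue_sources_cover[of j] by (rule UN_src_G[symmetric]) (rule src_blue_G)
  show "verts G (2*j + 2) = (\<Union>v \<in> verts G (2*j + 1). src G ` red G v)"
    unfolding V red_sources_cover[of j] by (rule UN_src_G[symmetric]) (rule src_red_G)
  fix w assume "w \<in> verts G (2*j + 1)"
  then obtain v where v: "v \<in> verts F (2*j + 1)" "w = \<phi>0 v" unfolding V by blast
  show "inj_on (src G) (blue G w)" "inj_on (src G) (red G w)"
    unfolding v(2) blueG[OF v(1)] redG[OF v(1)]
    using inj_src_G sources_inj[THEN bspec, OF v(1)] blue_sub[OF v(1)] red_sub[OF v(1)] by blast+
qed

lemma firsts_G: "l_first_level_sources G"
  unfolding l_first_level_sources_def
proof (intro allI conjI ballI impI)
  have f: "disjoint_family_on (\<lambda>v. src F ` blue F v) (verts F 0)"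
    "verts F 1 = (\<Union>v \<in> verts F 0. src F ` blue F v)" "verts F 1 = (\<Union>v \<in> verts F 0. src F ` red F v)"
    using firsts unfolding l_first_level_sources_def by metis+
  show "disjoint_family_on (\<lambda>v. src G ` blue G v) (verts G 0)"
    unfolding V by (rule disjoint_family_G[OF f(1)]) (use blue_sub src_blue_G in auto)
  show "verts G 1 = (\<Union>v \<in> verts G 0. src G ` blue G v)"
    unfolding V f(2) by (rule UN_src_G[symmetric]) (rule src_blue_G)
  show "verts G 1 = (\<Union>v \<in> verts G 0. src G ` red G v)"
    unfolding V f(3) by (rule UN_src_G[symmetric]) (rule src_red_G)
  fix j w1 w2 a b
  assume w: "w1 \<in> verts G (2*j)" "w2 \<in> verts G (2*j)" "a \<in> blue G w1" "b \<in> blue G w2" "a \<noteq> b"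
  obtain v1 v2 where v: "v1 \<in> verts F (2*j)" "w1 = \<phi>0 v1" "v2 \<in> verts F (2*j)" "w2 = \<phi>0 v2"
    using w(1,2) unfolding V by blast
  obtain e e' where e: "e \<in> blue F v1" "a = \<phi>1 e" "e' \<in> blue F v2" "b = \<phi>1 e'"
    using w(3,4) unfolding v(2,4) blueG[OF v(1)] blueG[OF v(3)] by blast
  have ee: "e \<in> blue_edges F (2*j)" "e' \<in> blue_edges F (2*j)" using e v by (simp_all add: blue_iff)
  have "src F e \<noteq> src F e'" using blue_from_eqI[OF ee(1)] blue_from_eqI[OF ee(2)] w(5) e(2,4) by metis
  then show "src G a \<noteq> src G b"
    unfolding e(2,4) srcG[OF blue_edge[OF ee(1)]] srcG[OF blue_edge[OF ee(2)]]
    using eq0[OF src_edge[OF blue_edge[OF ee(1)]] src_edge[OF blue_edge[OF ee(2)]]] by blast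
qed

lemma two_step_G: "l_two_step_sources G"
  unfolding l_two_step_sources_def
proof (intro allI ballI conjI)
  fix j w assume "w \<in> verts G (2*j)"
  then obtain v where v: "v \<in> verts F (2*j)" "w = \<phi>0 v" unfolding V by blast
  note ts = two_step[unfolded l_two_step_sources_def, THEN spec, THEN bspec, OF v(1)]
  have be: "src F e \<in> verts F (2*j + 1)" "src G (\<phi>1 e) = \<phi>0 (src F e)" if "e \<in> blue F v" for e
    using that blue_sub[OF v(1)] src_edge srcG by fastforce+
  have b: "src G ` blue G (src G (\<phi>1 e)) = \<phi>0 ` src F ` blue F (src F e)" if "e \<in> blue F v" for e
    using be[OF that] src_blue_G by simp
  have re: "f \<in> red_edges F (2*j)" if "f \<in> red F v" for f using that v(1) by (simp add: red_iff)
  have r: "src G ` redof G (\<phi>1 f) = \<phi>0 ` src F ` redof F f" if "f \<in> red F v" for f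
    using redofG[OF re[OF that]] src_image[OF redof_sub[OF re[OF that]]] by simp
  show "disjoint_family_on (\<lambda>e. src G ` blue G (src G e)) (blue G w)"
    unfolding v(2) blueG[OF v(1)]
    by (rule disjoint_family_G[where n = "2*j + 1",
      OF ts[THEN conjunct1]]) (use b blue_sub[OF be(1)] in auto)
  show "disjoint_family_on (\<lambda>f. src G ` redof G f) (red G w)"
    unfolding v(2) redG[OF v(1)]
    by (rule disjoint_family_G[where n = "2*j + 1", OF ts[THEN conjunct2, THEN conjunct1]])
      (use r redof_sub[OF re] in auto)
  have "(\<Union>e \<in> blue G w. src G ` blue G (src G e)) = \<phi>0 ` (\<Union>e \<in> blue F v. src F ` blue F (src F e))"
    unfolding v(2) blueG[OF v(1)] by (rule UN_src_G) (rule b)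
  also have "\<dots> = \<phi>0 ` (\<Union>f \<in> red F v. src F ` redof F f)" using ts by simp
  also have "\<dots> = (\<Union>f \<in> red G w. src G ` redof G f)"
    unfolding v(2) redG[OF v(1)] by (rule UN_src_G[symmetric]) (rule r)
  finally show "(\<Union>e \<in> blue G w. src G ` blue G (src G e)) = (\<Union>f \<in> red G w. src G ` redof G f)" .
qed

lemma red_to_blue_G: "l_red_to_blue G"
  unfolding l_red_to_blue_def
proof (intro allI ballI)
  fix j w a0 a1 assume w: "w \<in> verts G (2*j + 1)" and a: "a0 \<in> red G w" "a1 \<in> red G (src G a0)"
  obtain v where v: "v \<in> verts F (2*j + 1)" "w = \<phi>0 v" using w unfolding V by blast
  obtain f0 where f0: "f0 \<in> red F v" "a0 = \<phi>1 f0" using a(1) unfolding v(2) redG[OF v(1)] by blast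
  have f0e: "f0 \<in> edges F (2*j + 1)" using red_sub[OF v(1)] f0(1) by blast
  have u: "src F f0 \<in> verts F (2*j + 2)" using src_edge[OF f0e] by simp
  obtain f1 where f1: "f1 \<in> red F (src F f0)" "a1 = \<phi>1 f1"
    using a(2) unfolding f0(2) srcG[OF f0e] redG[OF u] by blast
  have f1e: "f1 \<in> edges F (2*j + 2)" using red_sub[OF u] f1(1) by blast
  have ex1: "\<exists>!p. fst p \<in> blue F v \<and> snd p \<in> blue F (src F (fst p)) \<and> src F (snd p) = src F f1"
    using red_to_blue[unfolded l_red_to_blue_def, THEN spec, THEN bspec, OF v(1), THEN bspec,
      OF f0(1), THEN bspec, OF f1(1)] .
  have *: "\<phi>1 e0 \<in> blue G w \<and> \<phi>1 e1 \<in> blue G (src G (\<phi>1 e0)) \<and> src G (\<phi>1 e1) = src G a1"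
    if "e0 \<in> blue F v" "e1 \<in> blue F (src F e0)" "src F e1 = src F f1" for e0 e1
  proof -
    have e0: "e0 \<in> edges F (2*j + 1)" using blue_sub[OF v(1)] that by blast
    have u': "src F e0 \<in> verts F (2*j + 2)" using src_edge[OF e0] by simp
    have e1: "e1 \<in> edges F (2*j + 2)" using blue_sub[OF u'] that by blast
    show ?thesis unfolding v(2) blueG[OF v(1)] srcG[OF e0] blueG[OF u'] srcG[OF e1] f1(2) srcG[OF f1e]
      using that by simp
  qed
  show "\<exists>!p. fst p \<in> blue G w \<and> snd p \<in> blue G (src G (fst p)) \<and> src G (snd p) = src G a1"
  proof (rule ex1_pair_image[OF ex1, where \<phi> = \<phi>1])
    fix p q assume p: "p \<in> blue G w \<and> q \<in> blue G (src G p) \<and> src G q = src G a1"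
    obtain e0 where e0: "e0 \<in> blue F v" "p = \<phi>1 e0" using p unfolding v(2) blueG[OF v(1)] by blast
    have e0e: "e0 \<in> edges F (2*j + 1)" using blue_sub[OF v(1)] e0 by blast
    have u': "src F e0 \<in> verts F (2*j + 2)" using src_edge[OF e0e] by simp
    obtain e1 where e1: "e1 \<in> blue F (src F e0)" "q = \<phi>1 e1"
      using p unfolding e0(2) srcG[OF e0e] blueG[OF u'] by blast
    have e1e: "e1 \<in> edges F (2*j + 2)" using blue_sub[OF u'] e1 by blast
    have "src F e1 = src F f1"
      using p eq0[OF src_edge[OF e1e] src_edge[OF f1e]]
      unfolding e1(2) f1(2) srcG[OF e1e] srcG[OF f1e] by blast
    then show "\<exists>a b. p = \<phi>1 a \<and> q = \<phi>1 b \<and> a \<in> blue F v \<and> b \<in> blue F (src F a) \<and> src F b = src F f1"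
      using e0 e1 by blast
  qed (use * in blast)
qed

lemma blue_to_red_G: "l_blue_to_red G"
  unfolding l_blue_to_red_def
proof (intro allI ballI impI)
  fix j w c a0 a1 assume w: "w \<in> verts G (2*j + 1)" and c: "c \<in> red_edges G (2*j)" "src G c = w"
    and a: "a0 \<in> blue G w" "a1 \<in> blue G (src G a0)"
  obtain v where v: "v \<in> verts F (2*j + 1)" "w = \<phi>0 v" using w unfolding V by blast
  obtain g where g: "g \<in> red_edges F (2*j)" "c = \<phi>1 g" "src F g = v"
    using c red_fibre_G[OF v(1)] v(2) by blast
  obtain f0 where f0: "f0 \<in> blue F v" "a0 = \<phi>1 f0" using a(1) unfolding v(2) blueG[OF v(1)] by blast
  have f0e: "f0 \<in> edges F (2*j + 1)" using blue_sub[OF v(1)] f0(1) by blast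
  have u: "src F f0 \<in> verts F (2*j + 2)" using src_edge[OF f0e] by simp
  obtain f1 where f1: "f1 \<in> blue F (src F f0)" "a1 = \<phi>1 f1"
    using a(2) unfolding f0(2) srcG[OF f0e] blueG[OF u] by blast
  have f1e: "f1 \<in> edges F (2*j + 2)" using blue_sub[OF u] f1(1) by blast
  have ex1: "\<exists>!p. fst p \<in> redof F g \<and> rng F (fst p) = v \<and> snd p \<in> red F (src F (fst p)) \<and>
    src F (snd p) = src F f1"
    using blue_to_red[unfolded l_blue_to_red_def, THEN spec, THEN bspec, OF v(1), THEN bspec,
      OF g(1), THEN mp, OF g(3),
        THEN bspec, OF f0(1), THEN bspec, OF f1(1)] .
  have *: "\<phi>1 e0 \<in> redof G c \<and> rng G (\<phi>1 e0) = w \<and> \<phi>1 e1 \<in> red G (src G (\<phi>1 e0)) \<and>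
    src G (\<phi>1 e1) = src G a1"
    if "e0 \<in> redof F g" "rng F e0 = v" "e1 \<in> red F (src F e0)" "src F e1 = src F f1" for e0 e1
  proof -
    have e0: "e0 \<in> edges F (2*j + 1)" using redof_sub[OF g(1)] that by blast
    have u': "src F e0 \<in> verts F (2*j + 2)" using src_edge[OF e0] by simp
    have e1: "e1 \<in> edges F (2*j + 2)" using red_sub[OF u'] that by blast
    show ?thesis unfolding v(2) g(2) redofG[OF g(1)] rngG[OF e0] srcG[OF e0] redG[OF u']
      srcG[OF e1] f1(2) srcG[OF f1e]
      using that by simp
  qed
  show "\<exists>!p. fst p \<in> redof G c \<and> rng G (fst p) = w \<and> snd p \<in> red G (src G (fst p)) \<and>
    src G (snd p) = src G a1"
  proof (rule ex1_pair_image[OF ex1, where \<phi> = \<phi>1])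
    fix p q assume p: "p \<in> redof G c \<and> rng G p = w \<and> q \<in> red G (src G p) \<and> src G q = src G a1"
    obtain e0 where e0: "e0 \<in> redof F g" "p = \<phi>1 e0" using p unfolding g(2) redofG[OF g(1)] by blast
    have r: "rng F e0 = v" using redof_odd(2)[OF g(1) e0(1)] g(3) by simp
    have e0e: "e0 \<in> edges F (2*j + 1)" using redof_sub[OF g(1)] e0 by blast
    have u': "src F e0 \<in> verts F (2*j + 2)" using src_edge[OF e0e] by simp
    obtain e1 where e1: "e1 \<in> red F (src F e0)" "q = \<phi>1 e1"
      using p unfolding e0(2) srcG[OF e0e] redG[OF u'] by blast
    have e1e: "e1 \<in> edges F (2*j + 2)" using red_sub[OF u'] e1 by blast
    have "src F e1 = src F f1"
      using p eq0[OF src_edge[OF e1e] src_edge[OF f1e]]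
      unfolding e1(2) f1(2) srcG[OF e1e] srcG[OF f1e] by blast
    then show "\<exists>a b. p = \<phi>1 a \<and> q = \<phi>1 b \<and>
        a \<in> redof F g \<and> rng F a = v \<and> b \<in> red F (src F a) \<and> src F b = src F f1"
      using e0 e1 r by blast
  qed (use * in auto)
qed

theorem relabelled_LDiag: "G \<in> LDiag"
  unfolding LDiag_def
  using bratteli_G colours_G evens_G firsts_G two_step_G red_to_blue_G blue_to_red_G by simp

theorem relabelled_iso: "ldiag_iso F G"
  unfolding ldiag_iso_def
proof (intro exI[of _ \<phi>0] exI[of _ \<phi>1] conjI allI ballI)
  show "bij_betw \<phi>0 (\<Union>n. verts F n) (\<Union>n. verts G n)" using inj0 V by (auto simp: bij_betw_def)
  show "bij_betw \<phi>1 (\<Union>n. edges F n) (\<Union>n. edges G n)" using inj1 E by (auto simp: bij_betw_def)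
qed (use V E rngG srcG sepG blueG redG redofG in auto)

end

text \<open>The levels are finite, so there are countably many vertices and edges.\<close>

theorem ldiag_nat_copy:
  assumes F: "F \<in> LDiag"
  shows "\<exists>G :: (nat, nat) cdiagram. G \<in> LDiag \<and> ldiag_iso F G"
proof -
  interpret l_diagram F by (rule l_diagram.intro[OF F])
  let ?V = "\<Union>n. verts F n" and ?E = "\<Union>n. edges F n"
  have "countable ?V" "countable ?E" using finite_verts finite_edges by (auto intro: countable_finite)
  then obtain \<phi>0 :: "_ \<Rightarrow> nat" and \<phi>1 :: "_ \<Rightarrow> nat" where inj: "inj_on \<phi>0 ?V" "inj_on \<phi>1 ?E"
    unfolding countable_def by blast
  let ?i = "inv_into ?V \<phi>0" and ?k = "inv_into ?E \<phi>1"
  define G where "G = \<lparr>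
     verts = (\<lambda>n. \<phi>0 ` verts F n), edges = (\<lambda>n. \<phi>1 ` edges F n),
     rng = (\<lambda>e. \<phi>0 (rng F (?k e))), src = (\<lambda>e. \<phi>0 (src F (?k e))),
     sep = (\<lambda>v. (`) \<phi>1 ` sep F (?i v)), blue = (\<lambda>v. \<phi>1 ` blue F (?i v)),
     red = (\<lambda>v. \<phi>1 ` red F (?i v)), redof = (\<lambda>f. \<phi>1 ` redof F (?k f))\<rparr>"
  have i: "?i (\<phi>0 v) = v" if "v \<in> verts F n" for v n using inv_into_f_f[OF inj(1), of v] that by blast
  have k: "?k (\<phi>1 e) = e" if "e \<in> edges F n" for e n using inv_into_f_f[OF inj(2), of e] that by blast
  interpret R: ldiag_relabelling F G \<phi>0 \<phi>1
    by unfold_locales (use inj i k k[OF red_edge] in \<open>simp_all add: G_def\<close>)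
  show ?thesis using R.relabelled_LDiag R.relabelled_iso by blast
qed

text \<open>The part of the structure that is evident for a contraction as well as for an \<open>l\<close>-diagram.  It
  is enough to build isomorphisms, and so a contraction can be compared with an \<open>l\<close>-diagram before it
  is known to be one.\<close>

definition coloured_diagram :: "('v, 'e) cdiagram \<Rightarrow> bool" where
  "coloured_diagram K \<longleftrightarrow>
     disjoint_family (verts K) \<and> disjoint_family (edges K) \<and>
     (\<forall>n. \<forall>e \<in> edges K n. rng K e \<in> verts K n \<and> src K e \<in> verts K (Suc n)) \<and>
     (\<forall>n. edges K n = blue_edges K n \<union> red_edges K n \<and> blue_edges K n \<inter> red_edges K n = {}) \<and>
     (\<forall>n. \<forall>v \<in> verts K n. blue K v = {e \<in> blue_edges K n. rng K e = v} \<and>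
        red K v = {e \<in> red_edges K n. rng K e = v}) \<and>
     (\<forall>j. \<forall>v \<in> verts K (2*j). sep K v = {blue K v, red K v}) \<and>
     (\<forall>j. \<forall>v \<in> verts K (2*j + 1).
        sep K v = insert (blue K v) (redof K ` {f \<in> red_edges K (2*j). src K f = v})) \<and>
     (\<forall>j. \<forall>f \<in> red_edges K (2*j). redof K f \<subseteq> red_edges K (2*j + 1))"

lemma (in l_diagram) coloured: "coloured_diagram F"
  unfolding coloured_diagram_def
proof (intro conjI allI ballI)
  show "disjoint_family (verts F)" "disjoint_family (edges F)"
    using bratteli by (simp_all add: separated_bratteli_def)
  fix n
  show "edges F n = blue_edges F n \<union> red_edges F n" by (rule edges_coloured)
  show "blue_edges F n \<inter> red_edges F n = {}" using red_not_blue by blast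
  show "rng F e \<in> verts F n" "src F e \<in> verts F (Suc n)" if "e \<in> edges F n" for e
    using rng_edge[OF that] src_edge[OF that] .
  show "blue F v = {e \<in> blue_edges F n. rng F e = v}" "red F v = {e \<in> red_edges F n. rng F e = v}"
    if "v \<in> verts F n" for v
    using blue_iff[OF that] red_iff[OF that] by auto
next
  show "sep F v = {blue F v, red F v}" if "v \<in> verts F (2*j)" for j v using sep_even[OF that] .
  show "sep F v = insert (blue F v) (redof F ` {f \<in> red_edges F (2*j). src F f = v})"
    if "v \<in> verts F (2*j + 1)" for j v using sep_odd[OF that] .
  show "redof F f \<subseteq> red_edges F (2*j + 1)" if "f \<in> red_edges F (2*j)" for j f
    using redof_odd(1)[OF that] by blast
qed

lemma coloured_diagramD:
  assumes "coloured_diagram K"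
  shows "v \<in> verts K n \<Longrightarrow> v \<in> verts K k \<Longrightarrow> n = k"
    and "e \<in> edges K n \<Longrightarrow> e \<in> edges K k \<Longrightarrow> n = k"
    and "e \<in> edges K n \<Longrightarrow> rng K e \<in> verts K n"
    and "e \<in> edges K n \<Longrightarrow> src K e \<in> verts K (Suc n)"
    and "edges K n = blue_edges K n \<union> red_edges K n" and "blue_edges K n \<inter> red_edges K n = {}"
    and "v \<in> verts K n \<Longrightarrow> blue K v = {e \<in> blue_edges K n. rng K e = v}"
    and "v \<in> verts K n \<Longrightarrow> red K v = {e \<in> red_edges K n. rng K e = v}"
    and "v \<in> verts K (2*j) \<Longrightarrow> sep K v = {blue K v, red K v}"
    and "v \<in> verts K (2*j + 1) \<Longrightarrow> sep K v = insert (blue K v) (redof K ` {f \<in>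
      red_edges K (2*j). src K f = v})"
    and "f \<in> red_edges K (2*j) \<Longrightarrow> redof K f \<subseteq> red_edges K (2*j + 1)"
proof -
  note c = assms[unfolded coloured_diagram_def]
  show "v \<in> verts K n \<Longrightarrow> v \<in> verts K k \<Longrightarrow> n = k"
    using c[THEN conjunct1] unfolding disjoint_family_on_def by blast
  show "e \<in> edges K n \<Longrightarrow> e \<in> edges K k \<Longrightarrow> n = k"
    using c[THEN conjunct2, THEN conjunct1] unfolding disjoint_family_on_def by blast
  show "e \<in> edges K n \<Longrightarrow> rng K e \<in> verts K n" "e \<in> edges K n \<Longrightarrow> src K e \<in> verts K (Suc n)"
    using c[THEN conjunct2, THEN conjunct2, THEN conjunct1] by blast+
  show "edges K n = blue_edges K n \<union> red_edges K n" "blue_edges K n \<inter> red_edges K n = {}"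
    using c[THEN conjunct2, THEN conjunct2, THEN conjunct2, THEN conjunct1] by simp_all
  show "v \<in> verts K n \<Longrightarrow> blue K v = {e \<in> blue_edges K n. rng K e = v}"
    "v \<in> verts K n \<Longrightarrow> red K v = {e \<in> red_edges K n. rng K e = v}"
    using c[THEN conjunct2, THEN conjunct2, THEN conjunct2, THEN conjunct2, THEN conjunct1] by simp_all
  show "v \<in> verts K (2*j) \<Longrightarrow> sep K v = {blue K v, red K v}"
    using c[THEN conjunct2, THEN conjunct2, THEN conjunct2, THEN conjunct2, THEN conjunct2,
      THEN conjunct1] by simp
  show "v \<in> verts K (2*j + 1) \<Longrightarrow> sep K v = insert (blue K v) (redof K ` {f \<in>
    red_edges K (2*j). src K f = v})"
    using c[THEN conjunct2, THEN conjunct2, THEN conjunct2, THEN conjunct2, THEN conjunct2,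
      THEN conjunct2, THEN conjunct1] by simp
  show "f \<in> red_edges K (2*j) \<Longrightarrow> redof K f \<subseteq> red_edges K (2*j + 1)"
    using c[THEN conjunct2, THEN conjunct2, THEN conjunct2, THEN conjunct2, THEN conjunct2,
      THEN conjunct2, THEN conjunct2] by simp
qed

text \<open>The maps may be given level by level and colour by colour, since levels and colours are
  disjoint; the separations are determined by the colours and by \<open>R(f)\<close>.\<close>

lemma ldiag_isoI:
  assumes K: "coloured_diagram K" and L: "coloured_diagram L"
    and V: "\<And>n. bij_betw (\<phi>0 n) (verts K n) (verts L n)"
    and B: "\<And>n. bij_betw (\<phi>B n) (blue_edges K n) (blue_edges L n)"
    and R: "\<And>n. bij_betw (\<phi>R n) (red_edges K n) (red_edges L n)"
    and Be: "\<And>n e. e \<in> blue_edges K n \<Longrightarrow> rng L (\<phi>B n e) = \<phi>0 n (rng K e) \<and>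
      src L (\<phi>B n e) = \<phi>0 (Suc n) (src K e)"
    and Re: "\<And>n e. e \<in> red_edges K n \<Longrightarrow> rng L (\<phi>R n e) = \<phi>0 n (rng K e) \<and>
      src L (\<phi>R n e) = \<phi>0 (Suc n) (src K e)"
    and ro: "\<And>j f. f \<in> red_edges K (2*j) \<Longrightarrow> \<phi>R (2*j + 1) ` redof K f = redof L (\<phi>R (2*j) f)"
  shows "ldiag_iso K L"
proof -
  note k = coloured_diagramD[OF K] and l = coloured_diagramD[OF L]
  define \<psi>0 where "\<psi>0 v = \<phi>0 (THE n. v \<in> verts K n) v" for v
  define \<psi>1 where "\<psi>1 e = (let n = THE n. e \<in> edges K n in if e \<in>
    blue_edges K n then \<phi>B n e else \<phi>R n e)" for e
  have p0: "\<psi>0 v = \<phi>0 n v" if "v \<in> verts K n" for v n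
  proof -
    have "(THE n. v \<in> verts K n) = n" by (rule the_equality) (use that k(1) in \<open>simp_all\<close>)
    then show ?thesis by (simp add: \<psi>0_def)
  qed
  have the1: "(THE n. e \<in> edges K n) = n" if "e \<in> edges K n" for e n
    by (rule the_equality) (use that k(2) in \<open>simp_all\<close>)
  have pB: "\<psi>1 e = \<phi>B n e" if "e \<in> blue_edges K n" for e n
    using that the1[of e n] k(5)[of n] by (auto simp: \<psi>1_def)
  have pR: "\<psi>1 e = \<phi>R n e" if "e \<in> red_edges K n" for e n
    using that the1[of e n] k(5)[of n] k(6)[of n] by (auto simp: \<psi>1_def)
  have iV: "\<psi>0 ` verts K n = verts L n" for n using V[of n] p0 by (force simp: bij_betw_def)
  have iB: "\<psi>1 ` blue_edges K n = blue_edges L n" for n using B[of n] pB by (force simp: bij_betw_def)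
  have iR: "\<psi>1 ` red_edges K n = red_edges L n" for n using R[of n] pR by (force simp: bij_betw_def)
  have iE: "\<psi>1 ` edges K n = edges L n" for n unfolding k(5) l(5) image_Un iB iR ..
  have e: "rng L (\<psi>1 e) = \<psi>0 (rng K e) \<and> src L (\<psi>1 e) = \<psi>0 (src K e)" if "e \<in> edges K n" for e n
  proof -
    have "\<psi>0 (rng K e) = \<phi>0 n (rng K e)" "\<psi>0 (src K e) = \<phi>0 (Suc n) (src K e)"
      using p0 k(3)[OF that] k(4)[OF that] by blast+
    moreover have "e \<in> blue_edges K n \<or> e \<in> red_edges K n" using that k(5)[of n] by blast
    ultimately show ?thesis using pB pR Be Re by metis
  qed
  have inj0: "inj_on \<psi>0 (\<Union>n. verts K n)"
  proof (rule inj_onI)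
    fix v w assume "v \<in> (\<Union>n. verts K n)" "w \<in> (\<Union>n. verts K n)" and eq: "\<psi>0 v = \<psi>0 w"
    then obtain n n' where n: "v \<in> verts K n" "w \<in> verts K n'" by blast
    have "\<psi>0 v \<in> verts L n" "\<psi>0 w \<in> verts L n'" using n iV by blast+
    then have "n = n'" using l(1) eq by simp
    then show "v = w" using n eq p0 V[of n] by (metis bij_betw_imp_inj_on inj_onD)
  qed
  have inj1: "inj_on \<psi>1 (\<Union>n. edges K n)"
  proof (rule inj_onI)
    fix v w assume "v \<in> (\<Union>n. edges K n)" "w \<in> (\<Union>n. edges K n)" and eq: "\<psi>1 v = \<psi>1 w"
    then obtain n n' where n: "v \<in> edges K n" "w \<in> edges K n'" by blast
    have "\<psi>1 v \<in> edges L n" "\<psi>1 w \<in> edges L n'" using n iE by blast+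
    then have nn: "n = n'" using l(2) eq by simp
    have cases: "(v \<in> blue_edges K n \<and> w \<in> blue_edges K n) \<or> (v \<in> red_edges K n \<and> w \<in> red_edges K n)"
    proof (rule ccontr)
      assume "\<not> ?thesis"
      then have "(v \<in> blue_edges K n \<and> w \<in> red_edges K n) \<or> (v \<in> red_edges K n \<and> w \<in> blue_edges K n)"
        using n nn k(5)[of n] by blast
      then have "\<psi>1 v \<in> blue_edges L n \<inter> red_edges L n" using eq iB[of n] iR[of n]
        by (metis IntI imageI)
      then show False using l(6) by blast
    qed
    then show "v = w" using eq pB pR B[of n] R[of n] by (metis bij_betw_imp_inj_on inj_onD)
  qed
  have fib: "\<psi>1 ` {e \<in> S. rng K e = v} = {e \<in> \<psi>1 ` S. rng L e = \<psi>0 v}"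
    if v: "v \<in> verts K n" and S: "S \<subseteq> edges K n" for S v n
  proof -
    have "rng L (\<psi>1 e) = \<psi>0 v \<longleftrightarrow> rng K e = v" if "e \<in> S" for e
    proof -
      have en: "e \<in> edges K n" using S that by blast
      have "rng K e \<in> (\<Union>n. verts K n)" "v \<in> (\<Union>n. verts K n)" using k(3)[OF en] v by blast+
      then show ?thesis using e[OF en] inj_on_eq_iff[OF inj0] by simp
    qed
    then show ?thesis by blast
  qed
  have bl: "\<psi>1 ` blue K v = blue L (\<psi>0 v)" and rd: "\<psi>1 ` red K v = red L (\<psi>0 v)"
    if v: "v \<in> verts K n" for v n
  proof -
    have w: "\<psi>0 v \<in> verts L n" using iV v by blast
    have "blue_edges K n \<subseteq> edges K n" "red_edges K n \<subseteq> edges K n" using k(5)[of n] by blast+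
    then show "\<psi>1 ` blue K v = blue L (\<psi>0 v)" "\<psi>1 ` red K v = red L (\<psi>0 v)"
      unfolding k(7)[OF v] k(8)[OF v] l(7)[OF w] l(8)[OF w] using fib[OF v] iB iR by simp_all
  qed
  have ro': "\<psi>1 ` redof K f = redof L (\<psi>1 f)" if f: "f \<in> red_edges K (2*j)" for f j
  proof -
    have "\<psi>1 ` redof K f = \<phi>R (2*j + 1) ` redof K f"
      by (rule image_cong[OF refl]) (use pR k(11)[OF f] in blast)
    then show ?thesis using ro[OF f] pR[OF f] by simp
  qed
  have sp: "(`) \<psi>1 ` sep K v = sep L (\<psi>0 v)" if v: "v \<in> verts K n" for v n
  proof (cases "even n")
    case True
    then obtain j where "n = 2*j" by blast
    then have vj: "v \<in> verts K (2*j)" "\<psi>0 v \<in> verts L (2*j)" using v iV by blast+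
    show ?thesis unfolding k(9)[OF vj(1)] l(9)[OF vj(2)] using bl[OF v] rd[OF v] by simp
  next
    case False
    then obtain j where "n = 2*j + 1" using oddE by blast
    then have vj: "v \<in> verts K (2*j + 1)" "\<psi>0 v \<in> verts L (2*j + 1)" using v iV by blast+
    have sub: "f \<in> edges K (2*j)" if "f \<in> red_edges K (2*j)" for f using that k(5)[of "2*j"] by blast
    have "src L (\<psi>1 f) = \<psi>0 v \<longleftrightarrow> src K f = v" if "f \<in> red_edges K (2*j)" for f
    proof -
      have "src K f \<in> (\<Union>n. verts K n)" "v \<in> (\<Union>n. verts K n)" using k(4)[OF sub[OF that]] v by blast+
      then show ?thesis using e[OF sub[OF that]] inj_on_eq_iff[OF inj0] by simp
    qed
    then have fs: "{f \<in> red_edges L (2*j). src L f = \<psi>0 v} = \<psi>1 ` {f \<in> red_edges K (2*j). src K f = v}"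
      unfolding iR[of "2*j", symmetric] by auto
    have "(`) \<psi>1 ` redof K ` {f \<in> red_edges K (2*j). src K f = v} = redof L ` \<psi>1 ` {f \<in>
      red_edges K (2*j). src K f = v}"
      unfolding image_image by (rule image_cong) (use ro' in auto)
    then show ?thesis unfolding k(10)[OF vj(1)] l(10)[OF vj(2)] fs using bl[OF v] by simp
  qed
  show ?thesis unfolding ldiag_iso_def
  proof (intro exI[of _ \<psi>0] exI[of _ \<psi>1] conjI allI ballI)
    show "bij_betw \<psi>0 (\<Union>n. verts K n) (\<Union>n. verts L n)" using inj0
      by (simp add: bij_betw_def image_UN iV)
    show "bij_betw \<psi>1 (\<Union>n. edges K n) (\<Union>n. edges L n)" using inj1
      by (simp add: bij_betw_def image_UN iE)
    fix n show "\<psi>0 ` verts K n = verts L n" "\<psi>1 ` edges K n = edges L n" by (rule iV, rule iE)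
  next
    fix d assume "d \<in> (\<Union>n. edges K n)"
    then show "rng L (\<psi>1 d) = \<psi>0 (rng K d)" "src L (\<psi>1 d) = \<psi>0 (src K d)" using e by auto
  next
    fix v assume "v \<in> (\<Union>n. verts K n)"
    then obtain n where v: "v \<in> verts K n" by blast
    show "(`) \<psi>1 ` sep K v = sep L (\<psi>0 v)" "\<psi>1 ` blue K v = blue L (\<psi>0 v)"
      by (rule sp[OF v], rule bl[OF v])
  next
    fix j v assume "v \<in> verts K (2*j)"
    then show "\<psi>1 ` red K v = red L (\<psi>0 v)" by (rule rd)
  next
    fix j f assume "f \<in> red_edges K (2*j)"
    then show "\<psi>1 ` redof K f = redof L (\<psi>1 f)" by (rule ro')
  qed
qed

text \<open>The two bijections behind \<^const>\<open>ldiag_iso\<close> get a name because the conjugacy that they induce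
  is needed explicitly, to follow the cells of a partition through it.\<close>

definition ldiag_map :: "('v, 'e) cdiagram \<Rightarrow> ('w, 'f) cdiagram \<Rightarrow> ('v \<Rightarrow> 'w) \<Rightarrow> ('e \<Rightarrow> 'f) \<Rightarrow> bool" where
  "ldiag_map F G \<phi>0 \<phi>1 \<longleftrightarrow>
     bij_betw \<phi>0 (\<Union>n. verts F n) (\<Union>n. verts G n) \<and>
     bij_betw \<phi>1 (\<Union>n. edges F n) (\<Union>n. edges G n) \<and>
     (\<forall>n. \<phi>0 ` verts F n = verts G n \<and> \<phi>1 ` edges F n = edges G n) \<and>
     (\<forall>e \<in> (\<Union>n. edges F n). rng G (\<phi>1 e) = \<phi>0 (rng F e) \<and> src G (\<phi>1 e) = \<phi>0 (src F e)) \<and>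
     (\<forall>v \<in> (\<Union>n. verts F n). (`) \<phi>1 ` sep F v = sep G (\<phi>0 v) \<and>
        \<phi>1 ` blue F v = blue G (\<phi>0 v)) \<and>
     (\<forall>j. \<forall>v \<in> verts F (2*j). \<phi>1 ` red F v = red G (\<phi>0 v)) \<and>
     (\<forall>j. \<forall>f \<in> red_edges F (2*j). \<phi>1 ` redof F f = redof G (\<phi>1 f))"

lemma ldiag_iso_map: "ldiag_iso F G \<longleftrightarrow> (\<exists>\<phi>0 \<phi>1. ldiag_map F G \<phi>0 \<phi>1)"
  by (simp only: ldiag_iso_def ldiag_map_def)

lemma ldiag_mapD:
  assumes "ldiag_map F G \<phi>0 \<phi>1"
  shows "bij_betw \<phi>0 (\<Union>n. verts F n) (\<Union>n. verts G n)"
     "bij_betw \<phi>1 (\<Union>n. edges F n) (\<Union>n. edges G n)"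
     "\<phi>0 ` verts F n = verts G n" "\<phi>1 ` edges F n = edges G n"
     "e \<in> edges F n \<Longrightarrow> rng G (\<phi>1 e) = \<phi>0 (rng F e)"
     "e \<in> edges F n \<Longrightarrow> src G (\<phi>1 e) = \<phi>0 (src F e)"
     "v \<in> verts F n \<Longrightarrow> (`) \<phi>1 ` sep F v = sep G (\<phi>0 v)"
     "v \<in> verts F n \<Longrightarrow> \<phi>1 ` blue F v = blue G (\<phi>0 v)"
     "v \<in> verts F (2*j) \<Longrightarrow> \<phi>1 ` red F v = red G (\<phi>0 v)"
     "f \<in> red_edges F (2*j) \<Longrightarrow> \<phi>1 ` redof F f = redof G (\<phi>1 f)"
  using assms unfolding ldiag_map_def by auto

lemma ldiag_iso_trans:
  assumes F: "\<And>n e. e \<in> edges F n \<Longrightarrow> rng F e \<in> verts F n" and FG: "ldiag_iso F G" and GH: "ldiag_iso G H"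
  shows "ldiag_iso F H"
proof -
  obtain \<phi>0 \<phi>1 where "ldiag_map F G \<phi>0 \<phi>1" using FG unfolding ldiag_iso_map by blast
  note p = ldiag_mapD[OF this]
  obtain \<psi>0 \<psi>1 where "ldiag_map G H \<psi>0 \<psi>1" using GH unfolding ldiag_iso_map by blast
  note q = ldiag_mapD[OF this]
  have v: "\<phi>0 v \<in> verts G n" if "v \<in> verts F n" for v n using p(3) that by blast
  have e: "\<phi>1 e \<in> edges G n" if "e \<in> edges F n" for e n using p(4) that by blast
  have r: "\<phi>1 f \<in> red_edges G (2*j)" if f: "f \<in> red_edges F (2*j)" for f j
  proof -
    have fe: "f \<in> edges F (2*j)" "f \<in> red F (rng F f)" using f by (auto simp: red_edges_def)
    have "\<phi>1 f \<in> red G (rng G (\<phi>1 f))" using p(9)[OF F[OF fe(1)]] p(5)[OF fe(1)] fe(2) by auto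
    then show ?thesis using e[OF fe(1)] by (simp add: red_edges_def)
  qed
  show ?thesis unfolding ldiag_iso_def
  proof (intro exI[of _ "\<psi>0 \<circ> \<phi>0"] exI[of _ "\<psi>1 \<circ> \<phi>1"] conjI allI ballI)
    show "bij_betw (\<psi>0 \<circ> \<phi>0) (\<Union>n. verts F n) (\<Union>n. verts H n)" using bij_betw_trans[OF p(1) q(1)] .
    show "bij_betw (\<psi>1 \<circ> \<phi>1) (\<Union>n. edges F n) (\<Union>n. edges H n)" using bij_betw_trans[OF p(2) q(2)] .
    fix n show "(\<psi>0 \<circ> \<phi>0) ` verts F n = verts H n" "(\<psi>1 \<circ> \<phi>1) ` edges F n = edges H n"
      by (simp_all only: image_comp[symmetric] p(3,4) q(3,4))
  next
    fix d assume "d \<in> (\<Union>n. edges F n)"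
    then obtain n where d: "d \<in> edges F n" by blast
    show "rng H ((\<psi>1 \<circ> \<phi>1) d) = (\<psi>0 \<circ> \<phi>0) (rng F d)" "src H ((\<psi>1 \<circ> \<phi>1) d) = (\<psi>0 \<circ> \<phi>0) (src F d)"
      using p(5,6)[OF d] q(5,6)[OF e[OF d]] by simp_all
  next
    fix w assume "w \<in> (\<Union>n. verts F n)"
    then obtain n where w: "w \<in> verts F n" by blast
    show "(\<psi>1 \<circ> \<phi>1) ` blue F w = blue H ((\<psi>0 \<circ> \<phi>0) w)"
      by (simp only: image_comp[symmetric] o_apply p(8)[OF w] q(8)[OF v[OF w]])
    have "(`) (\<psi>1 \<circ> \<phi>1) ` sep F w = (`) \<psi>1 ` (`) \<phi>1 ` sep F w"
      by (simp add: image_image image_comp comp_def)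
    then show "(`) (\<psi>1 \<circ> \<phi>1) ` sep F w = sep H ((\<psi>0 \<circ> \<phi>0) w)"
      using p(7)[OF w] q(7)[OF v[OF w]] by simp
  next
    fix j w assume w: "w \<in> verts F (2*j)"
    show "(\<psi>1 \<circ> \<phi>1) ` red F w = red H ((\<psi>0 \<circ> \<phi>0) w)"
      by (simp only: image_comp[symmetric] o_apply p(9)[OF w] q(9)[OF v[OF w]])
  next
    fix j f assume f: "f \<in> red_edges F (2*j)"
    show "(\<psi>1 \<circ> \<phi>1) ` redof F f = redof H ((\<psi>1 \<circ> \<phi>1) f)"
      by (simp only: image_comp[symmetric] o_apply p(10)[OF f] q(10)[OF r[OF f]])
  qed
qed

section \<open>Contractions\<close>

definition segment :: "(nat \<Rightarrow> 'e) \<Rightarrow> nat \<Rightarrow> nat \<Rightarrow> 'e list" where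
  "segment x a b = map x [a..<b]"

lemma segment_simps:
  "length (segment x a b) = b - a" "i < b - a \<Longrightarrow> segment x a b ! i = x (a + i)"
  by (simp_all add: segment_def)

lemma segment_ends:
  assumes "a < b"
  shows "segment x a b \<noteq> []" "hd (segment x a b) = x a" "last (segment x a b) = x (b - 1)"
proof -
  show "segment x a b \<noteq> []" "hd (segment x a b) = x a"
    using assms by (simp_all add: segment_def hd_map)
  have "segment x a b \<noteq> []" using assms by (simp add: segment_def)
  then show "last (segment x a b) = x (b - 1)"
    using assms by (simp add: segment_def last_map last_upt)
qed

lemma contraction_levels_mono:
  assumes "contraction_levels m"
  shows "strict_mono m" "even (m n) \<longleftrightarrow> even n"
proof -
  show "strict_mono m" using assms by (simp add: strict_mono_Suc_iff contraction_levels_def)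
  show "even (m n) \<longleftrightarrow> even n"
  proof (induction n)
    case (Suc n)
    have "m n < m (Suc n)" "odd (m (Suc n) - m n)" using assms by (simp_all add: contraction_levels_def)
    then show ?case using Suc by auto
  qed (use assms in \<open>simp add: contraction_levels_def\<close>)
qed

context l_diagram
begin

lemma segment_blue_path:
  assumes "x \<in> blue_rays F"
  shows "segment x a b \<in> blue_paths F a b"
  using ray_edge[OF assms] ray_src[OF assms] by (simp add: blue_paths_def segment_simps)

lemma segment_red_path:
  assumes x: "x \<in> blue_rays F"
  shows "segment (red_ray F x) a b \<in> red_paths F a b"
  unfolding red_paths_def
proof (intro CollectI conjI allI impI)
  fix i assume "Suc i < b - a" "even (a + i)"
  moreover from this obtain j where "a + i = 2*j" by blast
  ultimately show "segment (red_ray F x) a b ! Suc i \<in> redof F (segment (red_ray F x) a b ! i)"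
    using red_ray_redof[OF x, of j] by (simp add: segment_simps)
qed (use red_ray_edge[OF x] red_ray_link[OF x] in \<open>simp_all add: segment_simps\<close>)

text \<open>The last edge of a path determines the whole path, because a vertex determines the blue edge
  leaving it; so a ray through the last source runs along the path.\<close>

lemma blue_path_segment:
  assumes p: "p \<in> blue_paths F a b" and ab: "a < b"
  shows "\<exists>x \<in> blue_rays F. p = segment x a b"
proof -
  have len: "length p = b - a" and ed: "\<And>i. i < b - a \<Longrightarrow> p ! i \<in> blue_edges F (a + i)"
    and ln: "\<And>i. Suc i < b - a \<Longrightarrow> src F (p ! i) = rng F (p ! Suc i)"
    using p by (auto simp: blue_paths_def)
  have l: "p ! (b - a - 1) \<in> blue_edges F (b - 1)" using ed[of "b - a - 1"] ab by simp
  then have "src F (p ! (b - a - 1)) \<in> verts F b" using src_edge[OF blue_edge[OF l]] ab by simp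
  then obtain x where x: "x \<in> blue_rays F" "rng F (x b) = src F (p ! (b - a - 1))"
    using ray_through by blast
  \<comment> \<open>Induction from the last edge backwards.\<close>
  have *: "i < b - a \<Longrightarrow> p ! (b - a - 1 - i) = x (b - 1 - i)" for i
  proof (induction i)
    case 0
    then show ?case using blue_from_eqI[OF l] ray_blue_from[OF x(1), of "b - 1"] x(2) ab by simp
  next
    case (Suc i)
    let ?k = "b - a - 1 - Suc i"
    have k: "Suc ?k = b - a - 1 - i" "Suc ?k < b - a" "Suc (a + ?k) = b - 1 - i"
      "a + ?k = b - 1 - Suc i" using Suc.prems by auto
    have "src F (p ! ?k) = rng F (x (Suc (a + ?k)))" using ln[OF k(2)] Suc.IH Suc.prems k(1,3) by simp
    then have "p ! ?k = x (a + ?k)" using blue_from_eqI[OF ed[of ?k]] ray_blue_from[OF x(1),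
      of "a + ?k"] k(2) by simp
    then show ?case using k(4) by simp
  qed
  have "p ! i = x (a + i)" if "i < b - a" for i
    using *[of "b - a - 1 - i"] that by (simp add: algebra_simps)
  then have "p = segment x a b" using len by (intro nth_equalityI) (simp_all add: segment_simps)
  then show ?thesis using x(1) by blast
qed

lemma red_edge_on_ray:
  assumes f: "f \<in> red_edges F n"
  shows "\<exists>x \<in> blue_rays F. red_ray F x n = f"
proof (cases "even n")
  case True
  then obtain j where n: "n = 2*j" by blast
  have f': "f \<in> red_edges F (2*j)" using f n by simp
  then have "src F f \<in> verts F (2*j + 1)" using src_edge[OF red_edge] by fastforce
  then obtain y where "y \<in> blue_rays F" "rng F (y (2*j + 1)) = src F f" using ray_through by blast
  then show ?thesis using shift_lift[OF f'] n by blast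
next
  case False
  then obtain j where n: "n = 2*j + 1" using oddE by blast
  have f': "f \<in> red_edges F (2*j + 1)" using f n by simp
  then have "src F f \<in> verts F (2*j + 2)" using src_edge[OF red_edge] by fastforce
  then obtain x where x: "x \<in> blue_rays F" "rng F (x (2*j + 2)) = src F f" using ray_through by blast
  have "red_ray F x n = f" using red_ray_odd[OF x(1), of j] red_from_eqI[OF f'] x(2) n by simp
  then show ?thesis using x(1) by blast
qed

text \<open>The same backward determinism: at an even level a red edge is determined by the next one through
  \<open>redof_unique\<close>, at an odd level by its source.\<close>

lemma red_path_segment:
  assumes p: "p \<in> red_paths F a b" and ab: "a < b"
  shows "\<exists>x \<in> blue_rays F. p = segment (red_ray F x) a b"
proof -
  have len: "length p = b - a" and ed: "\<And>i. i < b - a \<Longrightarrow> p ! i \<in> red_edges F (a + i)"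
    and ln: "\<And>i. Suc i < b - a \<Longrightarrow> src F (p ! i) = rng F (p ! Suc i)"
    and ro: "\<And>i. Suc i < b - a \<Longrightarrow> even (a + i) \<Longrightarrow> p ! Suc i \<in> redof F (p ! i)"
    using p by (auto simp: red_paths_def)
  have l: "p ! (b - a - 1) \<in> red_edges F (b - 1)" using ed[of "b - a - 1"] ab by simp
  then obtain x where x: "x \<in> blue_rays F" "red_ray F x (b - 1) = p ! (b - a - 1)"
    using red_edge_on_ray by blast
  have *: "i < b - a \<Longrightarrow> p ! (b - a - 1 - i) = red_ray F x (b - 1 - i)" for i
  proof (induction i)
    case 0
    then show ?case using x(2) by simp
  next
    case (Suc i)
    let ?k = "b - a - 1 - Suc i"
    have k: "Suc ?k = b - a - 1 - i" "Suc ?k < b - a" "Suc (a + ?k) = b - 1 - i"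
      "a + ?k = b - 1 - Suc i" "?k < b - a"
      using Suc.prems by auto
    have IH: "p ! Suc ?k = red_ray F x (Suc (a + ?k))" using Suc k(1,3) by simp
    have "p ! ?k = red_ray F x (a + ?k)"
    proof (cases "even (a + ?k)")
      case True
      then obtain j where j: "a + ?k = 2*j" by blast
      have "p ! ?k \<in> red_edges F (2*j)" using ed[OF k(5)] j by simp
      moreover have "red_ray F x (2*j + 1) \<in> redof F (p ! ?k)" using ro[OF k(2) True] IH j by simp
      ultimately show ?thesis using redof_unique[OF _ _ red_ray_edge[OF x(1), of "2*j"]
        red_ray_redof[OF x(1), of j]] j by simp
    next
      case False
      then obtain j where j: "a + ?k = 2*j + 1" using oddE by blast
      have "p ! ?k \<in> red_edges F (2*j + 1)" using ed[OF k(5)] j by simp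
      moreover have "src F (p ! ?k) = src F (red_ray F x (a + ?k))"
        using ln[OF k(2)] IH red_ray_link[OF x(1), of "a + ?k"] by simp
      ultimately show ?thesis using red_from_eqI red_from_eqI[of "red_ray F x (2*j + 1)" j]
        red_ray_edge[OF x(1), of "2*j + 1"] j by metis
    qed
    then show ?case using k(4) by simp
  qed
  have "p ! i = red_ray F x (a + i)" if "i < b - a" for i
    using *[of "b - a - 1 - i"] that by (simp add: algebra_simps)
  then have "p = segment (red_ray F x) a b" using len
    by (intro nth_equalityI) (simp_all add: segment_simps)
  then show ?thesis using x(1) by blast
qed

end

locale contracted_diagram = l_diagram F for F :: "('v, 'e) cdiagram" +
  fixes m :: "nat \<Rightarrow> nat"
  assumes levels: "contraction_levels m"
begin

abbreviation "K \<equiv> contraction F m"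

lemma m_less: "m n < m (Suc n)" and m_even: "even (m n) \<longleftrightarrow> even n"
  and m_inj: "m n = m k \<longleftrightarrow> n = k"
  using contraction_levels_mono[OF levels] by (auto simp: strict_mono_Suc_iff strict_mono_eq)

lemma m_even_half: "\<exists>i. m (2*j) = 2*i" and m_odd_half: "\<exists>i. m (2*j + 1) = 2*i + 1"
  using m_even[of "2*j"] m_even[of "2*j + 1"] by (auto elim!: oddE evenE)

lemma contraction_fields [simp]:
  "verts K n = verts F (m n)"
  "edges K n = blue_paths F (m n) (m (Suc n)) \<union> red_paths F (m n) (m (Suc n))"
  "rng K p = rng F (hd p)" "src K p = src F (last p)"
  "blue K = contr_blue F m" "red K = contr_red F m" "redof K = contr_redof F m"
  by (simp_all add: contraction_def)

lemma blue_path_ends: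
  assumes "p \<in> blue_paths F (m n) (m (Suc n))"
  shows "hd p \<in> blue_edges F (m n)" "src F (last p) \<in> verts F (m (Suc n))"
proof -
  obtain x where x: "x \<in> blue_rays F" "p = segment x (m n) (m (Suc n))"
    using blue_path_segment[OF assms m_less] by blast
  show "hd p \<in> blue_edges F (m n)" using segment_ends[OF m_less] ray_edge[OF x(1)] x(2) by metis
  show "src F (last p) \<in> verts F (m (Suc n))"
    using segment_ends(3)[OF m_less, of x n] src_edge[OF blue_edge[OF ray_edge[OF x(1)]],
      of "m (Suc n) - 1"] x(2) m_less[of n] by simp
qed

lemma red_path_ends:
  assumes "p \<in> red_paths F (m n) (m (Suc n))"
  shows "hd p \<in> red_edges F (m n)" "src F (last p) \<in> verts F (m (Suc n))"
    "last p \<in> red_edges F (m (Suc n) - 1)"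
proof -
  obtain x where x: "x \<in> blue_rays F" "p = segment (red_ray F x) (m n) (m (Suc n))"
    using red_path_segment[OF assms m_less] by blast
  show "hd p \<in> red_edges F (m n)" using segment_ends[OF m_less] red_ray_edge[OF x(1)] x(2) by metis
  show l: "last p \<in> red_edges F (m (Suc n) - 1)"
    using segment_ends(3)[OF m_less] red_ray_edge[OF x(1)] x(2) by metis
  show "src F (last p) \<in> verts F (m (Suc n))" using src_edge[OF red_edge[OF l]] m_less[of n] by simp
qed

lemma blue_path_level:
  "p \<in> blue_paths F (m n) (m (Suc n)) \<Longrightarrow> rng F (hd p) \<in> verts F (m k) \<Longrightarrow> n = k"
  using edge_level[OF blue_edge[OF blue_path_ends(1)]] m_inj by metis

lemma red_path_level:
  "p \<in> red_paths F (m n) (m (Suc n)) \<Longrightarrow> rng F (hd p) \<in> verts F (m k) \<Longrightarrow> n = k"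
  using edge_level[OF red_edge[OF red_path_ends(1)]] m_inj by metis

lemma contr_blue_level:
  "v \<in> verts F (m n) \<Longrightarrow> contr_blue F m v = {p \<in> blue_paths F (m n) (m (Suc n)). rng F (hd p) = v}"
  unfolding contr_blue_def using blue_path_level by blast

lemma contr_red_level:
  "v \<in> verts F (m n) \<Longrightarrow> contr_red F m v = {p \<in> red_paths F (m n) (m (Suc n)). rng F (hd p) = v}"
  unfolding contr_red_def using red_path_level by blast

lemma paths_disjoint: "blue_paths F (m n) (m (Suc n)) \<inter> red_paths F (m n') (m (Suc n')) = {}"
  using blue_path_ends(1) red_path_ends(1) red_not_blue by blast

lemma path_rng:
  assumes "p \<in> blue_paths F (m n) (m (Suc n)) \<union> red_paths F (m n) (m (Suc n))"
  shows "rng F (hd p) \<in> verts F (m n)"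
  using assms rng_edge[OF blue_edge[OF blue_path_ends(1)]]
    rng_edge[OF red_edge[OF red_path_ends(1)]] by blast

lemma blue_edges_K: "blue_edges K n = blue_paths F (m n) (m (Suc n))"
proof -
  have "p \<in> contr_blue F m (rng F (hd p)) \<longleftrightarrow> p \<in> blue_paths F (m n) (m (Suc n))" if "p \<in> edges K n" for p
    using contr_blue_level[OF path_rng, of p n] that by simp
  then show ?thesis unfolding blue_edges_def by auto
qed

lemma red_edges_K: "red_edges K n = red_paths F (m n) (m (Suc n))"
proof -
  have "p \<in> contr_red F m (rng F (hd p)) \<longleftrightarrow> p \<in> red_paths F (m n) (m (Suc n))" if "p \<in> edges K n" for p
    using contr_red_level[OF path_rng, of p n] that by simp
  then show ?thesis unfolding red_edges_def by auto
qed

lemma contr_redof_iff: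
  assumes "f \<in> red_paths F (m (2*j)) (m (2*j + 1))"
  shows "g \<in> contr_redof F m f \<longleftrightarrow> g \<in> red_paths F (m (2*j + 1)) (m (2*j + 2)) \<and> hd g \<in> redof F (last f)"
proof
  assume "g \<in> contr_redof F m f"
  then obtain i where i: "f \<in> red_paths F (m (2*i)) (m (2*i + 1))"
    "g \<in> red_paths F (m (2*i + 1)) (m (2*i + 2))" "hd g \<in> redof F (last f)"
    unfolding contr_redof_def by blast
  have "2*i = 2*j" using red_path_level[of f "2*i" "2*j"] path_rng[of f "2*j"] i(1) assms by simp
  then show "g \<in> red_paths F (m (2*j + 1)) (m (2*j + 2)) \<and> hd g \<in> redof F (last f)" using i by simp
qed (use assms in \<open>auto simp: contr_redof_def\<close>)

theorem coloured_K: "coloured_diagram K"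
  unfolding coloured_diagram_def
proof (intro conjI allI ballI)
  show "disjoint_family (verts K)" unfolding disjoint_family_on_def using verts_level m_inj by fastforce
  show "disjoint_family (edges K)" unfolding disjoint_family_on_def
  proof (intro ballI impI)
    fix k n :: nat assume "k \<noteq> n"
    then have "m k \<noteq> m n" using m_inj by simp
    then show "edges K k \<inter> edges K n = {}"
      using verts_level path_rng[of _ k] path_rng[of _ n] unfolding contraction_fields by blast
  qed
  fix n
  show "edges K n = blue_edges K n \<union> red_edges K n" unfolding blue_edges_K red_edges_K by simp
  show "blue_edges K n \<inter> red_edges K n = {}" unfolding blue_edges_K red_edges_K by (rule paths_disjoint)
  show "rng K e \<in> verts K n" "src K e \<in> verts K (Suc n)" if "e \<in> edges K n" for e
    using that path_rng[of e n] blue_path_ends(2)[of e n] red_path_ends(2)[of e n] by auto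
  show "blue K v = {e \<in> blue_edges K n. rng K e = v}" "red K v = {e \<in> red_edges K n. rng K e = v}"
    if "v \<in> verts K n" for v
    unfolding blue_edges_K red_edges_K using contr_blue_level contr_red_level that by simp_all
next
  fix j v assume "v \<in> verts K (2*j)"
  then show "sep K v = {blue K v, red K v}" by (auto simp: contraction_def)
next
  fix j v assume v: "v \<in> verts K (2*j + 1)"
  have "\<not> (\<exists>i. v \<in> verts F (m (2*i)))"
  proof
    assume "\<exists>i. v \<in> verts F (m (2*i))"
    then obtain i where "v \<in> verts F (m (2*i))" by blast
    then have "m (2*i) = m (2*j + 1)" using verts_level[of v "m (2*i)" "m (2*j + 1)"] v by simp
    then show False using m_even[of "2*i"] m_even[of "2*j + 1"] by simp
  qed
  moreover have "{f. \<exists>i. f \<in> red_paths F (m (2*i)) (m (2*i + 1)) \<and>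
    src F (last f) = v} = {f \<in> red_edges K (2*j). src K f = v}"
  proof -
    have "i = j" if "f \<in> red_paths F (m (2*i)) (m (2*i + 1))" "src F (last f) = v" for f i
    proof -
      have "v \<in> verts F (m (2*i + 1))" using red_path_ends(2)[of f "2*i"] that by simp
      then have "m (2*i + 1) = m (2*j + 1)" using verts_level v by simp
      then show ?thesis using m_inj[of "2*i + 1" "2*j + 1"] by simp
    qed
    then show ?thesis unfolding red_edges_K by auto
  qed
  ultimately show "sep K v = insert (blue K v) (redof K ` {f \<in> red_edges K (2*j). src K f = v})"
    by (simp add: contraction_def)
next
  fix j f assume "f \<in> red_edges K (2*j)"
  then show "redof K f \<subseteq> red_edges K (2*j + 1)" unfolding red_edges_K using contr_redof_iff[of f j]
    by auto
qed

end

section \<open>Isomorphisms and contractions preserve the ray system\<close>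

text \<open>The common form of the conjugacies induced by an isomorphism, where \<open>m n = n\<close>, and by a
  contraction to the levels \<open>m n\<close>: the map \<open>h\<close> of rays is given by a bijection \<open>\<phi>\<close> of vertices.  That
  it commutes with the shift only needs some witness.\<close>

lemma ray_map_conj:
  assumes F: "F \<in> LDiag" and G: "G \<in> LDiag" and m: "strict_mono m"
    and inj: "\<And>n. inj_on \<phi> (verts F (m n))" and onto: "\<And>n. \<phi> ` verts F (m n) = verts G n"
    and edge: "\<And>x n. x \<in> blue_rays F \<Longrightarrow> h x n \<in> blue_edges G n"
    and rng: "\<And>x n. x \<in> blue_rays F \<Longrightarrow> rng G (h x n) = \<phi> (rng F (x (m n)))"
    and src: "\<And>x n. x \<in> blue_rays F \<Longrightarrow> src G (h x n) = \<phi> (rng F (x (m (Suc n))))"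
    and wit: "\<And>x. x \<in> blue_rays F \<Longrightarrow> \<exists>r. shift_witness G (h x) (h (ray_shift F x)) r"
  shows "homeomorphic_map (ray_topology F) (ray_topology G) h"
    and "x \<in> blue_rays F \<Longrightarrow> h (ray_shift F x) = ray_shift G (h x)"
proof -
  interpret F: l_diagram F by (rule l_diagram.intro[OF F])
  interpret G: l_diagram G by (rule l_diagram.intro[OF G])
  have ray: "h x \<in> blue_rays G" if "x \<in> blue_rays F" for x
    unfolding blue_rays_def using edge rng src that by simp
  have eq: "rng F (x (m n)) = rng F (x' (m n))"
    if "x \<in> blue_rays F" "x' \<in> blue_rays F" "rng G (h x n) = rng G (h x' n)" for x x' n
    using inj_onD[OF inj[of n], of "rng F (x (m n))" "rng F (x' (m n))"] F.ray_vertex rng that by simp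
  show "homeomorphic_map (ray_topology F) (ray_topology G) h"
  proof (rule continuous_imp_homeomorphic_map[OF _ F.compact_ray_topology G.Hausdorff_ray_topology])
    show "continuous_map (ray_topology F) (ray_topology G) h"
    proof (rule G.ray_continuousI)
      show "h x \<in> blue_rays G" if "x \<in> topspace (ray_topology F)" for x
        using ray that by (simp add: F.topspace_ray_topology)
      fix n v
      have "{x \<in> topspace (ray_topology F). rng G (h x n) = v} = {x \<in>
        blue_rays F. \<phi> (rng F (x (m n))) = v}"
        using rng by (auto simp: F.topspace_ray_topology)
      then show "openin (ray_topology F) {x \<in> topspace (ray_topology F). rng G (h x n) = v}"
        using F.clopen_coordinate(1)[of "\<lambda>e. \<phi> (rng F e) = v" "m n"] by simp
    qed
    show "inj_on h (topspace (ray_topology F))"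
    proof (rule inj_onI)
      fix x x' assume "x \<in> topspace (ray_topology F)" "x' \<in> topspace (ray_topology F)"
        and e: "h x = h x'"
      then have x: "x \<in> blue_rays F" "x' \<in> blue_rays F" by (simp_all add: F.topspace_ray_topology)
      show "x = x'"
      proof (rule F.ray_eqI[OF x])
        fix k
        have "k < m (Suc k)" using strict_mono_imp_increasing[OF m, of "Suc k"] by simp
        moreover have "rng F (x (m (Suc k))) = rng F (x' (m (Suc k)))" using eq[OF x] e by simp
        ultimately show "\<exists>n>k. rng F (x n) = rng F (x' n)" by blast
      qed
    qed
    have "\<exists>x \<in> blue_rays F. h x = y" if y: "y \<in> blue_rays G" for y
    proof -
      have "\<exists>v. v \<in> verts F (m n) \<and> \<phi> v = rng G (y n)" for n
        using onto[of n] G.ray_vertex[OF y, of n] by (metis imageE)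
      then obtain u where u: "\<And>n. u n \<in> verts F (m n)" "\<And>n. \<phi> (u n) = rng G (y n)" by metis
      have mS: "m n < m (Suc n)" for n using m by (simp add: strict_mono_Suc_iff)
      have "(F.parent ^^ (m (Suc n) - m n)) (u (Suc n)) = u n" for n
      proof -
        obtain x where x: "x \<in> blue_rays F" "rng F (x (m (Suc n))) = u (Suc n)"
          using F.ray_through[OF u(1)] by blast
        have "src G (h x n) = src G (y n)"
          using src[OF x(1), of n] x(2) u(2)[of "Suc n"] G.ray_src[OF y, of n] by simp
        then have "h x n = y n" using G.blue_from_eqI[OF edge[OF x(1)], of n]
          G.blue_from_eqI[OF G.ray_edge[OF y], of n] by metis
        then have "\<phi> (rng F (x (m n))) = \<phi> (u n)" using rng[OF x(1), of n] u(2)[of n] by simp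
        then have "rng F (x (m n)) = u n" using inj_onD[OF inj] F.ray_vertex[OF x(1)] u(1) by blast
        then show ?thesis using F.ray_parent_pow[OF x(1), of "m (Suc n) - m n" "m n"] x(2) mS[of n]
          by simp
      qed
      then obtain x where x: "x \<in> blue_rays F" "\<And>n. rng F (x (m n)) = u n"
        using F.ray_cofinal[of m u] mS u(1) by blast
      have "h x = y"
      proof (rule G.ray_eqI[OF ray[OF x(1)] y])
        fix k have "rng G (h x (Suc k)) = rng G (y (Suc k))" using rng[OF x(1)] x(2) u(2) by simp
        then show "\<exists>n>k. rng G (h x n) = rng G (y n)" by blast
      qed
      then show ?thesis using x(1) by blast
    qed
    then show "h ` topspace (ray_topology F) = topspace (ray_topology G)"
      unfolding F.topspace_ray_topology G.topspace_ray_topology using ray by blast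
  qed
  show "h (ray_shift F x) = ray_shift G (h x)" if "x \<in> blue_rays F"
    using wit[OF that] G.shift_eqI[OF ray[OF that] ray[OF F.ray_shift(1)[OF that]]] by metis
qed

lemma ray_top_conjI:
  assumes "F \<in> LDiag" "homeomorphic_map (ray_topology F) (ray_topology G) h"
    "\<And>x. x \<in> blue_rays F \<Longrightarrow> h (ray_shift F x) = ray_shift G (h x)"
  shows "top_conj (ray_system F) (ray_system G)"
  unfolding top_conj_def ray_system_def
  using assms(2,3) l_diagram.topspace_ray_topology[OF l_diagram.intro[OF assms(1)]]
  by (intro exI[of _ h]) simp

lemma ldiag_map_conj:
  assumes F: "F \<in> LDiag" and G: "G \<in> LDiag" and FG: "ldiag_map F G \<phi>0 \<phi>1"
  shows "homeomorphic_map (ray_topology F) (ray_topology G) (\<lambda>x n. \<phi>1 (x n))"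
    and "x \<in> blue_rays F \<Longrightarrow> (\<lambda>n. \<phi>1 (ray_shift F x n)) = ray_shift G (\<lambda>n. \<phi>1 (x n))"
proof -
  interpret F: l_diagram F by (rule l_diagram.intro[OF F])
  interpret G: l_diagram G by (rule l_diagram.intro[OF G])
  note iso = ldiag_mapD[OF FG]
  note p = bij_betw_imp_inj_on[OF iso(1)] iso(3,5,6,8,9,10)
  have v: "\<phi>0 v \<in> verts G n" if "v \<in> verts F n" for v n using p(2) that by blast
  have b: "\<phi>1 e \<in> blue_edges G n" if e: "e \<in> blue_edges F n" for e n
  proof -
    have r: "rng F e \<in> verts F n" using F.rng_edge[OF F.blue_edge[OF e]] .
    have "\<phi>1 e \<in> blue G (\<phi>0 (rng F e))" using p(5)[OF r] F.blueI[OF e refl] by blast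
    then show ?thesis using G.blue_iff[OF v[OF r]] by blast
  qed
  have r: "\<phi>1 e \<in> red_edges G (2*j)" if e: "e \<in> red_edges F (2*j)" for e j
  proof -
    have r: "rng F e \<in> verts F (2*j)" using F.rng_edge[OF F.red_edge[OF e]] .
    have "\<phi>1 e \<in> red G (\<phi>0 (rng F e))" using p(6)[OF r] F.redI[OF e refl] by blast
    then show ?thesis using G.red_iff[OF v[OF r]] by blast
  qed
  have inj: "inj_on \<phi>0 (verts F n)" for n using p(1) by (rule inj_on_subset) blast
  have bl: "\<phi>1 (x n) \<in> blue_edges G n" "rng G (\<phi>1 (x n)) = \<phi>0 (rng F (x n))"
    "src G (\<phi>1 (x n)) = \<phi>0 (rng F (x (Suc n)))" if x: "x \<in> blue_rays F" for x n
    using b[OF F.ray_edge[OF x]] p(3,4)[OF F.blue_edge[OF F.ray_edge[OF x]]] F.ray_src[OF x] by simp_all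
  have wit: "\<exists>r. shift_witness G (\<lambda>n. \<phi>1 (x n)) (\<lambda>n. \<phi>1 (ray_shift F x n)) r"
    if x: "x \<in> blue_rays F" for x
  proof -
    note xe = F.blue_edge[OF F.ray_edge[OF x]] and re = F.red_edge[OF F.red_ray_edge[OF x]]
    note ye = F.blue_edge[OF F.ray_edge[OF F.ray_shift(1)[OF x]]]
    have "shift_witness G (\<lambda>n. \<phi>1 (x n)) (\<lambda>n. \<phi>1 (ray_shift F x n)) (\<lambda>n. \<phi>1 (red_ray F x n))"
      unfolding shift_witness_def
    proof (intro allI conjI)
      fix j
      show "\<phi>1 (red_ray F x (2*j)) \<in> red_edges G (2*j)" using r[OF F.red_ray_edge[OF x]] .
      show "\<phi>1 (red_ray F x (2*j + 1)) \<in> redof G (\<phi>1 (red_ray F x (2*j)))"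
        using p(7)[OF F.red_ray_edge[OF x]] F.red_ray_redof[OF x, of j] by blast
      show "src G (\<phi>1 (red_ray F x (2*j))) = rng G (\<phi>1 (ray_shift F x (2*j + 1)))"
        unfolding p(4)[OF re] p(3)[OF ye] F.ray_shift_odd[OF x] ..
      show "src G (\<phi>1 (red_ray F x (2*j + 1))) = rng G (\<phi>1 (x (2*j + 2)))"
        unfolding p(4)[OF re] p(3)[OF xe] F.red_ray_src_odd[OF x] ..
    qed
    then show ?thesis by blast
  qed
  have sm: "strict_mono (\<lambda>n::nat. n)" by (simp add: strict_mono_def)
  show "homeomorphic_map (ray_topology F) (ray_topology G) (\<lambda>x n. \<phi>1 (x n))"
    by (rule ray_map_conj(1)[OF F G sm, where \<phi> = \<phi>0]) (rule inj p(2) bl wit | assumption)+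
  show "x \<in> blue_rays F \<Longrightarrow> (\<lambda>n. \<phi>1 (ray_shift F x n)) = ray_shift G (\<lambda>n. \<phi>1 (x n))"
    by (rule ray_map_conj(2)[OF F G sm, where \<phi> = \<phi>0 and h = "\<lambda>x n. \<phi>1 (x n)"])
      (rule inj p(2) bl wit | assumption)+
qed

lemma ray_system_iso:
  assumes F: "F \<in> LDiag" and G: "G \<in> LDiag" and FG: "ldiag_iso F G"
  shows "top_conj (ray_system F) (ray_system G)"
proof -
  obtain \<phi>0 \<phi>1 where "ldiag_map F G \<phi>0 \<phi>1" using FG unfolding ldiag_iso_map by blast
  from ldiag_map_conj[OF F G this] show ?thesis by (rule ray_top_conjI[OF F])
qed

text \<open>A ray is cut into blue paths, and its red ray into red paths, at the levels of the contraction;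
  the pieces of the red ray are the witness for the shift.\<close>

lemma ray_system_contraction:
  assumes F: "F \<in> LDiag" and G: "G \<in> LDiag" and m: "contraction_levels m"
    and FG: "ldiag_iso (contraction F m) G"
  shows "top_conj (ray_system F) (ray_system G)"
proof -
  interpret F: contracted_diagram F m by (intro contracted_diagram.intro l_diagram.intro
    contracted_diagram_axioms.intro F m)
  interpret G: l_diagram G by (rule l_diagram.intro[OF G])
  let ?K = "contraction F m"
  obtain \<phi>0 \<phi>1 where "ldiag_map ?K G \<phi>0 \<phi>1" using FG unfolding ldiag_iso_map by blast
  note iso = ldiag_mapD[OF this]
  note p = bij_betw_imp_inj_on[OF iso(1)] iso(3,5,6,8,9,10)
  note k = coloured_diagramD[OF F.coloured_K]
  have v: "\<phi>0 v \<in> verts G n" if "v \<in> verts ?K n" for v n using p(2) that by blast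
  have b: "\<phi>1 e \<in> blue_edges G n" if e: "e \<in> blue_edges ?K n" for e n
  proof -
    have r: "rng ?K e \<in> verts ?K n" using k(3) k(5)[of n] e by blast
    have "\<phi>1 e \<in> blue G (\<phi>0 (rng ?K e))" using p(5)[OF r] k(7)[OF r] e by blast
    then show ?thesis using G.blue_iff[OF v[OF r]] by blast
  qed
  have r: "\<phi>1 e \<in> red_edges G (2*j)" if e: "e \<in> red_edges ?K (2*j)" for e j
  proof -
    have r: "rng ?K e \<in> verts ?K (2*j)" using k(3) k(5)[of "2*j"] e by blast
    have "\<phi>1 e \<in> red G (\<phi>0 (rng ?K e))" using p(6)[OF r] k(8)[OF r] e by blast
    then show ?thesis using G.red_iff[OF v[OF r]] by blast
  qed
  let ?s = "\<lambda>x n. segment x (m n) (m (Suc n))"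
  have sb: "?s x n \<in> blue_edges ?K n" and eb: "?s x n \<in> edges ?K n" if "x \<in> blue_rays F" for x n
    using F.segment_blue_path[OF that] k(5)[of n] by (auto simp: F.blue_edges_K)
  have sr: "?s (red_ray F x) n \<in> red_edges ?K n" and er: "?s (red_ray F x) n \<in> edges ?K n"
    if "x \<in> blue_rays F" for x n
    using F.segment_red_path[OF that] k(5)[of n] by (auto simp: F.red_edges_K)
  note se = segment_ends[OF F.m_less]
  have inj: "inj_on \<phi>0 (verts F (m n))" for n using p(1) by (rule inj_on_subset) auto
  have onto: "\<phi>0 ` verts F (m n) = verts G n" for n using p(2) by simp
  have rg: "rng G (\<phi>1 (?s x n)) = \<phi>0 (rng F (x (m n)))" if "x \<in> blue_rays F" for x n
      using p(3)[OF eb[OF that], of n] se(2)[of x n] by simp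
  have be: "\<phi>1 (?s x n) \<in> blue_edges G n" if x: "x \<in> blue_rays F" for x n using b[OF sb[OF x]] .
  have sg: "src G (\<phi>1 (?s x n)) = \<phi>0 (rng F (x (m (Suc n))))" if x: "x \<in> blue_rays F" for x n
      using p(4)[OF eb[OF x]] se(3)[of x n] F.ray_src[OF x, of "m (Suc n) - 1"] F.m_less[of n] by simp
  have wit: "\<exists>r. shift_witness G (\<lambda>n. \<phi>1 (?s x n)) (\<lambda>n. \<phi>1 (?s (ray_shift F x) n)) r"
    if x: "x \<in> blue_rays F" for x
  proof -
    have y: "ray_shift F x \<in> blue_rays F" by (rule F.ray_shift(1)[OF x])
    have sc: "src G (\<phi>1 (?s (red_ray F x) n)) = \<phi>0 (src F (red_ray F x (m (Suc n) - 1)))" for n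
      using p(4)[OF er[OF x]] se(3)[of "red_ray F x" n] by simp
    have "shift_witness G (\<lambda>n. \<phi>1 (?s x n)) (\<lambda>n. \<phi>1 (?s (ray_shift F x) n)) (\<lambda>n. \<phi>1 (?s (red_ray F
      x) n))"
      unfolding shift_witness_def
    proof (intro allI conjI)
      fix j
      show "\<phi>1 (?s (red_ray F x) (2*j)) \<in> red_edges G (2*j)" using r[OF sr[OF x]] .
      obtain i where i: "m (2*j + 1) = 2*i + 1" using F.m_odd_half by blast
      have "?s (red_ray F x) (2*j + 1) \<in> redof ?K (?s (red_ray F x) (2*j))"
        using F.contr_redof_iff[of "?s (red_ray F x) (2*j)" j "?s (red_ray F x) (2*j + 1)"]
          sr[OF x, of "2*j"] sr[OF x, of "2*j + 1"] se(2)[of "red_ray F x"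
            "2*j + 1"] se(3)[of "red_ray F x" "2*j"]
          F.red_ray_redof[OF x, of i] i by (simp add: F.red_edges_K)
      then show "\<phi>1 (?s (red_ray F x) (2*j + 1)) \<in> redof G (\<phi>1 (?s (red_ray F x) (2*j)))"
        using p(7)[OF sr[OF x]] by blast
      show "src G (\<phi>1 (?s (red_ray F x) (2*j))) = rng G (\<phi>1 (?s (ray_shift F x) (2*j + 1)))"
        unfolding sc rg[OF y] using F.ray_shift_odd[OF x, of i] i by simp
      obtain i' where i': "m (2*j + 2) = 2*i'" using F.m_even_half[of "j + 1"] by auto
      then have "i' > 0" using F.m_less[of "2*j + 1"] by simp
      then obtain l where l: "i' = Suc l" by (cases i') auto
      then have "m (2*j + 2) = 2*l + 2" using i' by simp
      then show "src G (\<phi>1 (?s (red_ray F x) (2*j + 1))) = rng G (\<phi>1 (?s x (2*j + 2)))"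
        unfolding sc rg[OF x] using F.red_ray_src_odd[OF x, of l] by simp
    qed
    then show ?thesis by blast
  qed
  from ray_map_conj[OF F G contraction_levels_mono(1)[OF m], where \<phi> = \<phi>0 and h = "\<lambda>x n. \<phi>1 (?s x n)",
      OF inj onto be rg sg wit]
  show ?thesis by (rule ray_top_conjI[OF F])
qed


lemma l_rel_conj:
  assumes "(F, G) \<in> l_rel"
  shows "top_conj (ray_system F) (ray_system G)"
proof -
  have F: "F \<in> LDiag" and E: "equivclp l_step F G" using assms by (auto simp: l_rel_def)
  have st: "top_conj (ray_system H) (ray_system H')" if "l_step H H'" for H H'
    using that ray_system_iso ray_system_contraction unfolding l_step_def by blast
  have L: "ray_system H \<in> LHomeo" if "H \<in> LDiag" for H :: "(nat, nat) cdiagram"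
    using l_diagram.ray_system_LHomeo[OF l_diagram.intro[OF that]] .
  from E show ?thesis
  proof (induction rule: equivclp_induct)
    case base
    show ?case by (rule top_conj_refl)
  next
    case (step y z)
    have "top_conj (ray_system y) (ray_system z)"
      using step(2)
    proof
      assume zy: "l_step z y"
      then have "z \<in> LDiag" by (simp add: l_step_def)
      then show ?thesis using top_conj_sym[OF L st[OF zy]] by simp
    qed (rule st)
    with step(3) show ?case by (rule top_conj_trans)
  qed
qed

section \<open>Systems coded by a diagram\<close>

text \<open>Here \<open>h\<close> identifies \<open>(X, \<sigma>)\<close> with the ray system of \<open>F\<close>.  The points whose rays pass
  through one vertex form a cell, and the cells of one level form a partition of \<open>X\<close>.\<close>

locale coding = lhomeo X \<sigma> + F: l_diagram F
  for X :: "'a topology" and \<sigma> :: "'a \<Rightarrow> 'a" and F :: "('v, 'e) cdiagram" +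
  fixes h :: "'a \<Rightarrow> nat \<Rightarrow> 'e"
  assumes homeo: "homeomorphic_map X (ray_topology F) h"
    and equivariant: "x \<in> topspace X \<Longrightarrow> h (\<sigma> x) = ray_shift F (h x)"
begin

definition vertex_cell :: "nat \<Rightarrow> 'v \<Rightarrow> 'a set" where
  "vertex_cell n v = {x \<in> topspace X. rng F (h x n) = v}"

definition level_partition :: "nat \<Rightarrow> 'a set set" where
  "level_partition n = vertex_cell n ` verts F n"

abbreviation "vtx n x \<equiv> rng F (h x n)"

lemma ray: "x \<in> topspace X \<Longrightarrow> h x \<in> blue_rays F"
  and point: "r \<in> blue_rays F \<Longrightarrow> \<exists>x \<in> topspace X. h x = r"
proof -
  have "h ` topspace X = blue_rays F"
    using homeomorphic_imp_surjective_map[OF homeo] F.topspace_ray_topology by simp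
  then show "x \<in> topspace X \<Longrightarrow> h x \<in> blue_rays F" "r \<in> blue_rays F \<Longrightarrow> \<exists>x \<in> topspace X. h x = r"
    by (blast, metis imageE)
qed

lemma inj_h: "inj_on h (topspace X)"
  by (rule homeomorphic_imp_injective_map[OF homeo])

lemma vtx: "x \<in> topspace X \<Longrightarrow> vtx n x \<in> verts F n"
  using F.ray_vertex[OF ray] .

lemma vertex_cell_nonempty:
  assumes "v \<in> verts F n"
  shows "\<exists>x \<in> topspace X. vtx n x = v"
proof -
  obtain r where r: "r \<in> blue_rays F" "rng F (r n) = v" using F.ray_through[OF assms] by blast
  obtain x where "x \<in> topspace X" "h x = r" using point[OF r(1)] by blast
  with r(2) show ?thesis by auto
qed

lemma vertex_cell_inj:
  assumes "v \<in> verts F n" "vertex_cell n v = vertex_cell n w"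
  shows "v = w"
proof -
  obtain x where "x \<in> topspace X" "vtx n x = v" using vertex_cell_nonempty[OF assms(1)] by blast
  then have "x \<in> vertex_cell n w" using assms(2) by (auto simp: vertex_cell_def)
  then show ?thesis using \<open>vtx n x = v\<close> by (simp add: vertex_cell_def)
qed

lemma clopen_vertex_cell: "openin X (vertex_cell n v)" "closedin X (vertex_cell n v)"
proof -
  have c: "continuous_map X (ray_topology F) h" using homeo homeomorphic_imp_continuous_map by blast
  have e: "vertex_cell n v = {x \<in> topspace X. h x \<in> {r \<in> blue_rays F. rng F (r n) = v}}"
    using ray by (auto simp: vertex_cell_def)
  show "openin X (vertex_cell n v)" unfolding e
    by (rule openin_continuous_map_preimage[OF c F.clopen_coordinate(1)])
  show "closedin X (vertex_cell n v)" unfolding e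
    by (rule closedin_continuous_map_preimage[OF c F.clopen_coordinate(2)])
qed

lemma level_clopen_partition: "clopen_partition X (level_partition n)"
  unfolding clopen_partition_def
proof (intro conjI ballI)
  show "finite (level_partition n)" using F.finite_verts by (simp add: level_partition_def)
  show "partition_on (topspace X) (level_partition n)"
  proof (rule partition_onI)
    show "\<Union>(level_partition n) = topspace X" using vtx
      by (auto simp: level_partition_def vertex_cell_def)
    show "disjnt p q" if "p \<in> level_partition n" "q \<in> level_partition n" "p \<noteq> q" for p q
      using that by (auto simp: level_partition_def vertex_cell_def disjnt_iff)
    show "{} \<notin> level_partition n"
    proof
      assume "{} \<in> level_partition n"
      then obtain v where "v \<in> verts F n" "vertex_cell n v = {}" unfolding level_partition_def by blast
      then show False using vertex_cell_nonempty[of v n] by (auto simp: vertex_cell_def)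
    qed
  qed
  show "openin X Z" "closedin X Z" if "Z \<in> level_partition n" for Z
    using that clopen_vertex_cell by (auto simp: level_partition_def)
qed

lemma cell_of_level: "x \<in> topspace X \<Longrightarrow> cell_of (level_partition n) x = vertex_cell n (vtx n x)"
  by (rule clopen_partition_cell(3)[OF level_clopen_partition])
    (auto simp: level_partition_def vertex_cell_def vtx)

lemma cell_of_level_eq_iff:
  assumes "x \<in> topspace X" "y \<in> topspace X"
  shows "cell_of (level_partition n) x = cell_of (level_partition n) y \<longleftrightarrow> vtx n x = vtx n y"
  unfolding cell_of_level[OF assms(1)] cell_of_level[OF assms(2)]
  using vertex_cell_inj[OF vtx[OF assms(1)]] by metis

lemma vtx_below:
  assumes "x \<in> topspace X" "y \<in> topspace X" "vtx k x = vtx k y" "n \<le> k"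
  shows "vtx n x = vtx n y"
  by (rule F.ray_vertex_below[OF ray[OF assms(1)] ray[OF assms(2)] assms(3,4)])

lemma level_refine:
  assumes "n \<le> k"
  shows "level_partition n \<precsim>p level_partition k"
  unfolding refined_by_def
proof
  fix Z assume "Z \<in> level_partition k"
  then obtain v where v: "v \<in> verts F k" "Z = vertex_cell k v" by (auto simp: level_partition_def)
  obtain x where x: "x \<in> topspace X" "vtx k x = v" using vertex_cell_nonempty[OF v(1)] by blast
  have "Z \<subseteq> vertex_cell n (vtx n x)"
  proof
    fix y assume "y \<in> Z"
    then have y: "y \<in> topspace X" "vtx k y = vtx k x" using v(2) x(2) by (simp_all add: vertex_cell_def)
    then show "y \<in> vertex_cell n (vtx n x)" using vtx_below[OF y(1) x(1) y(2) assms]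
      by (simp add: vertex_cell_def)
  qed
  then show "\<exists>Y \<in> level_partition n. Z \<subseteq> Y" using vtx[OF x(1)] by (auto simp: level_partition_def)
qed

lemma level_base:
  assumes m: "strict_mono m"
  shows "clopen_base X (\<lambda>n. level_partition (m n))"
  unfolding clopen_base_def
proof (intro conjI allI impI)
  fix n
  show "clopen_partition X (level_partition (m n))" by (rule level_clopen_partition)
  have "m n \<le> m (Suc n)" using m by (simp add: strict_mono_less_eq)
  then show "level_partition (m n) \<precsim>p level_partition (m (Suc n))" by (rule level_refine)
next
  fix U x assume U: "openin X U" "x \<in> U"
  have x: "x \<in> topspace X" using openin_subset[OF U(1)] U(2) by blast
  have hU: "openin (ray_topology F) (h ` U)"
    using homeomorphic_imp_open_map[OF homeo] U(1) by (simp add: open_map_def)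
  obtain n where n: "\<forall>y \<in> blue_rays F. rng F (y n) = vtx n x \<longrightarrow> y \<in> h ` U"
    using F.ray_base[OF hU, of "h x"] U(2) by blast
  have "n \<le> m n" by (rule strict_mono_imp_increasing[OF m])
  have "y \<in> U" if y: "y \<in> topspace X" "vtx (m n) y = vtx (m n) x" for y
  proof -
    have "vtx n y = vtx n x" using vtx_below[OF y(1) x y(2) \<open>n \<le> m n\<close>] .
    then have "h y \<in> h ` U" using n ray[OF y(1)] by blast
    then show ?thesis using inj_on_image_mem_iff[OF inj_h y(1) openin_subset[OF U(1)]] by blast
  qed
  then have "vertex_cell (m n) (vtx (m n) x) \<subseteq> U" by (auto simp: vertex_cell_def)
  moreover have "vertex_cell (m n) (vtx (m n) x) \<in> level_partition (m n)"
    using vtx[OF x] by (simp add: level_partition_def)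
  ultimately show "\<exists>n. \<exists>Z \<in> level_partition (m n). x \<in> Z \<and> Z \<subseteq> U"
    using x by (intro exI[of _ n] bexI[of _ "vertex_cell (m n) (vtx (m n) x)"]) (simp_all add:
      vertex_cell_def)
qed

text \<open>On the cells of levels 0 and 1 the map \<open>\<sigma>\<close> need not be injective: the axioms allow two red edges
  with the same source and range at level 0.  From level 2 on it is, because a vertex at level 2
  determines the first red edge.  This is why the contractions below start at level 2 or later.\<close>

lemma level_inj:
  assumes "Z \<in> level_partition n" "2 \<le> n"
  shows "inj_on \<sigma> Z"
proof (rule inj_onI)
  fix x y assume xy: "x \<in> Z" "y \<in> Z" "\<sigma> x = \<sigma> y"
  then have x: "x \<in> topspace X" "y \<in> topspace X" and v: "vtx n x = vtx n y"
    using assms(1) by (auto simp: level_partition_def vertex_cell_def)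
  have "vtx (2*1) x = vtx (2*1) y" using vtx_below[OF x v] assms(2) by simp
  then have "red_ray F (h x) (2*0) = red_ray F (h y) (2*0)"
    using F.red_ray_below[OF ray[OF x(1)] ray[OF x(2)], of 1 0] by simp
  moreover have "ray_shift F (h x) = ray_shift F (h y)" using xy(3) equivariant x by metis
  ultimately have "h x = h y" using F.shift_inj[OF ray[OF x(1)] ray[OF x(2)]] by blast
  then show "x = y" using inj_onD[OF inj_h] x by blast
qed

text \<open>Translation of \<open>shift_lift\<close> to the coded space: the points with a given red edge are mapped onto
  the whole cell of its source.\<close>

lemma red_edge_image:
  assumes x: "x \<in> topspace X" and y: "y \<in> topspace X" and v: "vtx (2*i + 1) y = vtx (2*i + 1) (\<sigma> x)"
  shows "\<exists>z \<in> topspace X. \<sigma> z = y \<and> red_ray F (h z) (2*i) = red_ray F (h x) (2*i)"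
proof -
  have "rng F (h y (2*i + 1)) = src F (red_ray F (h x) (2*i))"
    using v equivariant[OF x] F.ray_shift_odd[OF ray[OF x], of i] by simp
  from F.shift_lift[OF F.red_ray_edge[OF ray[OF x]] ray[OF y] this]
  obtain r where r: "r \<in> blue_rays F" "ray_shift F r = h y"
    "red_ray F r (2*i) = red_ray F (h x) (2*i)" by blast
  obtain z where z: "z \<in> topspace X" "h z = r" using point[OF r(1)] by blast
  have "h (\<sigma> z) = h y" using equivariant[OF z(1)] z(2) r(2) by simp
  then have "\<sigma> z = y" using inj_onD[OF inj_h] maps[OF z(1)] y by blast
  then show ?thesis using z r(3) by blast
qed

lemma red_ray_vtx:
  assumes x: "x \<in> topspace X" and z: "z \<in> topspace X"
    and e: "red_ray F (h z) (2*i) = red_ray F (h x) (2*i)" and n: "n \<le> 2*i"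
  shows "vtx n z = vtx n x"
proof -
  have "vtx (2*i) z = vtx (2*i) x" using e F.red_ray_rng[OF ray[OF x], of i]
    F.red_ray_rng[OF ray[OF z], of i] by simp
  then show ?thesis using vtx_below[OF z x _ n] by blast
qed

text \<open>An odd cell that meets \<open>\<sigma>(Z)\<close> lies in \<open>\<sigma>(Z)\<close> by \<open>red_edge_image\<close>, applied at the last even
  level before it, and even cells are mapped into odd cells because the image ray is determined
  by the next even vertex.\<close>

lemma level_adapted:
  assumes m: "contraction_levels m" and m0: "2 \<le> m 0"
  shows "sigma_adapted \<sigma> (\<lambda>n. level_partition (m n))"
  unfolding sigma_adapted_def
proof (intro conjI allI ballI impI)
  have odd: "\<exists>i. m (2*j + 1) = 2*i + 1 \<and> m (2*j) \<le> 2*i" for j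
  proof -
    obtain i where "m (2*j + 1) = 2*i + 1" using contraction_levels_mono(2)[OF m, of "2*j + 1"]
      by (auto elim: oddE)
    moreover have "m (2*j) < m (2*j + 1)" using m by (simp add: contraction_levels_def)
    ultimately show ?thesis by auto
  qed
  show "inj_on \<sigma> Z" if "Z \<in> level_partition (m 0)" for Z using level_inj[OF that m0] .
  fix j
  show "Z' \<subseteq> \<sigma> ` Z"
    if Z: "Z \<in> level_partition (m (2*j))" "Z' \<in> level_partition (m (2*j + 1))" "\<sigma> ` Z \<inter> Z' \<noteq> {}"
      for Z Z'
  proof
    fix y assume y: "y \<in> Z'"
    obtain i where i: "m (2*j + 1) = 2*i + 1" "m (2*j) \<le> 2*i" using odd by blast
    obtain x where x: "x \<in> Z" "\<sigma> x \<in> Z'" using Z(3) by blast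
    obtain v v' where v: "Z = vertex_cell (m (2*j)) v" "Z' = vertex_cell (m (2*j + 1)) v'"
      using Z by (auto simp: level_partition_def)
    have xt: "x \<in> topspace X" "y \<in> topspace X" "vtx (2*i + 1) y = vtx (2*i + 1) (\<sigma> x)"
      using x y v i by (auto simp: vertex_cell_def)
    obtain z where z: "z \<in> topspace X" "\<sigma> z = y" "red_ray F (h z) (2*i) = red_ray F (h x) (2*i)"
      using red_edge_image[OF xt] by blast
    have "vtx (m (2*j)) z = vtx (m (2*j)) x" by (rule red_ray_vtx[OF xt(1) z(1,3) i(2)])
    then have "z \<in> Z" using x(1) z(1) v(1) by (simp add: vertex_cell_def)
    then show "y \<in> \<sigma> ` Z" using z(2) by blast
  qed
  show "\<exists>Z \<in> level_partition (m (2*j + 1)). \<sigma> ` Z' \<subseteq> Z" if Z': "Z' \<in> level_partition (m (2*j + 2))"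
    for Z'
  proof -
    obtain v where v: "v \<in> verts F (m (2*j + 2))" "Z' = vertex_cell (m (2*j + 2)) v" using Z'
      by (auto simp: level_partition_def)
    obtain x where x: "x \<in> topspace X" "vtx (m (2*j + 2)) x = v"
      using vertex_cell_nonempty[OF v(1)] by blast
    have lt: "m (2*j + 1) < m (2*j + 2)" using m by (simp add: contraction_levels_def)
    have "even (m (2*j + 2))" using contraction_levels_mono(2)[OF m, of "2*j + 2"] by simp
    then have "m (2*j + 2) = 2*(m (2*j + 2) div 2 - 1) + 2" using lt by presburger
    then obtain i where i: "m (2*j + 2) = 2*i + 2" by blast
    have "\<sigma> ` Z' \<subseteq> vertex_cell (m (2*j + 1)) (vtx (m (2*j + 1)) (\<sigma> x))"
    proof
      fix w assume "w \<in> \<sigma> ` Z'"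
      then obtain y where y: "y \<in> topspace X" "w = \<sigma> y" "vtx (2*i + 2) y = vtx (2*i + 2) x"
        using v(2) x(2) i by (auto simp: vertex_cell_def)
      have "rng F (ray_shift F (h y) (m (2*j + 1))) = rng F (ray_shift F (h x) (m (2*j + 1)))"
        by (rule F.ray_shift_below[OF ray[OF y(1)] ray[OF x(1)] y(3)]) (use lt i in linarith)
      then show "w \<in> vertex_cell (m (2*j + 1)) (vtx (m (2*j + 1)) (\<sigma> x))"
        using equivariant x(1) y(1,2) maps[OF y(1)] by (simp add: vertex_cell_def)
    qed
    then show ?thesis using vtx[OF maps[OF x(1)]] by (auto simp: level_partition_def)
  qed
qed

end

text \<open>The contraction of \<open>F\<close> to the levels \<open>m n\<close> is isomorphic to the diagram of the partitions of \<open>X\<close> at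
  these levels: a path corresponds to the pair of cells of its end vertices.\<close>

locale contracted_coding = coding X \<sigma> F h + contracted_diagram F m
  for X :: "'a topology" and \<sigma> :: "'a \<Rightarrow> 'a" and F :: "('v, 'e) cdiagram" and h :: "'a \<Rightarrow> nat \<Rightarrow> 'e"
    and m :: "nat \<Rightarrow> nat" +
  assumes start: "2 \<le> m 0"
begin

sublocale S: adapted_sequence X \<sigma> "\<lambda>n. level_partition (m n)"
  by unfold_locales (rule level_base[OF contraction_levels_mono(1)[OF levels]],
    rule level_adapted[OF levels start])

lemma m_ge: "2 \<le> m n"
  using start contraction_levels_mono(1)[OF levels] by (metis le0 le_trans strict_mono_less_eq)

lemma m_odd: "\<exists>i. m (2*j + 1) = 2*i + 1 \<and> m (2*j) \<le> 2*i"
  using m_odd_half[of j] m_less[of "2*j"] by auto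

lemma m_even_pos: "\<exists>i. m (2*j) = 2*i + 2"
proof -
  have "even (m (2*j))" "2 \<le> m (2*j)" using m_even[of "2*j"] m_ge by auto
  then have "m (2*j) = 2*(m (2*j) div 2 - 1) + 2" by presburger
  then show ?thesis by blast
qed

definition map_vertex :: "nat \<Rightarrow> 'v \<Rightarrow> 'a pvertex" where
  "map_vertex n v = (n, vertex_cell (m n) v)"

definition map_path :: "colour \<Rightarrow> nat \<Rightarrow> 'e list \<Rightarrow> 'a pedge" where
  "map_path c n p = (c, n, vertex_cell (m (Suc n)) (src F (last p)), vertex_cell (m n) (rng F (hd p)))"

abbreviation "bseg n x \<equiv> segment (h x) (m n) (m (Suc n))"
abbreviation "rseg n x \<equiv> segment (red_ray F (h x)) (m n) (m (Suc n))"

lemma map_bseg: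
  assumes x: "x \<in> topspace X"
  shows "map_path Blue n (bseg n x) = (Blue, n, S.cell (Suc n) x, S.cell n x)"
proof -
  have "src F (h x (m (Suc n) - 1)) = vtx (m (Suc n)) x"
    using F.ray_src[OF ray[OF x], of "m (Suc n) - 1"] m_less[of n] by simp
  then show ?thesis unfolding map_path_def segment_ends(2,3)[OF m_less] cell_of_level[OF x] by simp
qed

lemma map_rseg_even:
  assumes x: "x \<in> topspace X"
  shows "map_path Red (2*j) (rseg (2*j) x) = (Red, 2*j, S.cell (2*j + 1) (\<sigma> x), S.cell (2*j) x)"
proof -
  obtain i where i: "m (2*j + 1) = 2*i + 1" using m_odd by blast
  obtain l where l: "m (2*j) = 2*l" using m_even_half by blast
  have "src F (red_ray F (h x) (m (Suc (2*j)) - 1)) = vtx (m (2*j + 1)) (\<sigma> x)"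
    using F.ray_shift_odd[OF ray[OF x], of i] equivariant[OF x] i by simp
  moreover have "rng F (red_ray F (h x) (m (2*j))) = vtx (m (2*j)) x"
    using F.red_ray_rng[OF ray[OF x], of l] l by simp
  ultimately show ?thesis
    unfolding map_path_def segment_ends(2,3)[OF m_less] cell_of_level[OF x]
      cell_of_level[OF maps[OF x]] by simp
qed

lemma map_rseg_odd:
  assumes x: "x \<in> topspace X"
  shows "map_path Red (2*j + 1) (rseg (2*j + 1) x) =
    (Red, 2*j + 1, S.cell (2*j + 2) x, S.cell (2*j + 1) (\<sigma> x))"
proof -
  obtain i where i: "m (2*j + 1) = 2*i + 1" using m_odd by blast
  obtain l where l: "m (2*j + 2) = 2*l + 2" using m_even_pos[of "j + 1"] by auto
  have "src F (red_ray F (h x) (m (Suc (2*j + 1)) - 1)) = vtx (m (2*j + 2)) x"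
    using F.red_ray_src_odd[OF ray[OF x], of l] l by simp
  moreover have "rng F (red_ray F (h x) (m (2*j + 1))) = vtx (m (2*j + 1)) (\<sigma> x)"
    using F.red_ray_rng_odd[OF ray[OF x], of i] equivariant[OF x] i by simp
  ultimately show ?thesis
    unfolding map_path_def segment_ends(2,3)[OF m_less] cell_of_level[OF x]
      cell_of_level[OF maps[OF x]] by simp
qed

lemma blue_path_point: "p \<in> blue_paths F (m n) (m (Suc n)) \<Longrightarrow> \<exists>x \<in> topspace X. p = bseg n x"
  using F.blue_path_segment[OF _ m_less] point by metis

lemma red_path_point: "p \<in> red_paths F (m n) (m (Suc n)) \<Longrightarrow> \<exists>x \<in> topspace X. p = rseg n x"
  using F.red_path_segment[OF _ m_less] point by metis

lemma segment_cong: "(\<And>i. a \<le> i \<Longrightarrow> i < b \<Longrightarrow> x i = y i) \<Longrightarrow> segment x a b = segment y a b"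
  by (simp add: segment_def)

lemma bseg_eqI:
  assumes x: "x \<in> topspace X" "y \<in> topspace X" and c: "S.cell (Suc n) x = S.cell (Suc n) y"
  shows "bseg n x = bseg n y"
proof (rule segment_cong)
  fix i assume "i < m (Suc n)"
  then show "h x i = h y i"
    using F.ray_edge_below[OF ray[OF x(1)] ray[OF x(2)]] c cell_of_level_eq_iff[OF x] by blast
qed

lemma rseg_odd_eqI:
  assumes x: "x \<in> topspace X" "y \<in> topspace X" and c: "S.cell (2*j + 2) x = S.cell (2*j + 2) y"
  shows "rseg (2*j + 1) x = rseg (2*j + 1) y"
proof (rule segment_cong)
  fix i assume i: "i < m (Suc (2*j + 1))"
  obtain l where l: "m (2*j + 2) = 2*l" using m_even_half[of "j + 1"] by auto
  have "vtx (2*l) x = vtx (2*l) y" using c cell_of_level_eq_iff[OF x] l by simp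
  then show "red_ray F (h x) i = red_ray F (h y) i"
    using F.red_ray_below[OF ray[OF x(1)] ray[OF x(2)], of l i] i l by simp
qed

text \<open>A red path that starts at an even level is determined by its two ends.  The last edges are
  compared by lifting \<open>\<sigma> x\<close> along the red edge of \<open>y\<close>; the lift lies in the cell of \<open>x\<close> and has the same
  image as \<open>x\<close>, so it is \<open>x\<close>, as \<open>\<sigma>\<close> is injective on that cell.\<close>

lemma rseg_even_eqI:
  assumes x: "x \<in> topspace X" "y \<in> topspace X"
    and c: "S.cell (2*j + 1) (\<sigma> x) = S.cell (2*j + 1) (\<sigma> y)" "S.cell (2*j) x = S.cell (2*j) y"
  shows "rseg (2*j) x = rseg (2*j) y"
proof -
  obtain i where i: "m (2*j + 1) = 2*i + 1" "m (2*j) \<le> 2*i" using m_odd by blast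
  have "vtx (2*i + 1) (\<sigma> x) = vtx (2*i + 1) (\<sigma> y)"
    using c(1) cell_of_level_eq_iff[OF maps[OF x(1)] maps[OF x(2)]] i by simp
  then obtain z where z: "z \<in> topspace X" "\<sigma> z = \<sigma> x" "red_ray F (h z) (2*i) = red_ray F (h y) (2*i)"
    using red_edge_image[OF x(2) maps[OF x(1)]] by blast
  have "S.cell (2*j) z = S.cell (2*j) x"
    using red_ray_vtx[OF x(2) z(1,3) i(2)] cell_of_level_eq_iff[OF z(1) x(2)] c(2) by simp
  then have "z = x"
    using inj_onD[OF S.inj[OF S.cell(1)[OF x(1)]] z(2)] S.cell(2)[OF z(1)] S.cell(2)[OF x(1)] by metis
  then have e: "red_ray F (h x) (2*i) = red_ray F (h y) (2*i)" using z(3) by simp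
  have "red_ray F (h x) l = red_ray F (h y) l" if l: "l < m (Suc (2*j))" for l
  proof (cases "l = 2*i")
    case False
    then have "l < 2*i" using l i by simp
    then show ?thesis
      using F.red_ray_below[OF ray[OF x(1)] ray[OF x(2)], of i l]
        red_ray_vtx[OF x(2,1) e order_refl] by blast
  qed (use e in simp)
  then show ?thesis by (intro segment_cong) blast
qed

abbreviation "D' \<equiv> partition_diagram \<sigma> (\<lambda>n. level_partition (m n))"

lemma in_pred_edges_odd: "f \<in> pred_edges \<sigma> P (2*j + 1) \<longleftrightarrow>
    (\<exists>W \<in> P (2*j + 2). \<exists>Z \<in> P (2*j + 1). \<sigma> ` W \<subseteq> Z \<and> f = (Red, 2*j + 1, W, Z))"
  by (auto simp: pred_edges_def)

lemma bij_blue: "bij_betw (map_path Blue n) (blue_edges K n) (blue_edges D' n)"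
  unfolding blue_edges_K S.blue_edges_D
proof (rule bij_betwI')
  fix p q assume p: "p \<in> blue_paths F (m n) (m (Suc n))" and q: "q \<in> blue_paths F (m n) (m (Suc n))"
  obtain x y where x: "x \<in> topspace X" "p = bseg n x" and y: "y \<in> topspace X" "q = bseg n y"
    using blue_path_point[OF p] blue_path_point[OF q] by blast
  show "map_path Blue n p = map_path Blue n q \<longleftrightarrow> p = q"
    using map_bseg[OF x(1), of n] map_bseg[OF y(1), of n] bseg_eqI[OF x(1) y(1), of n] x(2) y(2) by auto
next
  fix p assume p: "p \<in> blue_paths F (m n) (m (Suc n))"
  obtain x where x: "x \<in> topspace X" "p = bseg n x" using blue_path_point[OF p] by blast
  show "map_path Blue n p \<in> pblue_edges (\<lambda>n. level_partition (m n)) n"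
    unfolding x(2) map_bseg[OF x(1)] pblue_edges_def
    using S.cell(1)[OF x(1)] S.cell_antimono[of n "Suc n", OF _ x(1)] by simp
next
  fix e assume "e \<in> pblue_edges (\<lambda>n. level_partition (m n)) n"
  then obtain W Z where e: "e = (Blue, n, W, Z)" "W \<in> level_partition (m (Suc n))"
    "Z \<in> level_partition (m n)" "W \<subseteq> Z"
    by (auto simp: pblue_edges_def)
  obtain x where x: "x \<in> topspace X" "x \<in> W" "W = S.cell (Suc n) x" using S.cell_cases[OF e(2)] by blast
  have "Z = S.cell n x" using S.cell(3)[OF e(3)] x(2) e(4) by blast
  then have "e = map_path Blue n (bseg n x)" unfolding map_bseg[OF x(1)] using e(1) x(3) by simp
  then show "\<exists>p \<in> blue_paths F (m n) (m (Suc n)). e = map_path Blue n p"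
    using F.segment_blue_path[OF ray[OF x(1)]] by blast
qed

lemma bij_red: "bij_betw (map_path Red n) (red_edges K n) (red_edges D' n)"
  unfolding red_edges_K S.red_edges_D
proof (cases "even n")
  case True
  then obtain j where n: "n = 2*j" by blast
  show "bij_betw (map_path Red n) (red_paths F (m n) (m (Suc n))) (pred_edges \<sigma> (\<lambda>n.
    level_partition (m n)) n)"
    unfolding n
  proof (rule bij_betwI')
    fix p q assume p: "p \<in> red_paths F (m (2*j)) (m (Suc (2*j)))"
      and q: "q \<in> red_paths F (m (2*j)) (m (Suc (2*j)))"
    obtain x y where x: "x \<in> topspace X" "p = rseg (2*j) x" and y: "y \<in> topspace X" "q = rseg (2*j) y"
      using red_path_point[OF p] red_path_point[OF q] by blast
    show "map_path Red (2*j) p = map_path Red (2*j) q \<longleftrightarrow> p = q"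
      using map_rseg_even[OF x(1), of j] map_rseg_even[OF y(1), of j] rseg_even_eqI[OF x(1) y(1),
        of j] x(2) y(2) by auto
  next
    fix p assume p: "p \<in> red_paths F (m (2*j)) (m (Suc (2*j)))"
    obtain x where x: "x \<in> topspace X" "p = rseg (2*j) x" using red_path_point[OF p] by blast
    note c = S.cell(1,2)[OF x(1)] and c' = S.cell(1,2)[OF maps[OF x(1)]]
    have "S.cell (2*j + 1) (\<sigma> x) \<subseteq> \<sigma> ` S.cell (2*j) x" using S.image_supset_iff[OF c(1) c'] c(2)
      by blast
    then show "map_path Red (2*j) p \<in> pred_edges \<sigma> (\<lambda>n. level_partition (m n)) (2*j)"
      unfolding x(2) map_rseg_even[OF x(1)] S.in_pred_edges_even using c(1) c'(1) by blast
  next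
    fix e assume "e \<in> pred_edges \<sigma> (\<lambda>n. level_partition (m n)) (2*j)"
    then obtain W Z where e: "e = (Red, 2*j, W, Z)" "W \<in> level_partition (m (2*j + 1))"
      "Z \<in> level_partition (m (2*j))" "W \<subseteq> \<sigma> ` Z"
      unfolding S.in_pred_edges_even by blast
    obtain y where y: "y \<in> W" using S.cell(5)[OF e(2)] by blast
    then obtain x where x: "x \<in> Z" "y = \<sigma> x" using e(4) by blast
    have xt: "x \<in> topspace X" using S.cell(4)[OF e(3)] x(1) by blast
    have "W = S.cell (2*j + 1) (\<sigma> x)" "Z = S.cell (2*j) x"
      using S.cell(3)[OF e(2) y] x(2) S.cell(3)[OF e(3) x(1)] by simp_all
    then have "e = map_path Red (2*j) (rseg (2*j) x)" unfolding map_rseg_even[OF xt] using e(1) by simp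
    then show "\<exists>p \<in> red_paths F (m (2*j)) (m (Suc (2*j))). e = map_path Red (2*j) p"
      using F.segment_red_path[OF ray[OF xt]] by blast
  qed
next
  case False
  then obtain j where n: "n = 2*j + 1" using oddE by blast
  show "bij_betw (map_path Red n) (red_paths F (m n) (m (Suc n))) (pred_edges \<sigma> (\<lambda>n.
    level_partition (m n)) n)"
    unfolding n
  proof (rule bij_betwI')
    fix p q assume p: "p \<in> red_paths F (m (2*j + 1)) (m (Suc (2*j + 1)))"
      and q: "q \<in> red_paths F (m (2*j + 1)) (m (Suc (2*j + 1)))"
    obtain x y where x: "x \<in> topspace X" "p = rseg (2*j + 1) x"
      and y: "y \<in> topspace X" "q = rseg (2*j + 1) y"
      using red_path_point[OF p] red_path_point[OF q] by blast
    show "map_path Red (2*j + 1) p = map_path Red (2*j + 1) q \<longleftrightarrow> p = q"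
      using map_rseg_odd[OF x(1), of j] map_rseg_odd[OF y(1), of j] rseg_odd_eqI[OF x(1) y(1),
        of j] x(2) y(2) by auto
  next
    fix p assume p: "p \<in> red_paths F (m (2*j + 1)) (m (Suc (2*j + 1)))"
    obtain x where x: "x \<in> topspace X" "p = rseg (2*j + 1) x" using red_path_point[OF p] by blast
    note c = S.cell(1,2)[OF x(1)] and c' = S.cell(1,2)[OF maps[OF x(1)]]
    have "\<sigma> ` S.cell (2*j + 2) x \<subseteq> S.cell (2*j + 1) (\<sigma> x)"
      using S.image_subset_iff[OF c'(1) c] c'(2) by blast
    then show "map_path Red (2*j + 1) p \<in> pred_edges \<sigma> (\<lambda>n. level_partition (m n)) (2*j + 1)"
      unfolding x(2) map_rseg_odd[OF x(1)] in_pred_edges_odd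
      by (intro bexI[OF _ c(1)] bexI[OF _ c'(1)] conjI refl)
  next
    fix e assume "e \<in> pred_edges \<sigma> (\<lambda>n. level_partition (m n)) (2*j + 1)"
    then obtain W Z where e: "e = (Red, 2*j + 1, W, Z)" "W \<in> level_partition (m (2*j + 2))"
      "Z \<in> level_partition (m (2*j + 1))" "\<sigma> ` W \<subseteq> Z"
      unfolding in_pred_edges_odd by blast
    obtain x where x: "x \<in> topspace X" "x \<in> W" "W = S.cell (2*j + 2) x" using S.cell_cases[OF e(2)]
      by blast
    have "Z = S.cell (2*j + 1) (\<sigma> x)" using S.cell(3)[OF e(3)] x(2) e(4) by blast
    then have "e = map_path Red (2*j + 1) (rseg (2*j + 1) x)" unfolding map_rseg_odd[OF x(1)]
      using e(1) x(3) by simp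
    then show "\<exists>p \<in> red_paths F (m (2*j + 1)) (m (Suc (2*j + 1))). e = map_path Red (2*j + 1) p"
      using F.segment_red_path[OF ray[OF x(1)]] by blast
  qed
qed

lemma map_redof:
  assumes f: "f \<in> red_edges K (2*j)"
  shows "map_path Red (2*j + 1) ` redof K f = redof D' (map_path Red (2*j) f)"
proof -
  have fp: "f \<in> red_paths F (m (2*j)) (m (Suc (2*j)))" using f unfolding red_edges_K .
  obtain x where x: "x \<in> topspace X" "f = rseg (2*j) x" using red_path_point[OF fp] by blast
  have fp': "f \<in> red_paths F (m (2*j)) (m (2*j + 1))" using fp by simp
  obtain i where i: "m (2*j + 1) = 2*i + 1" "m (2*j) \<le> 2*i" using m_odd by blast
  have last: "last f = red_ray F (h x) (2*i)"
    using segment_ends(3)[OF m_less[of "2*j"], of "red_ray F (h x)"] x(2) i(1) by simp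
  have le: "S.cell (2*j + 2) y \<subseteq> S.cell (2*j) y" if "y \<in> topspace X" for y
    using S.cell_antimono[of "2*j" "2*j + 2", OF _ that] by simp
  show ?thesis
  proof (intro equalityI subsetI)
    fix e assume "e \<in> map_path Red (2*j + 1) ` redof K f"
    then obtain g where g: "e = map_path Red (2*j + 1) g"
      "g \<in> red_paths F (m (2*j + 1)) (m (2*j + 2))" "hd g \<in> redof F (last f)"
      using contr_redof_iff[OF fp'] by auto
    obtain y where y: "y \<in> topspace X" "g = rseg (2*j + 1) y"
      using red_path_point[of g "2*j + 1"] g(2) by auto
    have "hd g = red_ray F (h y) (2*i + 1)"
      using segment_ends(2)[OF m_less[of "2*j + 1"], of "red_ray F (h y)"] y(2) i(1) by simp
    then have "red_ray F (h y) (2*i + 1) \<in> redof F (red_ray F (h x) (2*i))" using g(3) last by simp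
    then have ee: "red_ray F (h y) (2*i) = red_ray F (h x) (2*i)"
      using F.redof_unique[OF F.red_ray_edge[OF ray[OF y(1)]] F.red_ray_redof[OF ray[OF y(1)]]
        F.red_ray_edge[OF ray[OF x(1)]]] by blast
    have "vtx (2*i + 1) (\<sigma> y) = vtx (2*i + 1) (\<sigma> x)"
      using F.ray_shift_odd[OF ray[OF y(1)], of i] F.ray_shift_odd[OF ray[OF x(1)], of i]
        ee equivariant x(1) y(1) by simp
    then have c1: "S.cell (2*j + 1) (\<sigma> y) = S.cell (2*j + 1) (\<sigma> x)"
      using cell_of_level_eq_iff[OF maps[OF y(1)] maps[OF x(1)]] i by simp
    have c2: "S.cell (2*j) y = S.cell (2*j) x"
      using red_ray_vtx[OF x(1) y(1) ee i(2)] cell_of_level_eq_iff[OF y(1) x(1)] by simp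
    note c = S.cell(1,2)[OF y(1)] and c' = S.cell(1,2)[OF maps[OF y(1)]]
    have "\<sigma> ` S.cell (2*j + 2) y \<subseteq> S.cell (2*j + 1) (\<sigma> y)"
      using S.image_subset_iff[OF c'(1) c] c'(2) by blast
    then show "e \<in> redof D' (map_path Red (2*j) f)"
      unfolding g(1) y(2) x(2) map_rseg_odd[OF y(1)] map_rseg_even[OF x(1)]
        S.fields S.in_predof c1[symmetric]
      using c(1) c'(1) le[OF y(1)] c2 by auto
  next
    fix e assume "e \<in> redof D' (map_path Red (2*j) f)"
    then obtain W where W: "W \<in> level_partition (m (2*j + 2))" "\<sigma> ` W \<subseteq> S.cell (2*j + 1) (\<sigma> x)"
      "W \<subseteq> S.cell (2*j) x"
      "e = (Red, 2*j + 1, W, S.cell (2*j + 1) (\<sigma> x))"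
      unfolding x(2) map_rseg_even[OF x(1)] S.fields S.in_predof by blast
    obtain y where y: "y \<in> topspace X" "y \<in> W" "W = S.cell (2*j + 2) y" using S.cell_cases[OF W(1)]
      by blast
    have c1: "S.cell (2*j + 1) (\<sigma> y) = S.cell (2*j + 1) (\<sigma> x)"
      by (rule S.cell(3)[OF S.cell(1)[OF maps[OF x(1)]]]) (use W(2) y(2) in blast)
    have c2: "S.cell (2*j) y = S.cell (2*j) x"
      by (rule S.cell(3)[OF S.cell(1)[OF x(1)]]) (use W(3) y(2) in blast)
    have f2: "f = rseg (2*j) y" using rseg_even_eqI[OF y(1) x(1) c1 c2] x(2) by simp
    have "hd (rseg (2*j + 1) y) = red_ray F (h y) (2*i + 1)"
      using segment_ends(2)[OF m_less[of "2*j + 1"], of "red_ray F (h y)"] i(1) by simp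
    moreover have "last f = red_ray F (h y) (2*i)"
      using segment_ends(3)[OF m_less[of "2*j"], of "red_ray F (h y)"] f2 i(1) by simp
    ultimately have "hd (rseg (2*j + 1) y) \<in> redof F (last f)"
      using F.red_ray_redof[OF ray[OF y(1)], of i] by simp
    then have "rseg (2*j + 1) y \<in> redof K f"
      using contr_redof_iff[OF fp'] F.segment_red_path[OF ray[OF y(1)], of "m (2*j + 1)"
        "m (2*j + 2)"] by simp
    moreover have "e = map_path Red (2*j + 1) (rseg (2*j + 1) y)"
      unfolding map_rseg_odd[OF y(1)] using W(4) y(3) c1 by simp
    ultimately show "e \<in> map_path Red (2*j + 1) ` redof K f" by blast
  qed
qed

theorem contraction_iso: "ldiag_iso K D'"
proof (rule ldiag_isoI[OF coloured_K S.D.coloured, where ?\<phi>0.0 = map_vertex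
  and \<phi>B = "map_path Blue" and \<phi>R = "map_path Red"])
  show "bij_betw (map_vertex n) (verts K n) (verts D' n)" for n
  proof -
    have "inj_on (map_vertex n) (verts F (m n))"
      by (rule inj_onI) (use vertex_cell_inj in \<open>auto simp: map_vertex_def\<close>)
    moreover have "map_vertex n ` verts F (m n) = {n} \<times> level_partition (m n)"
      by (auto simp: map_vertex_def level_partition_def)
    ultimately show ?thesis by (simp add: bij_betw_def)
  qed
  show "rng D' (map_path Blue n e) = map_vertex n (rng K e) \<and>
    src D' (map_path Blue n e) = map_vertex (Suc n) (src K e)" for n e
    by (simp add: map_path_def map_vertex_def)
  show "rng D' (map_path Red n e) = map_vertex n (rng K e) \<and>
    src D' (map_path Red n e) = map_vertex (Suc n) (src K e)" for n e
    by (simp add: map_path_def map_vertex_def)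
qed (rule bij_blue bij_red map_redof | assumption)+

end

section \<open>Interleaving\<close>

text \<open>Indices \<open>i\<close> with \<open>i mod 4 \<in> {0, 3}\<close> take their partition from \<open>P\<close>, the others from \<open>Q\<close>.  So each
  sequence contributes consecutive pairs of an odd and an even index, and picking out one of the two
  sequences leaves odd gaps, as a contraction needs.\<close>

definition interleave :: "(nat \<Rightarrow> 'b) \<Rightarrow> (nat \<Rightarrow> 'b) \<Rightarrow> nat \<Rightarrow> nat \<Rightarrow> 'b" where
  "interleave P Q i = (if even ((i + 1) div 2) then P else Q)"

context lhomeo
begin

lemma eventually_good_step:
  assumes A: "clopen_partition X A" and Q: "clopen_base X Q"
  shows "\<exists>N. \<forall>n \<ge> N. good_step \<sigma> i A (Q n)"
proof -
  obtain N where N: "\<forall>n \<ge> N. \<forall>Z \<in> Q n. \<forall>C \<in> test_sets A. Z \<inter> C \<noteq> {} \<longrightarrow> Z \<subseteq> C"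
    using clopen_base_decides[OF compact Q test_sets_clopen[OF A]] by blast
  have "good_step \<sigma> i A (Q n)" if "n \<ge> N" for n
    by (rule good_stepI[OF A clopen_base_partition[OF Q]]) (use N that in blast)
  then show ?thesis by blast
qed

text \<open>Each index is chosen large enough that its partition may follow the one chosen before, and of
  the parity of its position, so that subsequences remain contraction levels.  The first index is 2
  because \<open>\<sigma>\<close> is injective on the cells there.\<close>

lemma interleaving:
  assumes P: "clopen_base X P" and Q: "clopen_base X Q" and inj: "\<And>Z. Z \<in> P 2 \<Longrightarrow> inj_on \<sigma> Z"
  shows "\<exists>a. strict_mono a \<and> (\<forall>i. even (a i) \<longleftrightarrow> even i) \<and> 2 \<le> a 0 \<and>
    clopen_base X (\<lambda>i. interleave P Q i (a i)) \<and> sigma_adapted \<sigma> (\<lambda>i. interleave P Q i (a i))"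
proof -
  let ?S = "interleave P Q"
  have S: "clopen_base X (?S i)" for i using P Q by (simp add: interleave_def)
  have "\<exists>a. \<forall>i. ((even (a i) \<longleftrightarrow> even i) \<and> (i = 0 \<longrightarrow> a i = 2)) \<and>
    (a i < a (Suc i) \<and> good_step \<sigma> i (?S i (a i)) (?S (Suc i) (a (Suc i))))"
  proof (rule dependent_nat_choice)
    show "\<exists>k::nat. (even k \<longleftrightarrow> even (0::nat)) \<and> ((0::nat) = 0 \<longrightarrow> k = 2)" by auto
    fix k i :: nat
    obtain N where N: "\<forall>n \<ge> N. good_step \<sigma> i (?S i k) (?S (Suc i) n)"
      using eventually_good_step[OF clopen_base_partition[OF S] S] by blast
    \<comment> \<open>Large enough, above \<open>k\<close>, and of the parity of \<open>Suc i\<close>.\<close>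
    let ?k = "2*(N + k + 1) + (if even i then 1 else 0)"
    have "(even ?k \<longleftrightarrow> even (Suc i)) \<and> (Suc i = 0 \<longrightarrow> ?k = 2) \<and> k < ?k \<and>
      good_step \<sigma> i (?S i k) (?S (Suc i) ?k)"
      using N by auto
    then show "\<exists>k'. ((even k' \<longleftrightarrow> even (Suc i)) \<and> (Suc i = 0 \<longrightarrow> k' = 2)) \<and>
        (k < k' \<and> good_step \<sigma> i (?S i k) (?S (Suc i) k'))" by blast
  qed
  then obtain a where a: "\<And>i. even (a i) \<longleftrightarrow> even i" "a 0 = 2" "\<And>i. a i < a (Suc i)"
    "\<And>i. good_step \<sigma> i (?S i (a i)) (?S (Suc i) (a (Suc i)))" by metis
  have sm: "strict_mono a" using a(3) by (simp add: strict_mono_Suc_iff)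
  have "clopen_base X (\<lambda>i. ?S i (a i))" unfolding clopen_base_def
  proof (intro conjI allI impI)
    show "clopen_partition X (?S n (a n))" for n by (rule clopen_base_partition[OF S])
    show "?S n (a n) \<precsim>p ?S (Suc n) (a (Suc n))" for n using a(4)[of n] by (simp add: good_step_def)
    fix U x assume U: "openin X U" "x \<in> U"
    have x: "x \<in> topspace X" using openin_subset[OF U(1)] U(2) by blast
    obtain n Z where Z: "Z \<in> P n" "x \<in> Z" "Z \<subseteq> U" using clopen_base_nbhd[OF P U] by blast
    \<comment> \<open>The positions divisible by 4 belong to \<open>P\<close>, so \<open>P\<close> alone already gives a base.\<close>
    have e: "?S (4*n) = P" by (simp add: interleave_def)
    have "4*n \<le> a (4*n)" by (rule strict_mono_imp_increasing[OF sm])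
    then have "n \<le> a (4*n)" by linarith
    then have "cell_of (P (a (4*n))) x \<subseteq> cell_of (P n) x" by (rule clopen_base_cell_antimono[OF P _ x])
    also have "cell_of (P n) x = Z" by (rule clopen_partition_cell(3)[OF clopen_base_partition[OF
      P] Z(1,2)])
    finally have "cell_of (P (a (4*n))) x \<subseteq> U" using Z(3) by blast
    then show "\<exists>n. \<exists>Z \<in> ?S n (a n). x \<in> Z \<and> Z \<subseteq> U"
      using clopen_partition_cell(1,2)[OF clopen_base_partition[OF P] x] e
        by (intro exI[of _ "4*n"]) auto
  qed
  moreover have "sigma_adapted \<sigma> (\<lambda>i. ?S i (a i))"
    by (rule good_steps_adapted) (use inj a(2,4) in \<open>simp_all add: interleave_def\<close>)
  ultimately show ?thesis using sm a(1,2) by (intro exI[of _ a]) simp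
qed

end

text \<open>A copy of the diagram of \<open>P\<close> codes \<open>(X, \<sigma>)\<close> by itineraries, and its level partitions are the
  given ones.\<close>

lemma (in adapted_sequence) coding_copy:
  assumes H: "H \<in> LDiag" and iso: "ldiag_map D H \<psi>0 \<psi>1"
  shows "coding X \<sigma> H (\<lambda>x n. \<psi>1 (itinerary x n))"
    and "coding.level_partition X H (\<lambda>x n. \<psi>1 (itinerary x n)) n = P n"
proof -
  interpret H: l_diagram H by (rule l_diagram.intro[OF H])
  note c = ldiag_map_conj[OF partition_diagram_LDiag H iso] and i = ldiag_mapD[OF iso]
  show coding: "coding X \<sigma> H (\<lambda>x n. \<psi>1 (itinerary x n))"
  proof
    show "homeomorphic_map X (ray_topology H) (\<lambda>x n. \<psi>1 (itinerary x n))"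
      using homeomorphic_map_compose[OF itinerary_homeomorphic c(1)] by (simp add: comp_def)
    show "(\<lambda>n. \<psi>1 (itinerary (\<sigma> x) n)) = ray_shift H (\<lambda>n. \<psi>1 (itinerary x n))" if "x \<in> topspace X" for x
      using c(2)[OF itinerary_ray[OF that]] itinerary_shift[OF that] by simp
  qed
  have V: "rng H (\<psi>1 (itinerary x n)) = \<psi>0 (n, cell n x)" if "x \<in> topspace X" for x n
  proof -
    have "itinerary x n \<in> edges D n" using D.blue_edge[OF D.ray_edge[OF itinerary_ray[OF that]]] .
    from i(5)[OF this] show ?thesis by (simp add: itinerary_def)
  qed
  have "{x \<in> topspace X. rng H (\<psi>1 (itinerary x n)) = \<psi>0 (n, Z)} = Z" if Z: "Z \<in> P n" for Z
  proof -
    have "\<psi>0 (n, cell n x) = \<psi>0 (n, Z) \<longleftrightarrow> cell n x = Z" if x: "x \<in> topspace X" for x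
    proof -
      have "(n, cell n x) \<in> (\<Union>n. verts D n)" "(n, Z) \<in> (\<Union>n. verts D n)" using Z cell(1)[OF x, of n]
        by auto
      then show ?thesis using inj_on_eq_iff[OF bij_betw_imp_inj_on[OF i(1)]] by simp
    qed
    then have "{x \<in> topspace X. rng H (\<psi>1 (itinerary x n)) = \<psi>0 (n, Z)} = {x \<in> topspace X. cell n x =
      Z}"
      using V by auto
    also have "\<dots> = Z"
    proof (intro equalityI subsetI)
      fix x assume "x \<in> {x \<in> topspace X. cell n x = Z}"
      then show "x \<in> Z" using cell(2)[of x n] by simp
    next
      fix x assume x: "x \<in> Z"
      then show "x \<in> {x \<in> topspace X. cell n x = Z}" using cell(3)[OF Z x] cell(4)[OF Z] by blast
    qed
    finally show ?thesis .
  qed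
  then have "(\<lambda>Z. {x \<in> topspace X. rng H (\<psi>1 (itinerary x n)) = \<psi>0 (n, Z)}) ` P n = P n" by simp
  moreover have "verts D n = Pair n ` P n" by auto
  ultimately have "(\<lambda>v. {x \<in> topspace X. rng H (\<psi>1 (itinerary x n)) = v}) ` \<psi>0 ` verts D n = P n"
    by (simp only: image_image)
  then show "coding.level_partition X H (\<lambda>x n. \<psi>1 (itinerary x n)) n = P n"
    unfolding coding.level_partition_def[OF coding] coding.vertex_cell_def[OF coding] i(3)[symmetric] .
qed

text \<open>If \<open>R\<close> has infinitely many partitions in common with the levels of \<open>F\<close>, then \<open>F\<close> and the diagram
  of \<open>R\<close> both contract to the diagram \<open>L\<close> of the common subsequence.\<close>

lemma coding_equiv:
  fixes F H :: "(nat, nat) cdiagram"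
  assumes F: "coding X \<sigma> F h" and b: "contraction_levels b" "2 \<le> b 0"
    and R: "adapted_sequence X \<sigma> R" and \<mu>: "contraction_levels \<mu>" "2 \<le> \<mu> 0"
    and eq: "\<And>n. R (\<mu> n) = coding.level_partition X F h (b n)"
    and H: "H \<in> LDiag" and iso: "ldiag_iso (partition_diagram \<sigma> R) H"
  shows "equivclp l_step F H"
proof -
  interpret F: contracted_coding X \<sigma> F h b
    by (intro contracted_coding.intro F contracted_diagram.intro contracted_diagram_axioms.intro b
        contracted_coding_axioms.intro coding.axioms(2)[OF F])
  interpret R: adapted_sequence X \<sigma> R by (rule R)
  obtain \<psi>0 \<psi>1 where m: "ldiag_map (partition_diagram \<sigma> R) H \<psi>0 \<psi>1" using iso
    unfolding ldiag_iso_map by blast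
  note cH = R.coding_copy[OF H m]
  interpret H: contracted_coding X \<sigma> H "\<lambda>x n. \<psi>1 (R.itinerary x n)" \<mu>
    by (intro contracted_coding.intro cH(1) contracted_diagram.intro contracted_diagram_axioms.intro \<mu>
        contracted_coding_axioms.intro l_diagram.intro H)
  have e: "(\<lambda>n. H.level_partition (\<mu> n)) = (\<lambda>n. F.level_partition (b n))" using cH(2) eq by simp
  obtain L :: "(nat, nat) cdiagram" where L: "L \<in> LDiag" "ldiag_iso F.D' L"
    using ldiag_nat_copy[OF F.S.partition_diagram_LDiag] by blast
  have "ldiag_iso F.K L"
    by (rule ldiag_iso_trans[OF coloured_diagramD(3)[OF F.coloured_K] F.contraction_iso L(2)])
  then have 1: "l_step F L" using F.F.LDiag L(1) b(1) by (auto simp: l_step_def)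
  have HD: "ldiag_iso H.K F.D'" using H.contraction_iso unfolding e .
  have "ldiag_iso H.K L"
    by (rule ldiag_iso_trans[OF coloured_diagramD(3)[OF H.coloured_K] HD L(2)])
  then have 2: "l_step H L" using H L(1) \<mu>(1) by (auto simp: l_step_def)
  have "equivclp l_step F L" "equivclp l_step L H" using 1 2
    by (simp_all add: r_into_equivclp equivclp_sym)
  then show ?thesis by (rule equivclp_trans)
qed

text \<open>Both diagrams are coded on the same space, the rays of \<open>F\<close>, and both are equivalent to the diagram
  of the interleaved sequence.\<close>

theorem conj_l_rel:
  assumes F: "F \<in> LDiag" and G: "G \<in> LDiag" and c: "top_conj (ray_system F) (ray_system G)"
  shows "(F, G) \<in> l_rel"
proof -
  interpret F: l_diagram F by (rule l_diagram.intro[OF F])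
  interpret G: l_diagram G by (rule l_diagram.intro[OF G])
  let ?X = "ray_topology F" and ?\<sigma> = "ray_shift F"
  have L: "(?X, ?\<sigma>) \<in> LHomeo" using F.ray_system_LHomeo by (simp add: ray_system_def)
  interpret X: lhomeo ?X ?\<sigma> by (rule lhomeo.intro[OF L])
  obtain k where k: "homeomorphic_map ?X (ray_topology G) k"
    "\<forall>x \<in> topspace ?X. k (?\<sigma> x) = ray_shift G (k x)"
    using c unfolding top_conj_def ray_system_def by auto
  interpret cF: coding ?X ?\<sigma> F "\<lambda>x. x"
    by unfold_locales (simp_all add: homeomorphic_map_id[unfolded id_def])
  interpret cG: coding ?X ?\<sigma> G k
    by unfold_locales (use k in auto)
  have id: "strict_mono (\<lambda>n::nat. n)" by (simp add: strict_mono_def)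
  let ?P = "cF.level_partition" and ?Q = "cG.level_partition"
  obtain a where a: "strict_mono a" "\<And>i. even (a i) \<longleftrightarrow> even i" "2 \<le> a 0"
    "clopen_base ?X (\<lambda>i. interleave ?P ?Q i (a i))" "sigma_adapted ?\<sigma> (\<lambda>i. interleave ?P ?Q i (a i))"
    using X.interleaving[OF cF.level_base[OF id] cG.level_base[OF id]] cF.level_inj by blast
  let ?R = "\<lambda>i. interleave ?P ?Q i (a i)"
  have R: "adapted_sequence ?X ?\<sigma> ?R" by unfold_locales (rule a)+
  obtain H :: "(nat, nat) cdiagram" where H: "H \<in> LDiag" "ldiag_iso (partition_diagram ?\<sigma> ?R) H"
    using ldiag_nat_copy[OF adapted_sequence.partition_diagram_LDiag[OF R]] by blast
  have levels: "contraction_levels \<mu>" "contraction_levels (\<lambda>n. a (\<mu> n))" "2 \<le> a (\<mu> 0)"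
    if m: "\<And>n. \<mu> n < \<mu> (Suc n)" "\<And>n. even (\<mu> n) \<longleftrightarrow> even n" for \<mu>
  proof -
    have d: "odd (v - u)" if "u < v" "even u \<longleftrightarrow> odd v" for u v :: nat using that by auto
    have "odd (\<mu> (Suc n) - \<mu> n)" for n by (rule d[OF m(1)]) (simp add: m(2))
    then show "contraction_levels \<mu>" unfolding contraction_levels_def using m(1) m(2)[of 0] by blast
    have lt: "a (\<mu> n) < a (\<mu> (Suc n))" for n using a(1) m(1) by (simp add: strict_mono_less)
    have "odd (a (\<mu> (Suc n)) - a (\<mu> n))" for n by (rule d[OF lt]) (simp add: m(2) a(2))
    then show "contraction_levels (\<lambda>n. a (\<mu> n))"
      unfolding contraction_levels_def using lt m(2)[of 0] a(2)[of "\<mu> 0"] by blast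
    have "a 0 \<le> a (\<mu> 0)" using a(1) by (simp add: strict_mono_less_eq)
    then show "2 \<le> a (\<mu> 0)" using a(3) by simp
  qed
  \<comment> \<open>\<open>?\<mu>\<close> enumerates 4, 7, 8, 11, \<open>\<dots>\<close>, positions taken from \<open>F\<close>, and \<open>?\<nu>\<close> enumerates
    2, 5, 6, 9, \<open>\<dots>\<close>, positions taken from \<open>G\<close>; both start at an even position not below 2.\<close>
  let ?\<mu> = "\<lambda>n::nat. 2*n + 4 + n mod 2" and ?\<nu> = "\<lambda>n::nat. 2*n + 2 + n mod 2"
  have mF: "?\<mu> n < ?\<mu> (Suc n)" "even (?\<mu> n) \<longleftrightarrow> even n" "even ((?\<mu> n + 1) div 2)" for n by presburger+
  have mG: "?\<nu> n < ?\<nu> (Suc n)" "even (?\<nu> n) \<longleftrightarrow> even n" "odd ((?\<nu> n + 1) div 2)" for n by presburger+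
  have "equivclp l_step F H"
    by (rule coding_equiv[OF cF.coding_axioms levels(2,3)[OF mF(1,2)] R levels(1)[OF mF(1,2)] _ _ H])
      (use mF(3) in \<open>simp_all add: interleave_def\<close>)
  moreover have "equivclp l_step G H"
    by (rule coding_equiv[OF cG.coding_axioms levels(2,3)[OF mG(1,2)] R levels(1)[OF mG(1,2)] _ _ H])
      (use mG(3) in \<open>simp_all add: interleave_def\<close>)
  ultimately have "equivclp l_step F G" by (meson equivclp_sym equivclp_trans)
  then show ?thesis using F G by (simp add: l_rel_def)
qed

section \<open>The correspondence of classes\<close>

lemma ray_LHomeo: "F \<in> LDiag \<Longrightarrow> ray_system F \<in> LHomeo"
  by (rule l_diagram.ray_system_LHomeo[OF l_diagram.intro])

lemma sigma_refined_diagram: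
  assumes L: "(X, \<sigma>) \<in> LHomeo" and d: "compatible_metric X d" and P: "sigma_refined X d \<sigma> P"
  shows "partition_diagram \<sigma> P \<in> LDiag" "top_conj (X, \<sigma>) (ray_system (partition_diagram \<sigma> P))"
proof -
  interpret lhomeo X \<sigma> by (rule lhomeo.intro[OF L])
  interpret adapted_sequence X \<sigma> P by unfold_locales (use P sigma_refined_iff[OF d] in blast)+
  show "partition_diagram \<sigma> P \<in> LDiag" "top_conj (X, \<sigma>) (ray_system (partition_diagram \<sigma> P))"
    by (rule partition_diagram_LDiag, rule top_conj_ray_system)
qed

lemma sigma_refined_exists:
  assumes "(X, \<sigma>) \<in> LHomeo" "compatible_metric X d"
  shows "\<exists>P. sigma_refined X d \<sigma> P"
  using lhomeo.adapted_exists[OF lhomeo.intro[OF assms(1)]]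
    lhomeo.sigma_refined_iff[OF lhomeo.intro[OF assms(1)] assms(2)] by blast

lemma compatible_metric_exists:
  assumes "(X, \<sigma>) \<in> LHomeo"
  shows "\<exists>d. compatible_metric X d"
  using lhomeo.metrizable[OF lhomeo.intro[OF assms]] Metric_space.topspace_mtopology
  unfolding metrizable_space_def compatible_metric_def by metis

text \<open>In particular every system, over any type, is conjugate to one whose space consists of functions
  \<open>nat \<Rightarrow> nat\<close>, so no class is empty.\<close>

lemma nat_diagram_exists:
  assumes "p \<in> LHomeo"
  shows "\<exists>G :: (nat, nat) cdiagram. G \<in> LDiag \<and> top_conj p (ray_system G)"
proof -
  obtain X \<sigma> where p: "p = (X, \<sigma>)" by (cases p)
  have L: "(X, \<sigma>) \<in> LHomeo" using assms p by simp
  obtain d where d: "compatible_metric X d" using compatible_metric_exists[OF L] by blast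
  obtain P where P: "sigma_refined X d \<sigma> P" using sigma_refined_exists[OF L d] by blast
  note D = sigma_refined_diagram[OF L d P]
  obtain G :: "(nat, nat) cdiagram" where G: "G \<in> LDiag" "ldiag_iso (partition_diagram \<sigma> P) G"
    using ldiag_nat_copy[OF D(1)] by blast
  show ?thesis using G(1) top_conj_trans[OF D(2) ray_system_iso[OF D(1) G]] p by blast
qed

text \<open>The equivalence of \<open>\<sim>\<^sub>l\<close> with conjugacy of ray systems, in the form that covers diagrams over
  arbitrary types.\<close>

lemma in_l_class_iff:
  assumes F: "F \<in> LDiag"
  shows "G \<in> l_class F \<longleftrightarrow> G \<in> LDiag \<and> top_conj (ray_system F) (ray_system G)"
proof
  assume "G \<in> l_class F"
  then obtain G0 where G0: "ldiag_iso F G0" "(G0, G) \<in> l_rel" by (auto simp: l_class_def)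
  then have "G0 \<in> LDiag" "G \<in> LDiag" by (auto simp: l_rel_def)
  then show "G \<in> LDiag \<and> top_conj (ray_system F) (ray_system G)"
    using top_conj_trans[OF ray_system_iso[OF F _ G0(1)] l_rel_conj[OF G0(2)]] by blast
next
  assume G: "G \<in> LDiag \<and> top_conj (ray_system F) (ray_system G)"
  obtain G0 :: "(nat, nat) cdiagram" where G0: "G0 \<in> LDiag" "ldiag_iso F G0"
    using ldiag_nat_copy[OF F] by blast
  have "top_conj (ray_system G0) (ray_system F)"
    by (rule top_conj_sym[OF ray_LHomeo[OF F] ray_system_iso[OF F G0]])
  then have "top_conj (ray_system G0) (ray_system G)" using G top_conj_trans by blast
  then have "(G0, G) \<in> l_rel" using conj_l_rel[OF G0(1)] G by blast
  then show "G \<in> l_class F" using G0(2) by (auto simp: l_class_def)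
qed

lemma tc_class_eq:
  assumes "p \<in> LHomeo" "top_conj p q"
  shows "tc_class p = tc_class q"
  unfolding tc_class_def using top_conj_trans[OF assms(2)]
    top_conj_trans[OF top_conj_sym[OF assms]] by blast

lemma l_class_eq:
  assumes "F \<in> LDiag" "G \<in> LDiag" "top_conj (ray_system F) (ray_system G)"
  shows "l_class F = l_class G"
  using in_l_class_iff[OF assms(1)] in_l_class_iff[OF assms(2)] top_conj_trans[OF assms(3)]
    top_conj_trans[OF top_conj_sym[OF ray_LHomeo[OF assms(1)] assms(3)]] by blast

lemma l_class_eq_conj:
  assumes F: "F \<in> LDiag" and G: "G \<in> LDiag" and e: "l_class F = l_class G"
  shows "top_conj (ray_system F) (ray_system G)"
proof -
  obtain G0 :: "(nat, nat) cdiagram" where G0: "G0 \<in> LDiag" "ldiag_iso G G0"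
    using ldiag_nat_copy[OF G] by blast
  note c = ray_system_iso[OF G G0]
  have "G0 \<in> l_class F" unfolding e in_l_class_iff[OF G] using G0(1) c by blast
  then have "top_conj (ray_system F) (ray_system G0)" unfolding in_l_class_iff[OF F] by blast
  then show ?thesis using top_conj_trans top_conj_sym[OF ray_LHomeo[OF G] c] by blast
qed

lemma l_class_image: "G \<in> LDiag \<Longrightarrow> l_rel `` {G} = l_class G"
  using in_l_class_iff[of G] l_rel_conj conj_l_rel[of G] by (auto simp: l_rel_def)

lemma tc_class_image: "q \<in> LHomeo \<Longrightarrow> tc_rel `` {q} = tc_class q"
  by (auto simp: tc_rel_def tc_class_def)

lemma l_class_quotient:
  assumes "F \<in> LDiag"
  shows "l_class F \<in> LDiag // l_rel"
proof -
  obtain G :: "(nat, nat) cdiagram" where G: "G \<in> LDiag" "ldiag_iso F G"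
    using ldiag_nat_copy[OF assms] by blast
  have "l_class F = l_rel `` {G}"
    using l_class_eq[OF assms G(1) ray_system_iso[OF assms G]] l_class_image[OF G(1)] by simp
  then show ?thesis using quotientI[OF G(1), of l_rel] by simp
qed

lemma tc_class_quotient:
  assumes "p \<in> LHomeo"
  shows "tc_class p \<in> LHomeo // tc_rel"
proof -
  obtain G :: "(nat, nat) cdiagram" where G: "G \<in> LDiag" "top_conj p (ray_system G)"
    using nat_diagram_exists[OF assms] by blast
  have "tc_class p = tc_rel `` {ray_system G}"
    using tc_class_eq[OF assms G(2)] tc_class_image[OF ray_LHomeo[OF G(1)]] by simp
  then show ?thesis using quotientI[OF ray_LHomeo[OF G(1)], of tc_rel] by simp
qed

lemma diagram_class_eq:
  assumes "(X, \<sigma>) \<in> LHomeo" "compatible_metric X d" "sigma_refined X d \<sigma> P"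
    and "(Y, \<tau>) \<in> LHomeo" "compatible_metric Y e" "sigma_refined Y e \<tau> Q"
    and c: "top_conj (X, \<sigma>) (Y, \<tau>)"
  shows "l_class (partition_diagram \<sigma> P) = l_class (partition_diagram \<tau> Q)"
proof -
  note D = sigma_refined_diagram[OF assms(1-3)] and E = sigma_refined_diagram[OF assms(4-6)]
  show ?thesis
    by (rule l_class_eq[OF D(1) E(1)
          top_conj_trans[OF top_conj_sym[OF assms(1) D(2)] top_conj_trans[OF c E(2)]]])
qed

lemma Phi_tc_class:
  assumes L: "(X, \<sigma>) \<in> LHomeo" and d: "compatible_metric X d" and P: "sigma_refined X d \<sigma> P"
  shows "Phi (tc_class (X, \<sigma>)) = l_class (partition_diagram \<sigma> P)"
  unfolding Phi_def
proof (rule the_equality)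
  obtain G :: "(nat, nat) cdiagram" where G: "G \<in> LDiag" "top_conj (X, \<sigma>) (ray_system G)"
    using nat_diagram_exists[OF L] by blast
  obtain Y \<tau> where Y: "ray_system G = (Y, \<tau>)" by (cases "ray_system G")
  have LY: "(Y, \<tau>) \<in> LHomeo" and c: "top_conj (X, \<sigma>) (Y, \<tau>)" using ray_LHomeo[OF G(1)] G(2) Y
    by simp_all
  obtain e where e: "compatible_metric Y e" using compatible_metric_exists[OF LY] by blast
  obtain Q where Q: "sigma_refined Y e \<tau> Q" using sigma_refined_exists[OF LY e] by blast
  have "(Y, \<tau>) \<in> tc_class (X, \<sigma>)" using LY c by (simp add: tc_class_def)
  then show "\<exists>Y \<tau> e Q. (Y, \<tau>) \<in> tc_class (X, \<sigma>) \<and> compatible_metric Y e \<and> sigma_refined Y e \<tau> Q \<and>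
      l_class (partition_diagram \<sigma> P) = l_class (partition_diagram \<tau> Q)"
    using e Q diagram_class_eq[OF L d P LY e Q c] by blast
next
  fix C assume "\<exists>Y \<tau> e Q. (Y, \<tau>) \<in> tc_class (X, \<sigma>) \<and> compatible_metric Y e \<and> sigma_refined Y e \<tau> Q \<and>
      C = l_class (partition_diagram \<tau> Q)"
  then obtain Y \<tau> e Q where Y: "(Y, \<tau>) \<in> tc_class (X, \<sigma>)" "compatible_metric Y e"
    "sigma_refined Y e \<tau> Q"
    "C = l_class (partition_diagram \<tau> Q)" by blast
  have "(Y, \<tau>) \<in> LHomeo" "top_conj (X, \<sigma>) (Y, \<tau>)" using Y(1) by (simp_all add: tc_class_def)
  then show "C = l_class (partition_diagram \<sigma> P)" using diagram_class_eq[OF L d P _ Y(2,3)] Y(4) by simp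
qed

lemma Psi_l_class:
  assumes F: "F \<in> LDiag"
  shows "Psi (l_class F) = tc_class (ray_system F)"
  unfolding Psi_def
proof (rule the_equality)
  have eq: "tc_class (ray_system F) = tc_class (ray_system G)" if "G \<in> l_class F" for G
    using that tc_class_eq[OF ray_LHomeo[OF F]] unfolding in_l_class_iff[OF F] by blast
  obtain G :: "(nat, nat) cdiagram" where G: "G \<in> LDiag" "ldiag_iso F G" using ldiag_nat_copy[OF F]
    by blast
  have "G \<in> l_class F" unfolding in_l_class_iff[OF F] using G(1) ray_system_iso[OF F G] by blast
  then show "\<exists>G \<in> l_class F. tc_class (ray_system F) = tc_class (ray_system G)" using eq by blast
  show "c = tc_class (ray_system F)" if "\<exists>G \<in> l_class F. c = tc_class (ray_system G)" for c
    using that eq by blast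
qed

text \<open>A system is conjugate to the ray system of its diagram.\<close>

lemma Psi_Phi:
  assumes "c \<in> LHomeo // tc_rel"
  shows "Phi c \<in> LDiag // l_rel \<and> Psi (Phi c) = c"
proof -
  obtain q where q: "q \<in> LHomeo" "c = tc_rel `` {q}" using assms by (rule quotientE)
  obtain X \<sigma> where X: "q = (X, \<sigma>)" by (cases q)
  have L: "(X, \<sigma>) \<in> LHomeo" and c: "c = tc_class (X, \<sigma>)" using q tc_class_image[OF q(1)] X by simp_all
  obtain d where d: "compatible_metric X d" using compatible_metric_exists[OF L] by blast
  obtain P where P: "sigma_refined X d \<sigma> P" using sigma_refined_exists[OF L d] by blast
  note D = sigma_refined_diagram[OF L d P]
  have "Phi c = l_class (partition_diagram \<sigma> P)" unfolding c by (rule Phi_tc_class[OF L d P])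
  moreover have "Psi (l_class (partition_diagram \<sigma> P)) = c"
    unfolding c Psi_l_class[OF D(1)] by (rule tc_class_eq[OF L D(2), symmetric])
  ultimately show ?thesis using l_class_quotient[OF D(1)] by simp
qed

text \<open>The diagram of a \<open>\<sigma>\<close>-refined sequence for the ray system of \<open>G\<close> need not be \<open>G\<close>, but its ray system
  is conjugate to that of \<open>G\<close>, and this decides the class.\<close>

lemma Phi_Psi:
  assumes "C \<in> LDiag // l_rel"
  shows "Psi C \<in> LHomeo // tc_rel \<and> Phi (Psi C) = C"
proof -
  obtain G where G: "G \<in> LDiag" "C = l_rel `` {G}" using assms by (rule quotientE)
  have C: "C = l_class G" using l_class_image[OF G(1)] G(2) by simp
  have P: "Psi C = tc_class (ray_system G)" unfolding C by (rule Psi_l_class[OF G(1)])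
  obtain X \<sigma> where X: "ray_system G = (X, \<sigma>)" by (cases "ray_system G")
  have L: "(X, \<sigma>) \<in> LHomeo" using ray_LHomeo[OF G(1)] X by simp
  obtain d where d: "compatible_metric X d" using compatible_metric_exists[OF L] by blast
  obtain Q where Q: "sigma_refined X d \<sigma> Q" using sigma_refined_exists[OF L d] by blast
  note D = sigma_refined_diagram[OF L d Q]
  have "Phi (Psi C) = l_class (partition_diagram \<sigma> Q)" unfolding P X by (rule Phi_tc_class[OF L d Q])
  also have "\<dots> = C" unfolding C by (rule l_class_eq[OF G(1) D(1), symmetric]) (use D(2) X in simp)
  finally show ?thesis using P tc_class_quotient[OF ray_LHomeo[OF G(1)]] by simp
qed

theorem theorem1p1:
  shows
   "(\<forall>(X :: 'a topology) \<sigma>. (X, \<sigma>) \<in> LHomeo \<longrightarrow>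
       tc_class (X, \<sigma>) \<in> LHomeo // tc_rel \<and>
       (\<forall>d. compatible_metric X d \<longrightarrow>
          (\<exists>P. sigma_refined X d \<sigma> P) \<and>
          (\<forall>P. sigma_refined X d \<sigma> P \<longrightarrow>
             partition_diagram \<sigma> P \<in> LDiag \<and>
             Phi (tc_class (X, \<sigma>)) = l_class (partition_diagram \<sigma> P)))) \<and>
    (\<forall>(X1 :: 'a topology) \<sigma>1 d1 P1 (X2 :: 'b topology) \<sigma>2 d2 P2.
       (X1, \<sigma>1) \<in> LHomeo \<and> compatible_metric X1 d1 \<and> sigma_refined X1 d1 \<sigma>1 P1 \<and>
       (X2, \<sigma>2) \<in> LHomeo \<and> compatible_metric X2 d2 \<and> sigma_refined X2 d2 \<sigma>2 P2 \<and>
       top_conj (X1, \<sigma>1) (X2, \<sigma>2) \<longrightarrow>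
       l_class (partition_diagram \<sigma>1 P1) = l_class (partition_diagram \<sigma>2 P2)) \<and>
    Phi \<in> (LHomeo // tc_rel) \<rightarrow> (LDiag // l_rel) \<and>
    (\<forall>F :: ('v, 'e) cdiagram. F \<in> LDiag \<longrightarrow>
       l_class F \<in> LDiag // l_rel \<and>
       ray_system F \<in> LHomeo \<and>
       Psi (l_class F) = tc_class (ray_system F)) \<and>
    (\<forall>(F1 :: ('v, 'e) cdiagram) (F2 :: ('w, 'f) cdiagram).
       F1 \<in> LDiag \<and> F2 \<in> LDiag \<and> l_class F1 = l_class F2 \<longrightarrow>
       top_conj (ray_system F1) (ray_system F2)) \<and>
    Psi \<in> (LDiag // l_rel) \<rightarrow> (LHomeo // tc_rel) \<and>
    (\<forall>c \<in> LHomeo // tc_rel. Psi (Phi c) = c) \<and>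
    (\<forall>C \<in> LDiag // l_rel. Phi (Psi C) = C) \<and>
    bij_betw Phi (LHomeo // tc_rel) (LDiag // l_rel)"
proof (intro conjI allI impI ballI)
  fix X :: "'a topology" and \<sigma> assume L: "(X, \<sigma>) \<in> LHomeo"
  show "tc_class (X, \<sigma>) \<in> LHomeo // tc_rel" by (rule tc_class_quotient[OF L])
  fix d assume d: "compatible_metric X d"
  show "\<exists>P. sigma_refined X d \<sigma> P" by (rule sigma_refined_exists[OF L d])
  fix P assume P: "sigma_refined X d \<sigma> P"
  show "partition_diagram \<sigma> P \<in> LDiag" by (rule sigma_refined_diagram(1)[OF L d P])
  show "Phi (tc_class (X, \<sigma>)) = l_class (partition_diagram \<sigma> P)" by (rule Phi_tc_class[OF L d P])
next
  fix X1 :: "'a topology" and \<sigma>1 d1 P1 and X2 :: "'b topology" and \<sigma>2 d2 P2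
  assume "(X1, \<sigma>1) \<in> LHomeo \<and> compatible_metric X1 d1 \<and> sigma_refined X1 d1 \<sigma>1 P1 \<and>
       (X2, \<sigma>2) \<in> LHomeo \<and> compatible_metric X2 d2 \<and> sigma_refined X2 d2 \<sigma>2 P2 \<and>
       top_conj (X1, \<sigma>1) (X2, \<sigma>2)"
  then show "l_class (partition_diagram \<sigma>1 P1) = l_class (partition_diagram \<sigma>2 P2)"
    by (elim conjE) (rule diagram_class_eq)
next
  show "Phi \<in> (LHomeo // tc_rel) \<rightarrow> (LDiag // l_rel)" using Psi_Phi by blast
  show "Psi \<in> (LDiag // l_rel) \<rightarrow> (LHomeo // tc_rel)" using Phi_Psi by blast
  show "Psi (Phi c) = c" if "c \<in> LHomeo // tc_rel" for c using Psi_Phi[OF that] by blast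
  show "Phi (Psi C) = C" if "C \<in> LDiag // l_rel" for C using Phi_Psi[OF that] by blast
  show "bij_betw Phi (LHomeo // tc_rel) (LDiag // l_rel)"
    by (rule bij_betw_byWitness[where f' = Psi]) (use Psi_Phi Phi_Psi in auto)
next
  fix F :: "('v, 'e) cdiagram" assume F: "F \<in> LDiag"
  show "l_class F \<in> LDiag // l_rel" by (rule l_class_quotient[OF F])
  show "ray_system F \<in> LHomeo" by (rule ray_LHomeo[OF F])
  show "Psi (l_class F) = tc_class (ray_system F)" by (rule Psi_l_class[OF F])
next
  fix F1 :: "('v, 'e) cdiagram" and F2 :: "('w, 'f) cdiagram"
  assume "F1 \<in> LDiag \<and> F2 \<in> LDiag \<and> l_class F1 = l_class F2"
  then show "top_conj (ray_system F1) (ray_system F2)" by (elim conjE) (rule l_class_eq_conj)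
qed

end
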